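(* Consider one of the following five regression models: Poisson regression with log-linear link, normal linear regression with known variance, exponential regression with log-linear link, binary logistic regression, or binary probit regression, with i.i.d. data $D^n$ from the true density $p^*(y|x)=f(y,x^T\beta^* )$ and with the truncated i.i.d.-binary / Gaussian variable selection prior with parameters $r_n,\bar r_n,\{V_\gamma\}$, all as described in the context. Assume that for some positive constants $B$ and $v$, $$\max\Big\{\sup_{\gamma:|\gamma|\le\bar r_n}\mathrm{ch}_1(V_\gamma),\ \sup_{\gamma:|\gamma|\le\bar r_n}\mathrm{ch}_1(V_\gamma^{-1})\Big\}\le B\,\bar r_n^{\,v}$$ for all large enough $\bar r_n$. Suppose $|x_j|\le1$ for all $j$ and $\lim_{n\to\infty}\sum_{j=1}^{K_n}|\beta_j^*|<\infty$, where $K_n$ is nondecreasing in $n$ and $K_n\succ n^\delta$ for some $\delta>0$. Let $\varepsilon_n\in(0,1]$ be a sequence with $n\varepsilon_n^2\succ1$, and assume $$\bar r_n\ln(K_n)\prec n\varepsilon_n^2,\qquad 1\le r_n\le\bar r_n<K_n,\qquad 1\prec r_n\prec K_n,\qquad \Delta(r_n)\equiv\inf_{\gamma:|\gamma|=r_n}\sum_{j:j\notin\gamma}|\beta_j^*|\prec\varepsilon_n^2.$$ Assume also that $\bar r_n\prec(n\varepsilon_n^2)^{1/v}$ in the case of normal linear, binary logistic or binary probit regression, or that $\bar r_n\prec(n\varepsilon_n^2)^{1/(4+v)}$ in the case of Poisson or exponential regression with log-linear link. Let $d(p,p^* )^2=\int\int|p(y,x|\gamma,\beta_\gamma)^{1/2}-p^*(y,x)^{1/2}|^2\,\nu_y(dy)\,\nu_x(dx)$.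 Then: (i) for some $r_0>0$, $\lim_{n\to\infty}P^*\{\pi[d(p,p^* )\le\varepsilon_n|D^n]\ge1-e^{-r_0n\varepsilon_n^2}\}=1$; (ii) for some $c_1>0$ and all sufficiently large $n$, $P^*\{\pi[d(p,p^* )>\varepsilon_n|D^n]\ge e^{-0.5c_1n\varepsilon_n^2}\}\le e^{-0.5c_1n\varepsilon_n^2}$; (iii) for some $c_1>0$ and all sufficiently large $n$, $E^*_{D^n}\,\pi[d(p,p^* )>\varepsilon_n|D^n]\le e^{-c_1n\varepsilon_n^2}$.
   Context: Notation. For sequences, $a_n\prec b_n$ (equivalently $b_n\succ a_n$) means $\lim_{n\to\infty}a_n/b_n=0$. $\mathrm{ch}_1$ denotes the largest eigenvalue of a symmetric matrix. Model. For each $n$, $x=(x_1,\dots,x_{K_n})^T$ is a random vector with probability law $\nu_x(dx)$, and $y$ is a real response with dominating measure $\nu_y(dy)$ (counting measure for discrete responses, Lebesgue measure for continuous ones). The conditional density of $y$ given linear parameter $h\in\mathbb R$ is $f(y,h)$, one of: Poisson regression: $f(y,h)=\exp\{hy-e^h-\ln(y!)\}$, $y\in\{0,1,2,\dots\}$; normal linear regression: $f(y,h)=(2\pi\sigma^2)^{-1/2}e^{-(y-h)^2/(2\sigma^2)}$, $y\in\mathbb R$, with $\sigma^2>0$ known; exponential regression: $f(y,h)=\exp\{-e^{-h}y-h\}$, $y\in(0,\infty)$; binary logistic regression: $f(y,h)=\exp\{hy-\ln(1+e^h)\}$, $y\in\{0,1\}$; binary probit regression: $f(y,h)=\Phi(h)^y(1-\Phi(h))^{1-y}$,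 $y\in\{0,1\}$, $\Phi$ the standard normal distribution function. The true conditional density of $y$ given $x$ is $p^*(y|x)=f(y,x^T\beta^* )$ for a true vector $\beta^*=(\beta_1^*,\dots,\beta_{K_n}^* )^T$; it is also the joint density $p^*(y,x)$ with respect to $\nu_x(dx)\nu_y(dy)$. The data $D^n=(x^{(i)},y^{(i)})_{i=1}^n$ are i.i.d. from $p^*\,\nu_x(dx)\nu_y(dy)$; $P^*$ and $E^*_{D^n}$ denote probability and expectation for $D^n$. Fitted models. A model is $\gamma=(\gamma_1,\dots,\gamma_{K_n})\in\{0,1\}^{K_n}$, identified with the index set $\{j:\gamma_j=1\}$; $|\gamma|$ is its size; $v_\gamma$ is the subvector of $v$ with indices in $\gamma$. With coefficients $\beta_\gamma\in\mathbb R^{|\gamma|}$ the fitted density is $p(y,x|\gamma,\beta_\gamma)=f(y,x_\gamma^T\beta_\gamma)$ (linear parameter $0$ for the empty model). Suprema of eigenvalues of $V_\gamma$ and $V_\gamma^{-1}$ are over nonempty $\gamma\subset\{1,\dots,K_n\}$. Prior. $r_n\le\bar r_n$ are integers. Let $\tilde\gamma_1,\dots,\tilde\gamma_{K_n}$ be i.i.d. binary with $\pi(\tilde\gamma_j=1)=\lambda_n=r_n/K_n$; $\gamma$ is distributed as $\tilde\gamma$ conditioned on $\sum_j\tilde\gamma_j\le\bar r_n$, i.e. $\pi(\gamma)\propto\prod_{j=1}^{K_n}\lambda_n^{\gamma_j}(1-\lambda_n)^{1-\gamma_j}\,I[\sum_l\gamma_l\le\bar r_n]$. Conditional on $\gamma$,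 $\beta_\gamma\sim N(0,V_\gamma)$ with $V_\gamma$ a given $|\gamma|\times|\gamma|$ (positive definite) covariance matrix. The posterior is $$\pi(\gamma,d\beta_\gamma|D^n)=\frac{\prod_{i=1}^np(y^{(i)},x^{(i)}|\gamma,\beta_\gamma)\,\pi(\gamma,d\beta_\gamma)}{\sum_{\gamma'}\int\prod_{i=1}^np(y^{(i)},x^{(i)}|\gamma',\beta'_{\gamma'})\,\pi(\gamma',d\beta'_{\gamma'})},$$ and it induces a posterior distribution on densities $p=p(\cdot|\gamma,\beta_\gamma)$. *)

theory Defs
  imports "HOL-Probability.Probability" "Jordan_Normal_Form.Char_Poly"
    "Jordan_Normal_Form.Gauss_Jordan_Elimination"
begin

definition prec :: "(nat \<Rightarrow> real) \<Rightarrow> (nat \<Rightarrow> real) \<Rightarrow> bool" where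
  "prec a b \<longleftrightarrow> (\<lambda>n. a n / b n) \<longlonglongrightarrow> 0"

text \<open>The argument of \<open>Normal_Linear\<close> is the known standard deviation.\<close>
datatype regression =
  Poisson | is_Normal_Linear: Normal_Linear real | Exponential | Logistic | Probit

definition valid_regression :: "regression \<Rightarrow> bool" where
  "valid_regression m \<longleftrightarrow> (\<forall>\<sigma>. m = Normal_Linear \<sigma> \<longrightarrow> \<sigma> > 0)"

definition std_normal_cdf :: "real \<Rightarrow> real" where
  "std_normal_cdf = cdf std_normal_distribution"

text \<open>Responses are real numbers in every model; the dominating measure, a measure on the Borel
  sets of the line, lives on the actual range of the response. Values of the density formula
  outside that range are irrelevant.\<close>
fun response_measure :: "regression \<Rightarrow> real measure" where
  "response_measure Poisson = distr (count_space \<nat>) borel (\<lambda>y. y)"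
| "response_measure (Normal_Linear \<sigma>) = lborel"
| "response_measure Exponential = density lborel (indicator {0<..})"
| "response_measure Logistic = distr (count_space {0, 1}) borel (\<lambda>y. y)"
| "response_measure Probit = distr (count_space {0, 1}) borel (\<lambda>y. y)"

fun reg_density :: "regression \<Rightarrow> real \<Rightarrow> real \<Rightarrow> real" where
  "reg_density Poisson y h = exp (h * y - exp h - ln (fact (nat \<lfloor>y\<rfloor>)))"
| "reg_density (Normal_Linear \<sigma>) y h = normal_density h \<sigma> y"
| "reg_density Exponential y h = exp (- exp (- h) * y - h)"
| "reg_density Logistic y h = exp (h * y - ln (1 + exp h))"
| "reg_density Probit y h = std_normal_cdf h powr y * (1 - std_normal_cdf h) powr (1 - y)"

text \<open>Models are finite index sets \<open>\<gamma> \<subseteq> {1..K}\<close>; a vector indexed by \<open>\<gamma>\<close> is a function on \<open>\<gamma>\<close>.\<close>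
definition lin_param :: "nat set \<Rightarrow> (nat \<Rightarrow> real) \<Rightarrow> (nat \<Rightarrow> real) \<Rightarrow> real" where
  "lin_param \<gamma> b x = (\<Sum>j\<in>\<gamma>. x j * b j)"

definition model_density ::
    "regression \<Rightarrow> nat set \<Rightarrow> (nat \<Rightarrow> real) \<Rightarrow> (nat \<Rightarrow> real) \<Rightarrow> real \<Rightarrow> real" where
  "model_density m \<gamma> b x y = reg_density m y (lin_param \<gamma> b x)"

definition true_density ::
    "regression \<Rightarrow> nat \<Rightarrow> (nat \<Rightarrow> real) \<Rightarrow> (nat \<Rightarrow> real) \<Rightarrow> real \<Rightarrow> real" where
  "true_density m K bs x y = reg_density m y (lin_param {1..K} bs x)"

definition sample_law ::
    "regression \<Rightarrow> nat \<Rightarrow> (nat \<Rightarrow> real) \<Rightarrow> (nat \<Rightarrow> real) measure \<Rightarrow> ((nat \<Rightarrow> real) \<times> real) measure" where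
  "sample_law m K bs \<nu> =
     density (\<nu> \<Otimes>\<^sub>M response_measure m) (\<lambda>(x, y). ennreal (true_density m K bs x y))"

definition data_law ::
    "regression \<Rightarrow> nat \<Rightarrow> (nat \<Rightarrow> real) \<Rightarrow> (nat \<Rightarrow> real) measure \<Rightarrow> nat \<Rightarrow>
      (nat \<Rightarrow> (nat \<Rightarrow> real) \<times> real) measure" where
  "data_law m K bs \<nu> n = PiM {1..n} (\<lambda>_. sample_law m K bs \<nu>)"

definition model_weight :: "nat \<Rightarrow> nat \<Rightarrow> nat \<Rightarrow> nat set \<Rightarrow> real" where
  "model_weight K r rbar \<gamma> =
     (if card \<gamma> \<le> rbar
      then \<Prod>j\<in>{1..K}. if j \<in> \<gamma> then real r / real K else 1 - real r / real K
      else 0)"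

definition model_prior :: "nat \<Rightarrow> nat \<Rightarrow> nat \<Rightarrow> nat set \<Rightarrow> real" where
  "model_prior K r rbar \<gamma> =
     model_weight K r rbar \<gamma> / (\<Sum>\<gamma>'\<in>Pow {1..K}. model_weight K r rbar \<gamma>')"

definition pos_def_mat :: "nat \<Rightarrow> real mat \<Rightarrow> bool" where
  "pos_def_mat k A \<longleftrightarrow> A \<in> carrier_mat k k \<and> transpose_mat A = A \<and>
     (\<forall>u\<in>carrier_vec k. u \<noteq> 0\<^sub>v k \<longrightarrow> scalar_prod u (A *\<^sub>v u) > 0)"

text \<open>Meaningful for symmetric matrices of positive dimension.\<close>
definition ch1 :: "real mat \<Rightarrow> real" where
  "ch1 A = Max {k. eigenvalue A k}"

definition inv_mat :: "real mat \<Rightarrow> real mat" where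
  "inv_mat A = the (mat_inverse A)"

text \<open>Rows and columns of the covariance matrix of \<open>\<gamma>\<close> follow the increasing enumeration of \<open>\<gamma>\<close>.\<close>
definition subvec :: "nat set \<Rightarrow> (nat \<Rightarrow> real) \<Rightarrow> real Matrix.vec" where
  "subvec \<gamma> b = Matrix.vec (card \<gamma>) (\<lambda>i. b (sorted_list_of_set \<gamma> ! i))"

text \<open>The centred Gaussian law with positive definite covariance matrix \<open>A\<close>, by its density.
  For empty \<open>\<gamma>\<close> it is the point mass on the empty vector.\<close>
definition coef_prior :: "nat set \<Rightarrow> real mat \<Rightarrow> (nat \<Rightarrow> real) measure" where
  "coef_prior \<gamma> A = density (PiM \<gamma> (\<lambda>_. lborel))
     (\<lambda>b. ennreal (exp (- scalar_prod (inv_mat A *\<^sub>v subvec \<gamma> b) (subvec \<gamma> b) / 2)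
        / sqrt ((2 * pi) ^ card \<gamma> * Determinant.det A)))"

text \<open>An event is a set of parameters \<open>(\<gamma>, b)\<close>.\<close>
definition posterior_mass ::
    "regression \<Rightarrow> nat \<Rightarrow> nat \<Rightarrow> nat \<Rightarrow> (nat set \<Rightarrow> real mat) \<Rightarrow> nat \<Rightarrow>
      (nat \<Rightarrow> (nat \<Rightarrow> real) \<times> real) \<Rightarrow> (nat set \<times> (nat \<Rightarrow> real)) set \<Rightarrow> ennreal" where
  "posterior_mass m K r rbar V n D A =
     (\<Sum>\<gamma>\<in>Pow {1..K}. ennreal (model_prior K r rbar \<gamma>) *
       (\<integral>\<^sup>+ b. ennreal (\<Prod>i=1..n. model_density m \<gamma> b (fst (D i)) (snd (D i))) * indicator A (\<gamma>, b)
          \<partial>coef_prior \<gamma> (V \<gamma>)))"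

definition posterior_prob ::
    "regression \<Rightarrow> nat \<Rightarrow> nat \<Rightarrow> nat \<Rightarrow> (nat set \<Rightarrow> real mat) \<Rightarrow> nat \<Rightarrow>
      (nat \<Rightarrow> (nat \<Rightarrow> real) \<times> real) \<Rightarrow> (nat set \<times> (nat \<Rightarrow> real)) set \<Rightarrow> real" where
  "posterior_prob m K r rbar V n D A =
     enn2real (posterior_mass m K r rbar V n D A / posterior_mass m K r rbar V n D UNIV)"

definition hellinger ::
    "regression \<Rightarrow> nat \<Rightarrow> (nat \<Rightarrow> real) \<Rightarrow> (nat \<Rightarrow> real) measure \<Rightarrow> nat set \<Rightarrow> (nat \<Rightarrow> real) \<Rightarrow> real" where
  "hellinger m K bs \<nu> \<gamma> b = sqrt (\<integral>x. (\<integral>y.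
      \<bar>sqrt (model_density m \<gamma> b x y) - sqrt (true_density m K bs x y)\<bar>\<^sup>2
      \<partial>response_measure m) \<partial>\<nu>)"

definition tail_sum :: "nat \<Rightarrow> (nat \<Rightarrow> real) \<Rightarrow> nat \<Rightarrow> real" where
  "tail_sum K bs r =
     (INF \<gamma>\<in>{\<gamma>. \<gamma> \<subseteq> {1..K} \<and> card \<gamma> = r}. \<Sum>j\<in>{1..K} - \<gamma>. \<bar>bs j\<bar>)"

end

theory Submission
  imports Defs "Jordan_Normal_Form.Spectral_Radius" "Jordan_Normal_Form.Jordan_Normal_Form_Existence"
begin

text \<open>
  Why the posterior concentrates. Divide the likelihood of every parameter by the true likelihood,
  which does not change the posterior, and let \<open>s = n \<epsilon>\<^sup>2\<close>. The posterior probability of the densities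
  that are \<open>\<epsilon>\<close>-far from the truth is then a ratio of two integrals of likelihood ratios against the
  prior, and it is exponentially small in \<open>s\<close> for three reasons.

  \<^item> The denominator is rarely small. Restrict it to a small box around the largest \<open>r\<close> true
    coefficients, which misses only the tail \<open>\<Delta>(r)\<close> of the true linear parameter. The inequality
    \<open>l + \<delta>\<^sup>2 / l \<ge> 2 \<delta>\<close> turns a small integral of the likelihood ratio \<open>l\<close> into a large integral of
    \<open>1 / l\<close>, and the expectation of \<open>1 / l\<close> is controlled by the chi-square divergence of the truth
    from the parameter (\<open>small_evidence\<close>). The prior mass of the box is bounded below by
    \<open>model_prior_ge\<close> and \<open>coef_prior_box\<close>.

  \<^item> Far parameters with moderate coefficients are detected. They are covered by a finite net of far
    parameters \<open>c\<close>. Some \<open>c\<close> reaches a likelihood ratio of at least one only with probability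
    \<open>exp (- s / 2)\<close> times the size of the net, by the affinity bound \<open>1 - \<epsilon>\<^sup>2 / 2\<close> per observation
    (\<open>test_error\<close>). If none does, then the likelihood ratio of a neighbour \<open>b\<close> of \<open>c\<close> is at most itself
    times the inverse square root of that of \<open>c\<close>; the expectation of this product is
    again exponentially small when the chi-square divergence of \<open>b\<close> from \<open>c\<close> is small
    (\<open>nn_integral_S_transfer\<close>, \<open>expected_untested_evidence\<close>).

  \<^item> Large coefficients are rare under the prior (\<open>coef_prior_tail\<close>), and the expectation of a likelihood
    ratio under the truth is one.

  Thus the chi-square divergence between two responses is the only quantity that has to be bounded
  for each regression family, in terms of the distance of the two linear parameters
  (\<open>chi_square_bound\<close>). Its modulus grows linearly with the size of the linear parameters, except in
  Poisson regression, where it grows exponentially; this makes the logarithm of the net size larger by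
  \<open>rbar\<^sup>2 C\<close> with \<open>C\<close> the largest moderate coefficient, and the growth condition with \<open>4 + v\<close> absorbs it.

  The covariance matrices enter through two-sided bounds of the prior density, which follow from
  bounds of a quadratic form and of a determinant by the extreme eigenvalues (\<open>pos_def_mat_bounds\<close>).
  All bounds are collected in \<open>posterior_far_bound\<close>, which holds for every fixed sample size; the rate
  assumptions make each of its terms at most \<open>exp (- s / 16)\<close> up to a constant factor
  (\<open>posterior_far_exponential\<close>). The expectation bound gives both probability statements by Markov's
  inequality.
\<close>

text \<open>From here on \<open>$\<close> selects the entries of vectors whose dimension is a natural number.\<close>

no_notation vec_nth (infixl "$" 90)

section \<open>Quadratic forms and eigenvalues\<close>

text \<open>The number \<open>u\<^sup>* A u\<close> is real when \<open>A\<close> is real and symmetric, and for an eigenvector \<open>u\<close> it is a positive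
  multiple of the eigenvalue. Thus passing to the complex numbers, over which the characteristic
  polynomial splits, does not produce new eigenvalues.\<close>

lemma complex_eigenvalue_symmetric:
  fixes A :: "real mat"
  assumes A: "A \<in> carrier_mat k k" and symm: "transpose_mat A = A"
    and root: "poly (char_poly (map_mat complex_of_real A)) a = 0"
  shows "\<exists>e. a = of_real e \<and> eigenvalue A e"
proof -
  let ?C = "map_mat complex_of_real A"
  have C: "?C \<in> carrier_mat k k" using A by auto
  from root eigenvalue_root_char_poly[OF C] have "eigenvalue ?C a" by auto
  then obtain u where u: "u \<in> carrier_vec k" "u \<noteq> 0\<^sub>v k" "?C *\<^sub>v u = a \<cdot>\<^sub>v u"
    using C unfolding eigenvalue_def eigenvector_def by auto
  have ent: "A $$ (i,j) = A $$ (j,i)" if "i < k" "j < k" for i j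
    using symm A that by (metis carrier_matD index_transpose_mat(1))
  have row: "(\<Sum>j<k. of_real (A $$ (i,j)) * u $ j) = a * u $ i" if "i < k" for i
  proof -
    have "(?C *\<^sub>v u) $ i = (\<Sum>j<k. of_real (A $$ (i,j)) * u $ j)"
      using that u(1) A by (simp add: scalar_prod_def lessThan_atLeast0)
    then show ?thesis unfolding u(3) using u(1) that by simp
  qed
  define S where "S = (\<Sum>i<k. \<Sum>j<k. of_real (A $$ (i,j)) * (cnj (u $ i) * u $ j))"
  define N where "N = (\<Sum>i<k. (cmod (u $ i))\<^sup>2)"
  have S1: "S = a * of_real N"
  proof -
    have "S = (\<Sum>i<k. cnj (u $ i) * (\<Sum>j<k. of_real (A $$ (i,j)) * u $ j))"
      unfolding S_def by (simp add: sum_distrib_left mult_ac)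
    also have "\<dots> = (\<Sum>i<k. a * of_real ((cmod (u $ i))\<^sup>2))"
    proof (intro sum.cong refl)
      fix i assume "i \<in> {..<k}"
      then have "cnj (u $ i) * (\<Sum>j<k. of_real (A $$ (i,j)) * u $ j) = cnj (u $ i) * (a * u $ i)"
        using row by simp
      then show "cnj (u $ i) * (\<Sum>j<k. of_real (A $$ (i,j)) * u $ j) = a * of_real ((cmod (u $ i))\<^sup>2)"
        unfolding complex_norm_square by (simp add: mult_ac)
    qed
    finally show ?thesis unfolding N_def by (simp add: sum_distrib_left)
  qed
  have "cnj S = (\<Sum>i<k. \<Sum>j<k. of_real (A $$ (i,j)) * (u $ i * cnj (u $ j)))"
    unfolding S_def by simp
  also have "\<dots> = (\<Sum>j<k. \<Sum>i<k. of_real (A $$ (i,j)) * (u $ i * cnj (u $ j)))"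
    by (rule sum.swap)
  also have "\<dots> = S" unfolding S_def
    by (intro sum.cong refl) (auto simp: ent mult_ac)
  finally have "cnj S = S" .
  moreover have "N > 0"
  proof -
    obtain i where i: "i < k" "u $ i \<noteq> 0"
      using u(1,2) by (metis carrier_vecD eq_vecI index_zero_vec)
    have "0 < (cmod (u $ i))\<^sup>2" using i by simp
    also have "\<dots> \<le> N" unfolding N_def
      using i by (intro member_le_sum) auto
    finally show ?thesis .
  qed
  ultimately have "cnj a = a" using S1 by simp
  then have a: "a = of_real (Re a)" by (simp add: complex_eq_iff)
  have "poly (char_poly ?C) (of_real (Re a)) = of_real (poly (char_poly A) (Re a))"
    unfolding of_real_hom.char_poly_hom[OF A] by simp
  with root a have "poly (char_poly A) (Re a) = 0" by simp
  then have "eigenvalue A (Re a)" using eigenvalue_root_char_poly[OF A] by auto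
  with a show ?thesis by blast
qed

text \<open>Compare the value at zero of the characteristic polynomial with its complex factorization.\<close>

lemma det_symmetric_eq_prod_eigenvalues:
  fixes A :: "real mat"
  assumes A: "A \<in> carrier_mat k k" and symm: "transpose_mat A = A"
  obtains es where "\<And>e. e \<in> set es \<Longrightarrow> eigenvalue A e" "length es = k" "Determinant.det A = prod_list es"
proof -
  let ?C = "map_mat complex_of_real A"
  have C: "?C \<in> carrier_mat k k" using A by auto
  from char_poly_factorized[OF C] obtain as where
    as: "char_poly ?C = (\<Prod>a\<leftarrow>as. [:- a, 1:])" "length as = k" by auto
  have ev: "a = of_real (Re a) \<and> eigenvalue A (Re a)" if "a \<in> set as" for a
  proof -
    have "poly (char_poly ?C) a = 0" unfolding as(1) using linear_poly_root[OF that] .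
    from complex_eigenvalue_symmetric[OF A symm this] show ?thesis by auto
  qed
  have "- char_matrix A 0 = (-1) \<cdot>\<^sub>m A"
    using A by (intro eq_matI) (auto simp: char_matrix_def)
  then have "poly (char_poly A) 0 = (-1) ^ k * Determinant.det A"
    unfolding char_poly_matrix[OF A] using A by simp
  moreover have "poly (char_poly ?C) 0 = of_real (poly (char_poly A) 0)"
    unfolding of_real_hom.char_poly_hom[OF A] by (metis of_real_0 of_real_hom.poly_map_poly)
  ultimately have "of_real ((-1) ^ k * Determinant.det A) = (\<Prod>a\<leftarrow>as. - a)"
    unfolding as(1) by (simp add: poly_prod_list o_def)
  also have "\<dots> = of_real ((-1) ^ k * prod_list (map Re as))"
    unfolding as(2)[symmetric] using ev by (induction as) auto
  finally have "(-1) ^ k * Determinant.det A = (-1) ^ k * prod_list (map Re as)"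
    by (simp only: of_real_eq_iff)
  then have "Determinant.det A = prod_list (map Re as)" by simp
  with ev as(2) show thesis by (intro that[of "map Re as"]) auto
qed

lemma prod_list_bounds:
  fixes es :: "real list"
  assumes "\<And>e. e \<in> set es \<Longrightarrow> 0 < e \<and> e \<le> \<rho>"
  shows "0 < prod_list es" "prod_list es \<le> \<rho> ^ length es"
proof -
  have "0 < prod_list es \<and> prod_list es \<le> \<rho> ^ length es"
    using assms proof (induction es)
    case (Cons e es)
    then have "0 < e" "e \<le> \<rho>" "0 < prod_list es" "prod_list es \<le> \<rho> ^ length es" by auto
    then show ?case by (auto intro!: mult_mono)
  qed simp
  then show "0 < prod_list es" "prod_list es \<le> \<rho> ^ length es" by auto
qed

abbreviation quad :: "real mat \<Rightarrow> real Matrix.vec \<Rightarrow> real" where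
  "quad A u \<equiv> scalar_prod u (A *\<^sub>v u)"

lemma scalar_prod_self_nonneg: "0 \<le> scalar_prod u (u :: real Matrix.vec)"
  by (simp add: scalar_prod_def sum_nonneg)

lemma scalar_prod_Cauchy_Schwarz:
  assumes "u \<in> carrier_vec k" "w \<in> carrier_vec k"
  shows "(scalar_prod u w)\<^sup>2 \<le> scalar_prod u u * scalar_prod w (w :: real Matrix.vec)"
  using assms Cauchy_Schwarz_ineq_sum[of "\<lambda>i. u $ i" "\<lambda>i. w $ i" "{0..<k}"]
  by (simp add: scalar_prod_def power2_eq_square)

lemma scalar_prod_mult_symmetric:
  fixes A :: "real mat"
  assumes A: "A \<in> carrier_mat k k" and symm: "transpose_mat A = A"
    and u: "u \<in> carrier_vec k" and w: "w \<in> carrier_vec k"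
  shows "scalar_prod (A *\<^sub>v u) w = scalar_prod u (A *\<^sub>v w)"
  using transpose_vec_mult_scalar[OF A w u] symm comm_scalar_prod[OF u, of "A *\<^sub>v w"]
    comm_scalar_prod[OF w, of "A *\<^sub>v u"] A u w
  by (metis mult_mat_vec_carrier)

lemma symmetric_pow:
  fixes A :: "real mat"
  assumes A: "A \<in> carrier_mat k k" and symm: "transpose_mat A = A"
  shows "transpose_mat (A ^\<^sub>m p) = (A ^\<^sub>m p :: real mat)"
proof (induction p)
  case 0
  then show ?case using A by simp
next
  case (Suc p)
  have "A * A ^\<^sub>m p = A ^\<^sub>m Suc p"
  proof (induction p)
    case 0
    then show ?case using A by simp
  next
    case (Suc p)
    then show ?case using A by (simp flip: assoc_mult_mat[OF A pow_carrier_mat[OF A] A])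
  qed
  then show ?case using Suc A by (simp add: transpose_mult[OF pow_carrier_mat[OF A] A] symm)
qed

lemma pow_mat_add:
  assumes A: "(A :: 'a :: semiring_1 mat) \<in> carrier_mat k k"
  shows "A ^\<^sub>m (p + q) = A ^\<^sub>m p * A ^\<^sub>m q"
proof (induction q)
  case 0
  then show ?case using A by simp
next
  case (Suc q)
  then show ?case
    using A by (simp add: assoc_mult_mat[OF pow_carrier_mat[OF A] pow_carrier_mat[OF A] A])
qed

text \<open>For symmetric \<open>B\<close> the Cauchy-Schwarz inequality reads \<open>(u \<bullet> B u)\<^sup>2 \<le> (u \<bullet> u) (u \<bullet> B\<^sup>2 u)\<close>. Squaring
  repeatedly, a Rayleigh quotient above one grows at least geometrically along the powers of the matrix.\<close>

lemma quad_pow_square_bound: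
  fixes A :: "real mat"
  assumes A: "A \<in> carrier_mat k k" and symm: "transpose_mat A = A" and u: "u \<in> carrier_vec k"
    and t: "1 < t" and h: "t * scalar_prod u u \<le> quad A u"
  shows "t ^ (2 ^ p) * scalar_prod u u \<le> quad (A ^\<^sub>m (2 ^ p)) u"
proof (induction p)
  case 0
  then show ?case using A h by simp
next
  case (Suc p)
  let ?B = "A ^\<^sub>m (2 ^ p)" and ?T = "t ^ (2 ^ p)" and ?n = "scalar_prod u u"
  have B: "?B \<in> carrier_mat k k" using pow_carrier_mat[OF A] .
  have Bu: "?B *\<^sub>v u \<in> carrier_vec k" using B u by simp
  have pw: "A ^\<^sub>m (2 ^ Suc p) = ?B * ?B" using pow_mat_add[OF A, of "2 ^ p" "2 ^ p"] by (simp add: mult_2)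
  have sq: "quad (A ^\<^sub>m (2 ^ Suc p)) u = scalar_prod (?B *\<^sub>v u) (?B *\<^sub>v u)"
    unfolding pw assoc_mult_mat_vec[OF B B u]
    using scalar_prod_mult_symmetric[OF B symmetric_pow[OF A symm] u Bu] by simp
  have T0: "0 < ?T" using t by simp
  show ?case
  proof (cases "?n = 0")
    case True
    then show ?thesis unfolding sq using scalar_prod_self_nonneg by simp
  next
    case False
    then have n0: "?n > 0" using scalar_prod_self_nonneg[of u] by linarith
    have "(?T * ?n)\<^sup>2 \<le> (quad ?B u)\<^sup>2"
      using Suc T0 n0 by (intro power_mono) auto
    also have "\<dots> \<le> ?n * quad (A ^\<^sub>m (2 ^ Suc p)) u"
      unfolding sq by (rule scalar_prod_Cauchy_Schwarz[OF u Bu])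
    finally have "?n * (?T\<^sup>2 * ?n) \<le> ?n * quad (A ^\<^sub>m (2 ^ Suc p)) u"
      by (simp add: power2_eq_square mult_ac)
    then have "?T\<^sup>2 * ?n \<le> quad (A ^\<^sub>m (2 ^ Suc p)) u" using n0 by simp
    then show ?thesis by (simp add: power_mult[symmetric] mult.commute)
  qed
qed

text \<open>The variational characterization of the largest eigenvalue, without diagonalization: by the Jordan
  normal form the powers of a matrix of spectral radius below one stay bounded, so that by
  \<open>quad_pow_square_bound\<close> no Rayleigh quotient can exceed one.\<close>

lemma quad_le_of_eigenvalues_less_one:
  fixes A :: "real mat"
  assumes A: "A \<in> carrier_mat k k" and symm: "transpose_mat A = A" and u: "u \<in> carrier_vec k"
    and ev: "\<And>e. eigenvalue A e \<Longrightarrow> \<bar>e\<bar> < 1"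
  shows "quad A u \<le> scalar_prod u u"
proof (rule ccontr)
  assume "\<not> ?thesis"
  then have lt: "scalar_prod u u < quad A u" by simp
  let ?C = "map_mat complex_of_real A" and ?n = "scalar_prod u u"
  have C: "?C \<in> carrier_mat k k" using A by auto
  have k: "k \<noteq> 0" using lt u A by (intro notI) (simp add: scalar_prod_def)
  have "spectral_radius ?C < 1"
  proof -
    from spectral_radius_mem_max(1)[OF C] k obtain a where
      a: "a \<in> spectrum ?C" "spectral_radius ?C = cmod a" by auto
    then have "poly (char_poly ?C) a = 0" using spectrum_root_char_poly[OF C] by auto
    from complex_eigenvalue_symmetric[OF A symm this] ev a show ?thesis by auto
  qed
  moreover have "\<exists>n_as. jordan_nf ?C n_as"
    using char_poly_factorized[OF C] jordan_nf_exists[OF C] by blast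
  ultimately obtain c where c: "\<And>p. norm_bound (?C ^\<^sub>m p) c"
    using spectral_radius_jnf_norm_bound_less_1[OF C] by blast
  have ent: "\<bar>(A ^\<^sub>m p) $$ (i,j)\<bar> \<le> c" if "i < k" "j < k" for p i j
  proof -
    have "?C ^\<^sub>m p = map_mat complex_of_real (A ^\<^sub>m p)" using of_real_hom.mat_hom_pow[OF A, of p] by (rule sym)
    then show ?thesis using c[of p] that A pow_carrier_mat[OF A, of p] unfolding norm_bound_def by auto
  qed
  have n0: "?n > 0"
  proof -
    have "?n \<noteq> 0"
    proof
      assume "?n = 0"
      then have "(\<Sum>i<k. (u $ i)\<^sup>2) = 0" using u by (simp add: scalar_prod_def power2_eq_square lessThan_atLeast0)
      then have "u = 0\<^sub>v k" using u by (intro eq_vecI) (auto simp: sum_nonneg_eq_0_iff)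
      then show False using lt A by simp
    qed
    then show ?thesis using scalar_prod_self_nonneg[of u] by linarith
  qed
  define t where "t = quad A u / ?n"
  have t: "1 < t" "t * ?n \<le> quad A u" unfolding t_def using lt n0 by auto
  define M where "M = c * (\<Sum>i<k. \<bar>u $ i\<bar>)\<^sup>2"
  have upper: "quad (A ^\<^sub>m p) u \<le> M" for p
  proof -
    have "quad (A ^\<^sub>m p) u = (\<Sum>i<k. u $ i * (\<Sum>j<k. (A ^\<^sub>m p) $$ (i,j) * u $ j))"
      using u carrier_matD[OF pow_carrier_mat[OF A, of p]]
      by (simp add: scalar_prod_def lessThan_atLeast0 del: pow_mat_dim)
    also have "\<dots> \<le> (\<Sum>i<k. \<bar>u $ i\<bar> * (\<Sum>j<k. c * \<bar>u $ j\<bar>))"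
    proof (intro sum_mono)
      fix i assume i: "i \<in> {..<k}"
      have "u $ i * (\<Sum>j<k. (A ^\<^sub>m p) $$ (i,j) * u $ j) \<le> \<bar>u $ i\<bar> * \<bar>\<Sum>j<k. (A ^\<^sub>m p) $$ (i,j) * u $ j\<bar>"
        by (simp flip: abs_mult)
      also have "\<bar>\<Sum>j<k. (A ^\<^sub>m p) $$ (i,j) * u $ j\<bar> \<le> (\<Sum>j<k. c * \<bar>u $ j\<bar>)"
        using ent i by (intro order.trans[OF sum_abs] sum_mono) (auto simp: abs_mult intro!: mult_right_mono)
      finally show "u $ i * (\<Sum>j<k. (A ^\<^sub>m p) $$ (i,j) * u $ j) \<le> \<bar>u $ i\<bar> * (\<Sum>j<k. c * \<bar>u $ j\<bar>)"
        by (simp add: mult_left_mono)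
    qed
    also have "\<dots> = M"
      unfolding M_def power2_eq_square by (simp add: sum_distrib_left sum_distrib_right mult_ac)
    finally show ?thesis .
  qed
  obtain p where p: "M / ?n < t ^ p" using real_arch_pow[OF t(1)] by blast
  have "t ^ p \<le> t ^ (2 ^ p)" using t(1) by (intro power_increasing) (auto intro: less_imp_le less_exp)
  then have "M < t ^ (2 ^ p) * ?n" using p n0 by (simp add: field_simps) (smt (verit) mult_left_mono)
  also have "\<dots> \<le> M"
    using quad_pow_square_bound[OF A symm u t] upper order.trans by blast
  finally show False by simp
qed

lemma smult_mat_mult_vec:
  assumes "A \<in> carrier_mat k k" "u \<in> carrier_vec k"
  shows "(c \<cdot>\<^sub>m A) *\<^sub>v u = c \<cdot>\<^sub>v (A *\<^sub>v (u :: real Matrix.vec))"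
  using assms by (intro eq_vecI) (auto simp: scalar_prod_def sum_distrib_left mult_ac intro!: sum.cong)

text \<open>Divide the matrix by a number slightly larger than \<open>\<rho>\<close> to make its eigenvalues strictly smaller than one.\<close>

lemma quad_le_of_eigenvalues_le:
  fixes A :: "real mat"
  assumes A: "A \<in> carrier_mat k k" and symm: "transpose_mat A = A" and u: "u \<in> carrier_vec k"
    and ev: "\<And>e. eigenvalue A e \<Longrightarrow> \<bar>e\<bar> \<le> \<rho>" and \<rho>: "0 < \<rho>"
  shows "quad A u \<le> \<rho> * scalar_prod u u"
proof -
  have "quad A u \<le> (\<rho> * s) * scalar_prod u u" if s: "1 < s" for s
  proof -
    let ?t = "\<rho> * s" let ?S = "(1 / ?t) \<cdot>\<^sub>m A"
    have t: "\<rho> < ?t" "0 < ?t" using s \<rho> by auto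
    have "quad ?S u \<le> scalar_prod u u"
    proof (rule quad_le_of_eigenvalues_less_one[OF _ _ u])
      show "?S \<in> carrier_mat k k" using A by simp
      show "transpose_mat ?S = ?S" using A symm
        by (intro eq_matI) (auto, metis carrier_matD index_transpose_mat(1))
      fix e assume "eigenvalue ?S e"
      then obtain w where w: "w \<in> carrier_vec k" "w \<noteq> 0\<^sub>v k" "?S *\<^sub>v w = e \<cdot>\<^sub>v w"
        using A unfolding eigenvalue_def eigenvector_def by auto
      have "A *\<^sub>v w = ?t \<cdot>\<^sub>v (?S *\<^sub>v w)"
        unfolding smult_mat_mult_vec[OF A w(1)] smult_smult_assoc using s \<rho> by simp
      also have "\<dots> = (?t * e) \<cdot>\<^sub>v w" unfolding w(3) by (simp add: smult_smult_assoc)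
      finally have "eigenvalue A (?t * e)"
        using A w unfolding eigenvalue_def eigenvector_def by auto
      from ev[OF this] have "?t * \<bar>e\<bar> \<le> \<rho>" using t \<rho> s by (simp add: abs_mult)
      also have "\<rho> < ?t * 1" using t by simp
      finally show "\<bar>e\<bar> < 1" using t(2) by (simp only: mult_less_cancel_left_pos)
    qed
    then show ?thesis using A u t(2)
      by (simp add: smult_mat_mult_vec[OF A u] field_simps)
  qed note * = this
  show ?thesis
  proof (rule field_le_epsilon)
    fix e :: real assume e: "0 < e"
    define n where "n = scalar_prod u u"
    have n: "0 \<le> n" unfolding n_def by (rule scalar_prod_self_nonneg)
    define s where "s = 1 + e / (\<rho> * (n + 1))"
    have s: "1 < s" unfolding s_def using e n \<rho> by simp
    have "\<rho> * s * n = \<rho> * n + e * (n / (n + 1))" 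
    proof -
      have "\<rho> * (e / (\<rho> * (n + 1))) = e / (n + 1)" using \<rho> by simp
      then have "\<rho> * s = \<rho> + e / (n + 1)" unfolding s_def by (simp add: distrib_left)
      then show ?thesis by (simp add: distrib_right)
    qed
    also have "\<dots> \<le> \<rho> * n + e" using e n by (simp add: field_simps)
    finally show "quad A u \<le> \<rho> * scalar_prod u u + e" using *[OF s] unfolding n_def by linarith
  qed
qed

lemma pos_def_mat_eigenvalue:
  assumes "pos_def_mat k A" "eigenvalue A e"
  shows "0 < e \<and> e \<le> ch1 A"
proof -
  have A: "A \<in> carrier_mat k k" using assms unfolding pos_def_mat_def by auto
  from assms(2) obtain w where w: "w \<in> carrier_vec k" "w \<noteq> 0\<^sub>v k" "A *\<^sub>v w = e \<cdot>\<^sub>v w"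
    using A unfolding eigenvalue_def eigenvector_def by auto
  have "0 < quad A w" using assms(1) w unfolding pos_def_mat_def by auto
  then have "0 < e * scalar_prod w w" using w by simp
  then have "0 < e" using scalar_prod_self_nonneg[of w] by (simp add: zero_less_mult_iff)
  moreover have "finite {k. eigenvalue A k}"
    using card_finite_spectrum(1)[OF A] unfolding spectrum_def .
  ultimately show ?thesis using assms(2) unfolding ch1_def by (auto intro!: Max_ge)
qed

lemma pos_def_mat_inverse:
  assumes "pos_def_mat k A"
  shows "A * inv_mat A = 1\<^sub>m k" "inv_mat A * A = 1\<^sub>m k" "inv_mat A \<in> carrier_mat k k"
    "pos_def_mat k (inv_mat A)"
proof -
  have A: "A \<in> carrier_mat k k" and sym: "transpose_mat A = A"
    and pos: "\<And>u. u \<in> carrier_vec k \<Longrightarrow> u \<noteq> 0\<^sub>v k \<Longrightarrow> 0 < quad A u"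
    using assms unfolding pos_def_mat_def by auto
  have "Determinant.det A \<noteq> 0"
  proof
    assume "Determinant.det A = 0"
    then obtain w where "w \<in> carrier_vec k" "w \<noteq> 0\<^sub>v k" "A *\<^sub>v w = 0\<^sub>v k"
      using det_0_iff_vec_prod_zero_field[OF A] by auto
    with pos[of w] show False by simp
  qed
  then have "A \<in> Units (ring_mat TYPE(real) k ())" using det_non_zero_imp_unit[OF A, where ?b = "()"] by blast
  then obtain B where "mat_inverse A = Some B" using mat_inverse(1)[OF A, where b = "()"] by fastforce
  then show *: "A * inv_mat A = 1\<^sub>m k" "inv_mat A * A = 1\<^sub>m k" "inv_mat A \<in> carrier_mat k k"
    using mat_inverse(2)[OF A] unfolding inv_mat_def by auto
  let ?B = "inv_mat A"
  have "transpose_mat ?B * A = 1\<^sub>m k"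
    using transpose_mult[OF A *(3)] *(1) sym by simp
  then have "?B = (transpose_mat ?B * A) * ?B" using *(3) by simp
  also have "\<dots> = transpose_mat ?B * (A * ?B)"
    using *(3) A by (intro assoc_mult_mat[of _ k k _ k _ k]) auto
  also have "\<dots> = transpose_mat ?B" unfolding *(1) using *(3) by (intro right_mult_one_mat) auto
  finally have symB: "transpose_mat ?B = ?B" by simp
  have "0 < quad ?B u" if u: "u \<in> carrier_vec k" "u \<noteq> 0\<^sub>v k" for u
  proof -
    let ?w = "?B *\<^sub>v u"
    have w: "?w \<in> carrier_vec k" using *(3) u by simp
    have Aw: "A *\<^sub>v ?w = u" using assoc_mult_mat_vec[OF A *(3) u(1)] *(1) u(1) by simp
    have "A *\<^sub>v 0\<^sub>v k = 0\<^sub>v k" using A by (intro eq_vecI) auto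
    then have "?w \<noteq> 0\<^sub>v k" using u(2) Aw by metis
    from pos[OF w this] show ?thesis unfolding Aw using comm_scalar_prod[OF w u(1)] by simp
  qed
  then show "pos_def_mat k ?B" unfolding pos_def_mat_def using *(3) symB by auto
qed

text \<open>The lower bound of the inverse form needs no square root of \<open>A\<close>: it is the inequality \<open>0 \<le> z \<bullet> A z\<close>
  for \<open>z = A\<^sup>-\<^sup>1 u - u / \<tau>\<close>. In dimension zero there are no eigenvalues and \<open>ch1\<close> is an arbitrary number,
  hence the conditions \<open>k \<noteq> 0\<close>.\<close>

lemma pos_def_mat_bounds:
  assumes A: "pos_def_mat k A" and \<tau>: "0 < \<tau>"
    and ch: "k \<noteq> 0 \<Longrightarrow> ch1 A \<le> \<tau>" "k \<noteq> 0 \<Longrightarrow> ch1 (inv_mat A) \<le> \<tau>"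
  shows "\<And>u. u \<in> carrier_vec k \<Longrightarrow> quad (inv_mat A) u \<le> \<tau> * scalar_prod u u"
    and "\<And>u. u \<in> carrier_vec k \<Longrightarrow> scalar_prod u u / \<tau> \<le> quad (inv_mat A) u"
    and "Determinant.det A \<le> \<tau> ^ k" and "(1 / \<tau>) ^ k \<le> Determinant.det A"
proof -
  let ?B = "inv_mat A"
  note B = pos_def_mat_inverse[OF A]
  have Ac: "A \<in> carrier_mat k k" "transpose_mat A = A" and sB: "transpose_mat ?B = ?B"
    using A B(4) unfolding pos_def_mat_def by auto
  have k0: "k \<noteq> 0" if "eigenvalue M e" "M \<in> carrier_mat k k" for M :: "real mat" and e
    using that unfolding eigenvalue_def eigenvector_def by auto
  have eA: "\<bar>e\<bar> \<le> \<tau>" if "eigenvalue A e" for e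
    using pos_def_mat_eigenvalue[OF A that] ch(1) k0[OF that Ac(1)] by auto
  have eB: "\<bar>e\<bar> \<le> \<tau>" if "eigenvalue ?B e" for e
    using pos_def_mat_eigenvalue[OF B(4) that] ch(2) k0[OF that B(3)] by auto
  show "quad ?B u \<le> \<tau> * scalar_prod u u" if "u \<in> carrier_vec k" for u
    by (rule quad_le_of_eigenvalues_le[OF B(3) sB that eB \<tau>])
  show "scalar_prod u u / \<tau> \<le> quad ?B u" if u: "u \<in> carrier_vec k" for u
  proof -
    let ?w = "?B *\<^sub>v u" let ?z = "?w - (1/\<tau>) \<cdot>\<^sub>v u"
    have w: "?w \<in> carrier_vec k" and z: "?z \<in> carrier_vec k" using B(3) u by auto
    have Aw: "A *\<^sub>v ?w = u" using assoc_mult_mat_vec[OF Ac(1) B(3) u] B(1) u by simp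
    have "0 \<le> quad A ?z"
    proof (cases "?z = 0\<^sub>v k")
      case True
      then show ?thesis using Ac(1) by simp
    next
      case False
      then show ?thesis using A z unfolding pos_def_mat_def by (simp add: less_imp_le)
    qed
    also have "quad A ?z = scalar_prod ?z (u - (1/\<tau>) \<cdot>\<^sub>v (A *\<^sub>v u))"
      using mult_minus_distrib_mat_vec[OF Ac(1) w, of "(1/\<tau>) \<cdot>\<^sub>v u"] u Ac(1) Aw
      by (simp add: mult_mat_vec[OF Ac(1) u])
    also have "\<dots> = scalar_prod ?w u - (1/\<tau>) * scalar_prod ?w (A *\<^sub>v u)
        - (1/\<tau>) * scalar_prod u u + (1/\<tau>)\<^sup>2 * quad A u"
      using u w Ac(1) 
      by (simp add: minus_scalar_prod_distrib[of _ k] scalar_prod_minus_distrib[of _ k] power2_eq_square algebra_simps)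
    also have "scalar_prod ?w (A *\<^sub>v u) = scalar_prod u u"
      using scalar_prod_mult_symmetric[OF Ac w u] Aw by simp
    also have "scalar_prod ?w u = quad ?B u" using comm_scalar_prod[OF w u] .
    finally have "0 \<le> quad ?B u - 2 * scalar_prod u u / \<tau> + quad A u / \<tau>\<^sup>2" by (simp add: field_simps)
    moreover have "quad A u / \<tau>\<^sup>2 \<le> (\<tau> * scalar_prod u u) / \<tau>\<^sup>2"
      using quad_le_of_eigenvalues_le[OF Ac u eA \<tau>] by (intro divide_right_mono) auto
    moreover have "(\<tau> * scalar_prod u u) / \<tau>\<^sup>2 = scalar_prod u u / \<tau>"
      using \<tau> by (simp add: power2_eq_square)
    ultimately show ?thesis by linarith
  qed
  have dets: "0 < Determinant.det M \<and> Determinant.det M \<le> \<tau> ^ k"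
    if M: "M \<in> carrier_mat k k" "transpose_mat M = M" and e: "\<And>e. eigenvalue M e \<Longrightarrow> 0 < e \<and> e \<le> \<tau>" for M
    using det_symmetric_eq_prod_eigenvalues[OF M] prod_list_bounds e by metis
  have pA: "0 < e \<and> e \<le> \<tau>" if "eigenvalue A e" for e
    using pos_def_mat_eigenvalue[OF A that] ch(1) k0[OF that Ac(1)] by auto
  have pB: "0 < e \<and> e \<le> \<tau>" if "eigenvalue ?B e" for e
    using pos_def_mat_eigenvalue[OF B(4) that] ch(2) k0[OF that B(3)] by auto
  have dA: "0 < Determinant.det A" "Determinant.det A \<le> \<tau> ^ k" using dets[OF Ac pA] by auto
  then show "Determinant.det A \<le> \<tau> ^ k" by simp
  have "1 = Determinant.det A * Determinant.det ?B"
    using det_mult[OF Ac(1) B(3)] B(1) by simp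
  also have "\<dots> \<le> Determinant.det A * \<tau> ^ k"
    using dA dets[OF B(3) sB pB] by (intro mult_left_mono) auto
  finally show "(1 / \<tau>) ^ k \<le> Determinant.det A"
    using \<tau> by (simp add: power_divide divide_le_eq)
qed

section \<open>The regression families\<close>

lemma std_normal_cdf_eq:
  "std_normal_cdf h = measure std_normal_distribution {..h}"
  unfolding std_normal_cdf_def cdf_def ..

lemma std_normal_prob: "prob_space std_normal_distribution"
  by (rule prob_space_normal_density) simp

lemma std_normal_tail_eq:
  "1 - std_normal_cdf h = measure std_normal_distribution {h<..}"
proof -
  interpret prob_space std_normal_distribution by (rule std_normal_prob)
  have "prob (space std_normal_distribution - {..h}) = 1 - prob {..h}"
    by (rule prob_compl) simp
  moreover have "space std_normal_distribution - {..h} = {h<..}" by auto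
  ultimately show ?thesis unfolding std_normal_cdf_eq by simp
qed

lemma std_normal_measure_Ioc:
  assumes "a \<le> b" "0 \<le> c"
  shows "(\<And>s. a \<le> s \<Longrightarrow> s \<le> b \<Longrightarrow> std_normal_density s \<le> c) \<Longrightarrow>
      measure std_normal_distribution {a<..b} \<le> c * (b - a)"
    and "(\<And>s. a \<le> s \<Longrightarrow> s \<le> b \<Longrightarrow> c \<le> std_normal_density s) \<Longrightarrow>
      c * (b - a) \<le> measure std_normal_distribution {a<..b}"
proof -
  interpret prob_space std_normal_distribution by (rule std_normal_prob)
  have e: "emeasure std_normal_distribution {a<..b} =
      (\<integral>\<^sup>+ s. ennreal (std_normal_density s) * indicator {a<..b} s \<partial>lborel)"
    by (subst emeasure_density) auto
  have c: "(\<integral>\<^sup>+ s. ennreal c * indicator {a<..b} s \<partial>lborel) = ennreal (c * (b - a))"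
    using assms by (subst nn_integral_cmult_indicator) (auto simp: ennreal_mult)
  show "measure std_normal_distribution {a<..b} \<le> c * (b - a)"
    if "\<And>s. a \<le> s \<Longrightarrow> s \<le> b \<Longrightarrow> std_normal_density s \<le> c"
  proof -
    have "ennreal (measure std_normal_distribution {a<..b}) \<le> ennreal (c * (b - a))"
      unfolding emeasure_eq_measure[symmetric] e c[symmetric]
      using that by (intro nn_integral_mono) (auto simp: indicator_def intro!: ennreal_leI)
    then show ?thesis using assms by (subst (asm) ennreal_le_iff) auto
  qed
  show "c * (b - a) \<le> measure std_normal_distribution {a<..b}"
    if "\<And>s. a \<le> s \<Longrightarrow> s \<le> b \<Longrightarrow> c \<le> std_normal_density s"
  proof -
    have "ennreal (c * (b - a)) \<le> ennreal (measure std_normal_distribution {a<..b})"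
      unfolding emeasure_eq_measure[symmetric] e c[symmetric]
      using that by (intro nn_integral_mono) (auto simp: indicator_def intro!: ennreal_leI)
    then show ?thesis by (subst (asm) ennreal_le_iff) auto
  qed
qed

text \<open>The logarithm of the density has slope at most \<open>L\<close> on \<open>[- L, L]\<close>, so the density changes by a bounded
  factor over distances of order \<open>1 / L\<close>.\<close>

lemma std_normal_density_ratio:
  assumes "\<bar>s\<bar> \<le> L" "\<bar>t\<bar> \<le> L" "\<bar>s - t\<bar> * L \<le> 2"
  shows "exp (-2) * std_normal_density t \<le> std_normal_density s"
proof -
  have "s\<^sup>2 - t\<^sup>2 = (s - t) * (s + t)" by (simp add: power2_eq_square algebra_simps)
  also have "\<dots> \<le> \<bar>s - t\<bar> * \<bar>s + t\<bar>" by (simp flip: abs_mult)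
  also have "\<dots> \<le> \<bar>s - t\<bar> * (2 * L)" using assms by (intro mult_left_mono) auto
  also have "\<dots> \<le> 4" using assms(3) by (simp add: mult.commute)
  finally have "exp (-2 - t\<^sup>2 / 2) \<le> exp (- s\<^sup>2 / 2)" by simp
  then have "exp (-2) * exp (- t\<^sup>2 / 2) \<le> exp (- s\<^sup>2 / 2)" by (simp add: exp_add[symmetric])
  then show ?thesis unfolding std_normal_density_def by (simp add: divide_right_mono mult_ac)
qed

text \<open>Over distances \<open>1 / (1 + H)\<close> the density is constant up to a factor. Hence each of the two intervals
  of that length next to \<open>h'\<close> has mass comparable to the density divided by \<open>1 + H\<close>; one of them lies
  below \<open>h'\<close> and the other above, which bounds the lower and the upper tail at \<open>h'\<close> from below.\<close>

lemma std_normal_cdf_relative_lipschitz: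
  assumes H: "0 \<le> H" and h: "\<bar>h\<bar> \<le> H" "\<bar>h'\<bar> \<le> H" and d: "\<bar>h - h'\<bar> * (1 + H) \<le> 1"
  shows "\<bar>std_normal_cdf h - std_normal_cdf h'\<bar> \<le> exp 2 * (1 + H) * \<bar>h - h'\<bar> * std_normal_cdf h'" (is ?A)
    and "\<bar>std_normal_cdf h - std_normal_cdf h'\<bar> \<le> exp 2 * (1 + H) * \<bar>h - h'\<bar> * (1 - std_normal_cdf h')" (is ?B)
proof -
  interpret prob_space std_normal_distribution by (rule std_normal_prob)
  let ?P = "measure std_normal_distribution" and ?f = "std_normal_density h'"
  let ?d = "1 / (1 + H)"
  have dd: "\<bar>h - h'\<bar> \<le> ?d" using d H by (simp add: field_simps)
  have d1: "0 < ?d" "?d \<le> 1" "?d * (1 + H) = 1" using H by auto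
  define a where "a = min h h'"
  define b where "b = max h h'"
  have ab: "a \<le> b" "b - a = \<bar>h - h'\<bar>" unfolding a_def b_def by auto
  have "\<bar>std_normal_cdf h - std_normal_cdf h'\<bar> = ?P {..b} - ?P {..a}"
    unfolding std_normal_cdf_eq a_def b_def
    using finite_measure_mono[of "{..h}" "{..h'}"] finite_measure_mono[of "{..h'}" "{..h}"]
    by (cases "h \<le> h'") (auto simp: min_def max_def)
  also have "\<dots> = ?P {a<..b}"
  proof -
    have "{..b} - {..a} = {a<..b}" by auto
    with finite_measure_Diff[of "{..b}" "{..a}"] ab show ?thesis by auto
  qed
  finally have diff: "\<bar>std_normal_cdf h - std_normal_cdf h'\<bar> = ?P {a<..b}" .
  have ratio: "std_normal_density s \<le> exp 2 * std_normal_density t"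
    if "\<bar>s - h'\<bar> \<le> ?d" "\<bar>t - h'\<bar> \<le> ?d" for s t
  proof -
    have "\<bar>t - s\<bar> \<le> 2 * ?d" using that by auto
    then have "\<bar>t - s\<bar> * (1 + H) \<le> (2 * ?d) * (1 + H)" using H by (intro mult_right_mono) auto
    then have "exp (-2) * std_normal_density s \<le> std_normal_density t"
      using that h d1(2) H unfolding mult.assoc d1(3) by (intro std_normal_density_ratio[where L = "1 + H"]) linarith+
    then have "exp 2 * (exp (-2) * std_normal_density s) \<le> exp 2 * std_normal_density t" by simp
    then show ?thesis by (simp add: exp_minus field_simps)
  qed
  \<comment> \<open>The maximum of the density near \<open>h'\<close> bounds the mass between \<open>h\<close> and \<open>h'\<close> from above; up to the factor
    \<open>exp 2\<close> it also bounds the density near \<open>h'\<close> from below.\<close>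
  obtain t where t: "\<bar>t - h'\<bar> \<le> ?d" "\<And>s. \<bar>s - h'\<bar> \<le> ?d \<Longrightarrow> std_normal_density s \<le> std_normal_density t"
  proof -
    have "compact {h' - ?d .. h' + ?d}" "{h' - ?d .. h' + ?d} \<noteq> {}" using d1 by auto
    moreover have "continuous_on {h' - ?d .. h' + ?d} std_normal_density"
      unfolding std_normal_density_def by (intro continuous_intros) auto
    ultimately obtain t where "t \<in> {h' - ?d .. h' + ?d}"
      "\<forall>s\<in>{h' - ?d .. h' + ?d}. std_normal_density s \<le> std_normal_density t"
      using continuous_attains_sup by blast
    then show thesis by (intro that[of t]) (auto simp: abs_le_iff)
  qed
  let ?m = "std_normal_density t"
  have up: "?P {a<..b} \<le> ?m * \<bar>h - h'\<bar>"
    unfolding ab(2)[symmetric] using t dd ab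
    by (intro std_normal_measure_Ioc) (auto simp: a_def b_def)
  have low: "exp (-2) * ?m \<le> std_normal_density s" if "\<bar>s - h'\<bar> \<le> ?d" for s
    using ratio[OF t(1) that] by (simp add: exp_minus field_simps)
  have l1: "(exp (-2) * ?m) * ?d \<le> ?P {h' - ?d<..h'}"
    using std_normal_measure_Ioc(2)[of "h' - ?d" h' "exp (-2) * ?m"] low d1 by force
  have l2: "(exp (-2) * ?m) * ?d \<le> ?P {h'<..h' + ?d}"
    using std_normal_measure_Ioc(2)[of h' "h' + ?d" "exp (-2) * ?m"] low d1 by force
  have conc: "?P {a<..b} \<le> exp 2 * (1 + H) * \<bar>h - h'\<bar> * p" if p: "(exp (-2) * ?m) * ?d \<le> p" for p
  proof -
    have "?m = exp 2 * (1 + H) * ((exp (-2) * ?m) * ?d)" 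
    proof -
      have "exp 2 * (1 + H) * ((exp (-2) * ?m) * ?d) = (exp 2 * exp (-2)) * ((?d * (1 + H)) * ?m)"
        by (simp only: mult_ac)
      also have "\<dots> = ?m" unfolding d1(3) by (simp add: exp_minus)
      finally show ?thesis ..
    qed
    also have "\<dots> \<le> exp 2 * (1 + H) * p" using p H by (intro mult_left_mono) auto
    finally have "?m * \<bar>h - h'\<bar> \<le> exp 2 * (1 + H) * p * \<bar>h - h'\<bar>" by (intro mult_right_mono) auto
    with up show ?thesis by (simp add: mult_ac)
  qed
  have "?P {h' - ?d<..h'} \<le> std_normal_cdf h'" unfolding std_normal_cdf_eq
    by (intro finite_measure_mono) auto
  with l1 conc show ?A unfolding diff by force
  have "?P {h'<..h' + ?d} \<le> 1 - std_normal_cdf h'" unfolding std_normal_tail_eq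
    by (intro finite_measure_mono) auto
  with l2 conc show ?B unfolding diff by force
qed

lemma std_normal_cdf_strict: "0 < std_normal_cdf h" "std_normal_cdf h < 1"
proof -
  interpret prob_space std_normal_distribution by (rule std_normal_prob)
  let ?P = "measure std_normal_distribution"
  define c where "c = min (std_normal_density (\<bar>h\<bar> + 1)) 1"
  have c: "0 < c" unfolding c_def by (simp add: normal_density_pos)
  have le: "c \<le> std_normal_density s" if "\<bar>s\<bar> \<le> \<bar>h\<bar> + 1" for s
  proof -
    have "s\<^sup>2 \<le> (\<bar>h\<bar> + 1)\<^sup>2" using that by (metis abs_ge_zero power2_abs power_mono)
    then have "std_normal_density (\<bar>h\<bar> + 1) \<le> std_normal_density s"
      unfolding std_normal_density_def by (intro mult_left_mono) auto
    then show ?thesis unfolding c_def by simp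
  qed
  have "c * (h - (h - 1)) \<le> ?P {h - 1<..h}"
    using c le by (intro std_normal_measure_Ioc(2)) auto
  also have "\<dots> \<le> std_normal_cdf h" unfolding std_normal_cdf_eq by (intro finite_measure_mono) auto
  finally show "0 < std_normal_cdf h" using c by simp
  have "c * ((h + 1) - h) \<le> ?P {h<..h + 1}"
    using c le by (intro std_normal_measure_Ioc(2)) auto
  also have "\<dots> \<le> 1 - std_normal_cdf h" unfolding std_normal_tail_eq by (intro finite_measure_mono) auto
  finally show "std_normal_cdf h < 1" using c by simp
qed

lemma std_normal_cdf_measurable [measurable]: "std_normal_cdf \<in> borel_measurable borel"
proof -
  interpret prob_space std_normal_distribution by (rule std_normal_prob)
  have "mono std_normal_cdf" unfolding std_normal_cdf_eq
    by (intro monoI finite_measure_mono) auto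
  then show ?thesis by (rule borel_measurable_mono)
qed

lemma reg_density_pos: "valid_regression m \<Longrightarrow> 0 < reg_density m y h"
  using std_normal_cdf_strict[of h]
  by (cases m) (auto simp: valid_regression_def intro!: normal_density_pos mult_pos_pos)

lemma sets_response_measure [measurable_cong, simp]: "sets (response_measure m) = sets borel"
  by (cases m) auto

lemma space_response_measure [simp]: "space (response_measure m) = UNIV"
  by (cases m) auto

lemma reg_density_measurable [measurable]:
  assumes [measurable]: "Y \<in> borel_measurable M" "h \<in> borel_measurable M"
  shows "(\<lambda>x. reg_density m (Y x) (h x)) \<in> borel_measurable M"
proof (cases m)
  case Poisson
  have [measurable]: "(\<lambda>y::real. ln (fact (nat \<lfloor>y\<rfloor>)) :: real) \<in> borel_measurable borel"
    by (rule measurable_compose[OF measurable_real_floor, of "\<lambda>i. ln (fact (nat i))" borel]) simp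
  show ?thesis unfolding Poisson by simp
next
  case (Normal_Linear \<sigma>)
  then show ?thesis by (simp add: normal_density_def)
qed auto

lemma nn_integral_binary_response:
  assumes m: "m = Logistic \<or> m = Probit" and [measurable]: "g \<in> borel_measurable borel"
  shows "(\<integral>\<^sup>+y. g y \<partial>response_measure m) = g 0 + g 1"
proof -
  have "response_measure m = distr (count_space {0, 1}) borel (\<lambda>y. y)" using m by auto
  then have "(\<integral>\<^sup>+y. g y \<partial>response_measure m) = (\<integral>\<^sup>+y. g y \<partial>count_space {0, 1})"
    by (simp add: nn_integral_distr)
  also have "\<dots> = g 0 + g 1" by (subst nn_integral_count_space_finite) auto
  finally show ?thesis .
qed

lemma nn_integral_Poisson_response:
  assumes [measurable]: "g \<in> borel_measurable borel"
  shows "(\<integral>\<^sup>+y. g y \<partial>response_measure Poisson) = (\<Sum>k. g (real k))"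
proof -
  have b: "bij_betw real UNIV \<nat>" by (auto simp: bij_betw_def Nats_def inj_on_def)
  have "(\<integral>\<^sup>+y. g y \<partial>response_measure Poisson) = (\<integral>\<^sup>+y. g y \<partial>count_space \<nat>)"
    by (simp add: nn_integral_distr)
  also have "\<dots> = (\<integral>\<^sup>+k. g (real k) \<partial>count_space UNIV)"
    by (rule nn_integral_bij_count_space[OF b, symmetric])
  also have "\<dots> = (\<Sum>k. g (real k))" by (rule nn_integral_count_space_nat)
  finally show ?thesis .
qed

lemma nn_integral_reg_density:
  assumes "valid_regression m"
  shows "(\<integral>\<^sup>+y. ennreal (reg_density m y h) \<partial>response_measure m) = 1"
proof (cases m)
  case Poisson
  have "reg_density Poisson (real k) h = exp (- exp h) * ((exp h) ^ k /\<^sub>R fact k)" for k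
    by (simp add: exp_diff exp_minus exp_add exp_of_nat2_mult field_simps)
  moreover have "(\<integral>\<^sup>+y. ennreal (reg_density m y h) \<partial>response_measure m) =
        (\<Sum>k. ennreal (reg_density Poisson (real k) h))"
    unfolding Poisson by (rule nn_integral_Poisson_response) (intro measurable_compose[OF _ measurable_ennreal] reg_density_measurable measurable_ident_sets measurable_const, auto)
  ultimately have "(\<integral>\<^sup>+y. ennreal (reg_density m y h) \<partial>response_measure m) =
        (\<Sum>k. ennreal (exp (- exp h) * ((exp h) ^ k /\<^sub>R fact k)))"
    by (simp only:)
  also have "\<dots> = ennreal (\<Sum>k. exp (- exp h) * ((exp h) ^ k /\<^sub>R fact k))"
    by (intro suminf_ennreal2 summable_mult summable_exp_generic) simp_all
  also have "(\<Sum>k. exp (- exp h) * ((exp h) ^ k /\<^sub>R fact k)) = exp (- exp h) * exp (exp h)"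
    
    using suminf_mult[OF summable_exp_generic[of "exp h"], of "exp (- exp h)"] by (simp only: exp_def)
  finally show ?thesis by (simp add: exp_minus)
next
  case (Normal_Linear \<sigma>)
  then have "\<sigma> > 0" using assms by (simp add: valid_regression_def)
  from prob_space.emeasure_space_1[OF prob_space_normal_density[OF this, of h]]
  show ?thesis by (simp add: Normal_Linear emeasure_density)
next
  case Exponential
  have "(\<integral>\<^sup>+y. ennreal (reg_density m y h) \<partial>response_measure m) =
     (\<integral>\<^sup>+y. indicator {0<..} y * ennreal (exp (- exp (- h) * y - h)) \<partial>lborel)"
    unfolding Exponential by (simp add: nn_integral_density)
  also have "\<dots> = (\<integral>\<^sup>+y. ennreal (exponential_density (exp (- h)) y) \<partial>lborel)"
  proof (rule nn_integral_cong_AE)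
    have "AE y in lborel. y \<noteq> (0::real)" by (rule AE_lborel_singleton)
    then show "AE y in lborel. indicator {0<..} y * ennreal (exp (- exp (- h) * y - h)) =
        ennreal (exponential_density (exp (- h)) y)"
    proof eventually_elim
      case (elim y)
      have "exp (- exp (- h) * y - h) = exp (- h) * exp (- y * exp (- h))"
        by (simp add: mult_exp_exp algebra_simps)
      with elim show ?case by (auto simp: exponential_density_def indicator_def)
    qed
  qed
  also have "\<dots> = 1"
    using prob_space.emeasure_space_1[OF prob_space_exponential_density[of "exp (- h)"]]
    by (simp add: emeasure_density)
  finally show ?thesis .
next
  case Logistic
  have "0 < 1 + exp h" by (simp add: add_pos_pos)
  then show ?thesis
    unfolding Logistic by (subst nn_integral_binary_response)
      (auto simp: exp_diff exp_minus field_simps simp flip: ennreal_plus)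
next
  case Probit
  then show ?thesis using std_normal_cdf_strict[of h]
    unfolding Probit by (subst nn_integral_binary_response)
      (auto simp flip: ennreal_plus)
qed

text \<open>The response measure has a finite density with respect to the probability measure
  \<open>f(y, 0) \<nu>\<^sub>y(dy)\<close>, because the density of the response is positive. This covers all families at once.\<close>

lemma sigma_finite_response_measure:
  assumes m: "valid_regression m"
  shows "sigma_finite_measure (response_measure m)"
proof -
  let ?M = "response_measure m" and ?f = "\<lambda>y. ennreal (reg_density m y 0)"
  let ?N = "density ?M ?f"
  have pos: "0 < reg_density m y 0" for y by (rule reg_density_pos[OF m])
  have "emeasure ?N (space ?N) = 1"
    using nn_integral_reg_density[OF m, of 0] by (simp add: emeasure_density)
  then interpret N: finite_measure ?N by (intro finite_measureI) simp
  have "?M = density ?N (\<lambda>y. ennreal (1 / reg_density m y 0))"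
    using pos by (subst density_density_eq) (auto simp: less_imp_le less_imp_neq[THEN not_sym] density_1 simp flip: ennreal_mult)
  moreover have "sigma_finite_measure (density ?N (\<lambda>y. ennreal (1 / reg_density m y 0)))"
    by (subst N.sigma_finite_iff_density_finite) auto
  ultimately show ?thesis by simp
qed

text \<open>The chi-square divergence of the response with parameter \<open>h\<close> from the one with parameter \<open>h'\<close>.\<close>

definition chi_square :: "regression \<Rightarrow> real \<Rightarrow> real \<Rightarrow> ennreal" where
  "chi_square m h h' =
     (\<integral>\<^sup>+y. ennreal ((reg_density m y h - reg_density m y h')\<^sup>2 / reg_density m y h') \<partial>response_measure m)"

lemma chi_square_le_ratio:
  assumes m: "valid_regression m" and q: "0 \<le> q"
    and le: "AE y in response_measure m. \<bar>reg_density m y h - reg_density m y h'\<bar> \<le> q * reg_density m y h'"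
  shows "chi_square m h h' \<le> ennreal (q\<^sup>2)"
proof -
  have pos: "0 < reg_density m y h'" for y by (rule reg_density_pos[OF m])
  have "chi_square m h h' \<le> (\<integral>\<^sup>+y. ennreal (q\<^sup>2) * ennreal (reg_density m y h') \<partial>response_measure m)"
    unfolding chi_square_def
  proof (intro nn_integral_mono_AE, use le in eventually_elim)
    case (elim y)
    have "(reg_density m y h - reg_density m y h')\<^sup>2 \<le> (q * reg_density m y h')\<^sup>2"
      using elim by (metis abs_ge_zero power2_abs power_mono)
    then have "(reg_density m y h - reg_density m y h')\<^sup>2 / reg_density m y h' \<le> q\<^sup>2 * reg_density m y h'"
      using pos[of y] by (simp add: field_simps power2_eq_square)
    then show ?case using pos[of y] by (simp flip: ennreal_mult add: less_imp_le)
  qed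
  also have "\<dots> = ennreal (q\<^sup>2)"
    by (subst nn_integral_cmult) (auto simp: nn_integral_reg_density[OF m])
  finally show ?thesis .
qed

text \<open>Expand the square; both densities integrate to one. The identity is stated additively because
  extended nonnegative numbers do not subtract well.\<close>

lemma chi_square_add_2:
  assumes m: "valid_regression m"
  shows "chi_square m h h' + 2 =
    (\<integral>\<^sup>+y. ennreal ((reg_density m y h)\<^sup>2 / reg_density m y h') \<partial>response_measure m) + 1"
proof -
  let ?f = "\<lambda>y. reg_density m y h" and ?g = "\<lambda>y. reg_density m y h'" and ?M = "response_measure m"
  have pos: "0 < ?f y" "0 < ?g y" for y by (auto intro: reg_density_pos[OF m])
  have "chi_square m h h' + 2 * (\<integral>\<^sup>+y. ennreal (?f y) \<partial>?M) =
      (\<integral>\<^sup>+y. ennreal ((?f y - ?g y)\<^sup>2 / ?g y) + 2 * ennreal (?f y) \<partial>?M)"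
    unfolding chi_square_def by (simp add: nn_integral_add nn_integral_cmult)
  also have "\<dots> = (\<integral>\<^sup>+y. ennreal ((?f y)\<^sup>2 / ?g y) + ennreal (?g y) \<partial>?M)"
  proof (intro nn_integral_cong)
    fix y
    have "(?f y - ?g y)\<^sup>2 / ?g y + 2 * ?f y = (?f y)\<^sup>2 / ?g y + ?g y"
      using pos[of y] by (simp add: field_simps power2_eq_square)
    then show "ennreal ((?f y - ?g y)\<^sup>2 / ?g y) + 2 * ennreal (?f y) =
        ennreal ((?f y)\<^sup>2 / ?g y) + ennreal (?g y)"
      using pos[of y] by (simp flip: ennreal_plus ennreal_numeral ennreal_mult add: less_imp_le)
  qed
  also have "\<dots> = (\<integral>\<^sup>+y. ennreal ((?f y)\<^sup>2 / ?g y) \<partial>?M) + 1"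
    by (simp add: nn_integral_add nn_integral_reg_density[OF m])
  finally show ?thesis by (simp add: nn_integral_reg_density[OF m])
qed

lemma nn_integral_density_square_ratio:
  assumes m: "valid_regression m"
  shows "(\<integral>\<^sup>+y. ennreal ((reg_density m y h)\<^sup>2 / reg_density m y h') \<partial>response_measure m) =
    chi_square m h h' + 1"
proof -
  have "(\<integral>\<^sup>+y. ennreal ((reg_density m y h)\<^sup>2 / reg_density m y h') \<partial>response_measure m) + 1 =
      (chi_square m h h' + 1) + 1"
    using chi_square_add_2[OF m, of h h'] by (simp add: add.assoc)
  then show ?thesis by (subst (asm) ennreal_add_left_cancel[of 1, unfolded add.commute[of 1]]) auto
qed

text \<open>In an exponential family \<open>f\<^sub>h\<^sup>2 / f\<^sub>h\<^sub>'\<close> is a multiple of another member of the family, so its integral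
  is the factor.\<close>

lemma chi_square_exponential_family:
  assumes m: "valid_regression m" and c: "0 \<le> c"
    and eq: "\<And>y. (reg_density m y h)\<^sup>2 / reg_density m y h' = (1 + c) * reg_density m y h''"
  shows "chi_square m h h' = ennreal c"
proof -
  have "chi_square m h h' + 1 =
      (\<integral>\<^sup>+y. ennreal (1 + c) * ennreal (reg_density m y h'') \<partial>response_measure m)"
    using c reg_density_pos[OF m]
    by (simp add: nn_integral_density_square_ratio[OF m, symmetric] eq ennreal_mult less_imp_le)
  also have "\<dots> = ennreal c + 1"
    using c by (subst nn_integral_cmult) (auto simp: nn_integral_reg_density[OF m] ennreal_plus add.commute)
  finally show ?thesis by (subst (asm) ennreal_add_left_cancel[of 1, unfolded add.commute[of 1]]) auto
qed

lemma abs_exp_minus_one_le: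
  fixes d :: real
  assumes "\<bar>d\<bar> \<le> 1"
  shows "\<bar>exp d - 1\<bar> \<le> 2 * \<bar>d\<bar>"
proof (cases "0 \<le> d")
  case True
  have "exp d \<le> 1 + d + d\<^sup>2" using True assms by (intro exp_bound) auto
  also have "d\<^sup>2 \<le> d" using True assms by (simp add: power2_eq_square mult_left_le)
  finally have "exp d \<le> 1 + 2 * d" by simp
  then show ?thesis using True by simp
next
  case False
  then have "\<bar>exp d - 1\<bar> = 1 - exp d" "\<bar>d\<bar> = - d" by auto
  then show ?thesis using False exp_ge_add_one_self[of d] by linarith
qed

text \<open>The divergence is \<open>exp (\<mu>' (\<mu> / \<mu>' - 1)\<^sup>2) - 1\<close> for the means \<open>\<mu> = exp h\<close> and \<open>\<mu>' = exp h'\<close>. The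
  factor \<open>\<mu>'\<close> is the source of the exponential dependence on the size of the parameters.\<close>

lemma chi_square_Poisson:
  assumes H: "0 \<le> H" "\<bar>h'\<bar> \<le> H" and le: "4 * exp H * \<bar>h - h'\<bar> \<le> 1"
  shows "chi_square Poisson h h' \<le> ennreal ((4 * exp H * \<bar>h - h'\<bar>)\<^sup>2)"
proof -
  let ?d = "h - h'"
  let ?e = "exp h' * (exp ?d - 1)\<^sup>2"
  have m: "valid_regression Poisson" by (simp add: valid_regression_def)
  have eH: "1 \<le> exp H" using H by simp
  have "4 * 1 * \<bar>?d\<bar> \<le> 4 * exp H * \<bar>?d\<bar>" using eH by (intro mult_right_mono mult_left_mono) auto
  also note le
  finally have d: "\<bar>?d\<bar> \<le> 1/4" by simp
  have eq: "chi_square Poisson h h' = ennreal (exp ?e - 1)"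
  proof (rule chi_square_exponential_family[OF m])
    fix y
    have e: "?e = exp (2 * h - h') - 2 * exp h + exp h'"
      by (simp add: power2_eq_square algebra_simps mult_exp_exp)
    have "(reg_density Poisson y h)\<^sup>2 / reg_density Poisson y h' = exp ?e * reg_density Poisson y (2 * h - h')"
      unfolding e by (simp add: power2_eq_square mult_exp_exp exp_diff[symmetric] algebra_simps)
    then show "(reg_density Poisson y h)\<^sup>2 / reg_density Poisson y h' =
      (1 + (exp ?e - 1)) * reg_density Poisson y (2 * h - h')" by simp
  qed simp
  have "(exp ?d - 1)\<^sup>2 \<le> (2 * \<bar>?d\<bar>)\<^sup>2"
    using power_mono[OF abs_exp_minus_one_le[of ?d], of 2] d by simp
  then have "?e \<le> exp H * (2 * \<bar>?d\<bar>)\<^sup>2" using H by (intro mult_mono) auto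
  also have "\<dots> = (4 * exp H * \<bar>?d\<bar>) * \<bar>?d\<bar>" by (simp add: power2_eq_square)
  finally have e: "?e \<le> (4 * exp H * \<bar>?d\<bar>) * \<bar>?d\<bar>" .
  also have "\<dots> \<le> 1 * \<bar>?d\<bar>" using le by (intro mult_right_mono) auto
  finally have "?e \<le> 1" using d by simp
  then have "exp ?e - 1 \<le> 2 * ?e" using abs_exp_minus_one_le[of ?e] by simp
  also have "\<dots> \<le> (4 * exp H * \<bar>?d\<bar>) * (2 * 1 * \<bar>?d\<bar>)" using e by simp
  also have "\<dots> \<le> (4 * exp H * \<bar>?d\<bar>) * (4 * exp H * \<bar>?d\<bar>)"
    using eH by (intro mult_left_mono mult_right_mono mult_mono) auto
  finally show ?thesis
    unfolding eq by (intro ennreal_leI) (simp only: power2_eq_square)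
qed

lemma chi_square_Normal_Linear:
  assumes \<sigma>: "0 < \<sigma>" and le: "(2 / \<sigma>) * \<bar>h - h'\<bar> \<le> 1"
  shows "chi_square (Normal_Linear \<sigma>) h h' \<le> ennreal (((2 / \<sigma>) * \<bar>h - h'\<bar>)\<^sup>2)"
proof -
  let ?m = "Normal_Linear \<sigma>" and ?d = "h - h'"
  let ?e = "(?d / \<sigma>)\<^sup>2" and ?q = "(2 / \<sigma>) * \<bar>?d\<bar>"
  have m: "valid_regression ?m" using \<sigma> by (simp add: valid_regression_def)
  have eq: "chi_square ?m h h' = ennreal (exp ?e - 1)"
  proof (rule chi_square_exponential_family[OF m])
    fix y
    let ?k = "1 / sqrt (2 * pi * \<sigma>\<^sup>2)"
    let ?E = "\<lambda>h. exp (- (y - h)\<^sup>2 / (2 * \<sigma>\<^sup>2))"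
    have k: "?k \<noteq> 0" using \<sigma> by simp
    have dens: "reg_density ?m y h = ?k * ?E h" for h by (simp add: normal_density_def)
    have "- (y - h)\<^sup>2 / (2 * \<sigma>\<^sup>2) + - (y - h)\<^sup>2 / (2 * \<sigma>\<^sup>2) - - (y - h')\<^sup>2 / (2 * \<sigma>\<^sup>2) =
        ?e + - (y - (2 * h - h'))\<^sup>2 / (2 * \<sigma>\<^sup>2)"
      using \<sigma> by (simp add: field_simps power2_eq_square)
    then have "?E h * ?E h / ?E h' = exp ?e * ?E (2 * h - h')"
      by (simp only: mult_exp_exp exp_diff[symmetric])
    moreover have "(k * a)\<^sup>2 / (k * b) = k * (a * a / b)" if "k \<noteq> 0" for k a b :: real
      using that by (simp add: power2_eq_square)
    note this[OF k, of "?E h" "?E h'"]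
    ultimately show "(reg_density ?m y h)\<^sup>2 / reg_density ?m y h' =
        (1 + (exp ?e - 1)) * reg_density ?m y (2 * h - h')"
      unfolding dens by simp
  qed simp
  have e4: "4 * ?e = ?q\<^sup>2" by (simp add: power_mult_distrib power_divide)
  have "?q\<^sup>2 \<le> 1" using le \<sigma> by (intro power_le_one) auto
  then have "?e \<le> 1" using e4 by simp
  then have "exp ?e - 1 \<le> 2 * ?e" using abs_exp_minus_one_le[of ?e] by simp
  also have "\<dots> \<le> ?q\<^sup>2" using e4 zero_le_power2[of "?d / \<sigma>"] by linarith
  finally show ?thesis unfolding eq by (intro ennreal_leI)
qed

text \<open>Only the ratio \<open>w\<close> of the two rates matters: the divergence is \<open>(1 - w)\<^sup>2 / (w (2 - w))\<close>. The third
  member of the family, used for the integral, has \<open>2 - w\<close> times the rate of the first.\<close>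

lemma chi_square_Exponential:
  assumes le: "4 * \<bar>h - h'\<bar> \<le> 1"
  shows "chi_square Exponential h h' \<le> ennreal ((4 * \<bar>h - h'\<bar>)\<^sup>2)"
proof -
  let ?m = Exponential and ?d = "h - h'"
  have m: "valid_regression ?m" by (simp add: valid_regression_def)
  define w where "w = exp ?d"
  have w: "\<bar>w - 1\<bar> \<le> 2 * \<bar>?d\<bar>" unfolding w_def using le by (intro abs_exp_minus_one_le) auto
  have w2: "1/2 \<le> w" "w \<le> 3/2" using w le by arith+
  have w0: "0 < w * (2 - w)" using w2 by simp
  define c where "c = (1 - w)\<^sup>2 / (w * (2 - w))"
  have c1: "1 + c = 1 / (w * (2 - w))" unfolding c_def using w2 by (simp add: field_simps power2_eq_square)
  have eq: "chi_square ?m h h' = ennreal c"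
  proof (rule chi_square_exponential_family[OF m, where h'' = "h - ln (2 - w)"])
    show "0 \<le> c" unfolding c_def using w0 by simp
    fix y
    have a: "exp (- h') = w * exp (- h)" unfolding w_def by (simp add: mult_exp_exp)
    have b: "exp (- (h - ln (2 - w))) = (2 - w) * exp (- h)" using w2 by (simp add: exp_diff exp_minus field_simps)
    have hh: "h' = h - ln w" unfolding w_def by simp
    have "(reg_density ?m y h)\<^sup>2 / reg_density ?m y h' =
        exp ((- exp (- h) * y - h) + (- exp (- h) * y - h) - (- (w * exp (- h)) * y - h'))"
      unfolding reg_density.simps a power2_eq_square by (simp only: mult_exp_exp exp_diff[symmetric])
    also have "(- exp (- h) * y - h) + (- exp (- h) * y - h) - (- (w * exp (- h)) * y - h') =
        - ln (w * (2 - w)) + (- ((2 - w) * exp (- h)) * y - (h - ln (2 - w)))"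
      using w2 unfolding hh by (simp add: ln_mult) (simp add: algebra_simps)
    also have "exp \<dots> = (1 + c) * reg_density ?m y (h - ln (2 - w))"
      unfolding reg_density.simps b c1 exp_add using w0 by (simp add: exp_minus inverse_eq_divide)
    finally show "(reg_density ?m y h)\<^sup>2 / reg_density ?m y h' = (1 + c) * reg_density ?m y (h - ln (2 - w))" .
  qed
  have "1/2 * (1/2) \<le> w * (2 - w)" using w2 by (intro mult_mono) auto
  then have "c \<le> (1 - w)\<^sup>2 / (1/4)" unfolding c_def by (intro divide_left_mono) auto
  also have "\<dots> = (2 * \<bar>w - 1\<bar>)\<^sup>2" by (simp add: power2_eq_square algebra_simps)
  also have "\<dots> \<le> (4 * \<bar>?d\<bar>)\<^sup>2" using w by (intro power_mono) auto
  finally show ?thesis unfolding eq by (intro ennreal_leI)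
qed

lemma AE_binary_response:
  assumes m: "m = Logistic \<or> m = Probit" and "P 0" "P 1"
  shows "AE y in response_measure m. P y"
proof (rule AE_I)
  show "{y \<in> space (response_measure m). \<not> P y} \<subseteq> - {0, 1}" using assms by auto
  have "emeasure (response_measure m) (- {0, 1}) = (\<integral>\<^sup>+y. indicator (- {0, 1}) y \<partial>response_measure m)"
    by (subst nn_integral_indicator) auto
  also have "\<dots> = 0" by (subst nn_integral_binary_response[OF m]) auto
  finally show "emeasure (response_measure m) (- {0, 1}) = 0" .
qed simp

text \<open>The logarithms of both success and failure probability are Lipschitz in the parameter.\<close>

lemma chi_square_Logistic:
  assumes le: "2 * \<bar>h - h'\<bar> \<le> 1"
  shows "chi_square Logistic h h' \<le> ennreal ((2 * \<bar>h - h'\<bar>)\<^sup>2)"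
proof (rule chi_square_le_ratio)
  show m: "valid_regression Logistic" by (simp add: valid_regression_def)
  have one: "0 < 1 + exp b" for b :: real by (simp add: add_pos_pos)
  have ratio: "\<bar>1 / (1 + exp b) - 1 / (1 + exp a)\<bar> \<le> 2 * \<bar>b - a\<bar> * (1 / (1 + exp a))"
    if "\<bar>b - a\<bar> \<le> 1" for a b :: real
  proof -
    have frac: "1 / q - 1 / p = (e / q) * x * (1 / p)" if "0 < p" "0 < q" "e * x = p - q" for p q e x :: real
      using that by (simp add: divide_simps)
    have "exp b * (exp (a - b) - 1) = (1 + exp a) - (1 + exp b)"
      by (simp add: right_diff_distrib mult_exp_exp)
    from frac[OF one one this]
    have "\<bar>1 / (1 + exp b) - 1 / (1 + exp a)\<bar> =
        \<bar>exp b / (1 + exp b)\<bar> * \<bar>exp (a - b) - 1\<bar> * \<bar>1 / (1 + exp a)\<bar>"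
      by (simp only: abs_mult)
    also have "\<dots> \<le> 1 * (2 * \<bar>a - b\<bar>) * (1 / (1 + exp a))"
    proof (intro mult_mono)
      show "\<bar>exp b / (1 + exp b)\<bar> \<le> 1" "\<bar>1 / (1 + exp a)\<bar> \<le> 1 / (1 + exp a)"
        using one[of a] one[of b] by simp_all
      show "\<bar>exp (a - b) - 1\<bar> \<le> 2 * \<bar>a - b\<bar>" using that by (intro abs_exp_minus_one_le) simp
    qed simp_all
    finally show ?thesis by (simp add: abs_minus_commute)
  qed
  have d0: "reg_density Logistic 0 h = 1 / (1 + exp h)" for h
    using one[of h] by (simp add: exp_minus inverse_eq_divide)
  have d1: "reg_density Logistic 1 h = 1 / (1 + exp (- h))" for h
  proof -
    have "reg_density Logistic 1 h = exp h / (1 + exp h)" using one[of h] by (simp add: exp_diff)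
    also have "\<dots> = 1 / (1 + exp (- h))" using one[of h] by (simp add: exp_minus divide_simps add.commute)
    finally show ?thesis .
  qed
  have le1: "\<bar>h - h'\<bar> \<le> 1" using le by argo
  have le2: "\<bar>- h - - h'\<bar> \<le> 1" using le1 by (simp add: abs_minus_commute)
  from ratio[OF le1] ratio[OF le2]
  have "\<bar>reg_density Logistic 0 h - reg_density Logistic 0 h'\<bar> \<le> 2 * \<bar>h - h'\<bar> * reg_density Logistic 0 h'"
    "\<bar>reg_density Logistic 1 h - reg_density Logistic 1 h'\<bar> \<le> 2 * \<bar>h - h'\<bar> * reg_density Logistic 1 h'"
    unfolding d0 d1 by (simp_all add: abs_minus_commute)
  then show "AE y in response_measure Logistic.
      \<bar>reg_density Logistic y h - reg_density Logistic y h'\<bar> \<le> 2 * \<bar>h - h'\<bar> * reg_density Logistic y h'"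
    by (intro AE_binary_response) simp_all
qed simp

lemma chi_square_Probit:
  assumes H: "0 \<le> H" "\<bar>h\<bar> \<le> H" "\<bar>h'\<bar> \<le> H" and le: "exp 2 * (1 + H) * \<bar>h - h'\<bar> \<le> 1"
  shows "chi_square Probit h h' \<le> ennreal ((exp 2 * (1 + H) * \<bar>h - h'\<bar>)\<^sup>2)"
proof (rule chi_square_le_ratio)
  show m: "valid_regression Probit" by (simp add: valid_regression_def)
  let ?d = "h - h'"
  have "1 * (\<bar>?d\<bar> * (1 + H)) \<le> exp 2 * (\<bar>?d\<bar> * (1 + H))" using H by (intro mult_right_mono) auto
  also have "\<dots> \<le> 1" using le by (simp add: mult_ac)
  finally have d: "\<bar>?d\<bar> * (1 + H) \<le> 1" by simp
  have d0: "reg_density Probit 0 h = 1 - std_normal_cdf h" and d1: "reg_density Probit 1 h = std_normal_cdf h" for h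
    using std_normal_cdf_strict[of h] by simp_all
  from std_normal_cdf_relative_lipschitz[OF H d]
  have "\<bar>reg_density Probit 0 h - reg_density Probit 0 h'\<bar> \<le> exp 2 * (1 + H) * \<bar>?d\<bar> * reg_density Probit 0 h'"
    "\<bar>reg_density Probit 1 h - reg_density Probit 1 h'\<bar> \<le> exp 2 * (1 + H) * \<bar>?d\<bar> * reg_density Probit 1 h'"
    unfolding d0 d1 by (simp_all add: abs_minus_commute)
  then show "AE y in response_measure Probit.
      \<bar>reg_density Probit y h - reg_density Probit y h'\<bar> \<le> exp 2 * (1 + H) * \<bar>h - h'\<bar> * reg_density Probit y h'"
    by (intro AE_binary_response) simp_all
  show "0 \<le> exp 2 * (1 + H) * \<bar>h - h'\<bar>" using H by simp
qed

text \<open>The order of growth of the Lipschitz modulus of the root of the divergence on \<open>[- H, H]\<close>. The linear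
  growth comes from the tails of the normal distribution in probit regression, the exponential growth
  from the variance \<open>exp h\<close> in Poisson regression. Only the logarithm of the modulus affects the rate.\<close>

definition chi_growth :: "regression \<Rightarrow> real \<Rightarrow> real" where
  "chi_growth m H = (if m = Poisson then exp H else 1 + H)"

lemma chi_growth_ge_1: "0 \<le> H \<Longrightarrow> 1 \<le> chi_growth m H"
  by (simp add: chi_growth_def)

text \<open>This is all that the argument needs to know about the five families beyond positivity and
  normalization of their densities.\<close>

lemma chi_square_bound:
  assumes m: "valid_regression m"
  obtains c where "1 \<le> c"
    "\<And>H h h' d. 0 \<le> H \<Longrightarrow> \<bar>h\<bar> \<le> H \<Longrightarrow> \<bar>h'\<bar> \<le> H \<Longrightarrow> \<bar>h - h'\<bar> \<le> d \<Longrightarrow>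
       c * chi_growth m H * d \<le> 1 \<Longrightarrow> chi_square m h h' \<le> ennreal ((c * chi_growth m H * d)\<^sup>2)"
proof -
  define P where "P c H h h' \<longleftrightarrow> (\<exists>a\<ge>0. a \<le> c * chi_growth m H \<and>
        (a * \<bar>h - h'\<bar> \<le> 1 \<longrightarrow> chi_square m h h' \<le> ennreal ((a * \<bar>h - h'\<bar>)\<^sup>2)))" for c H h h'
  have "\<exists>c\<ge>1. \<forall>H h h'. 0 \<le> H \<longrightarrow> \<bar>h\<bar> \<le> H \<longrightarrow> \<bar>h'\<bar> \<le> H \<longrightarrow> P c H h h'"
  proof (cases m)
    case Poisson
    have "P 4 H h h'" if "0 \<le> H" "\<bar>h'\<bar> \<le> H" for H h h'
      using chi_square_Poisson[OF that, of h] 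
      unfolding P_def Poisson by (intro exI[of _ "4 * exp H"]) (simp add: chi_growth_def)
    moreover have "(1::real) \<le> 4" by simp
    ultimately show ?thesis by blast
  next
    case (Normal_Linear \<sigma>)
    then have \<sigma>: "0 < \<sigma>" using m by (simp add: valid_regression_def)
    let ?c = "1 + 2 / \<sigma>"
    have "P ?c H h h'" if H: "0 \<le> H" for H h h'
      unfolding P_def
    proof (intro exI[of _ "2 / \<sigma>"] conjI impI)
      have "(2 / \<sigma>) * 1 \<le> ?c * (1 + H)" using H \<sigma> by (intro mult_mono) auto
      then show "2 / \<sigma> \<le> ?c * chi_growth m H" unfolding chi_growth_def Normal_Linear by simp
      show "0 \<le> 2 / \<sigma>" using \<sigma> by simp
      assume "2 / \<sigma> * \<bar>h - h'\<bar> \<le> 1"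
      then show "chi_square m h h' \<le> ennreal ((2 / \<sigma> * \<bar>h - h'\<bar>)\<^sup>2)"
        unfolding Normal_Linear by (rule chi_square_Normal_Linear[OF \<sigma>])
    qed
    moreover have "1 \<le> ?c" using \<sigma> by simp
    ultimately show ?thesis by blast
  next
    case Exponential
    have "P 4 H h h'" if "0 \<le> H" for H h h'
      using chi_square_Exponential[of h h'] that 
      unfolding P_def Exponential by (intro exI[of _ "4 :: real"]) (simp add: chi_growth_def)
    moreover have "(1::real) \<le> 4" by simp
    ultimately show ?thesis by blast
  next
    case Logistic
    have "P 2 H h h'" if "0 \<le> H" for H h h'
      using chi_square_Logistic[of h h'] that 
      unfolding P_def Logistic by (intro exI[of _ "2 :: real"]) (simp add: chi_growth_def)
    moreover have "(1::real) \<le> 2" by simp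
    ultimately show ?thesis by blast
  next
    case Probit
    have "P (exp 2) H h h'" if "0 \<le> H" "\<bar>h\<bar> \<le> H" "\<bar>h'\<bar> \<le> H" for H h h'
      using chi_square_Probit[OF that] that 
      unfolding P_def Probit by (intro exI[of _ "exp 2 * (1 + H)"]) (simp add: chi_growth_def)
    moreover have "(1::real) \<le> exp 2" by simp
    ultimately show ?thesis by blast
  qed
  then obtain c where c: "1 \<le> c"
    and ex: "\<And>H h h'. 0 \<le> H \<Longrightarrow> \<bar>h\<bar> \<le> H \<Longrightarrow> \<bar>h'\<bar> \<le> H \<Longrightarrow> P c H h h'" by blast
  show thesis
  proof (rule that[OF c])
    fix H h h' d :: real
    assume H: "0 \<le> H" "\<bar>h\<bar> \<le> H" "\<bar>h'\<bar> \<le> H" and d: "\<bar>h - h'\<bar> \<le> d" and le: "c * chi_growth m H * d \<le> 1"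
    from ex[OF H] obtain a where a: "0 \<le> a" "a \<le> c * chi_growth m H"
      "a * \<bar>h - h'\<bar> \<le> 1 \<Longrightarrow> chi_square m h h' \<le> ennreal ((a * \<bar>h - h'\<bar>)\<^sup>2)"
      unfolding P_def by auto
    have m1: "a * \<bar>h - h'\<bar> \<le> c * chi_growth m H * d" using a(1,2) d by (intro mult_mono) auto
    then have "chi_square m h h' \<le> ennreal ((a * \<bar>h - h'\<bar>)\<^sup>2)" using le by (intro a(3)) simp
    also have "\<dots> \<le> ennreal ((c * chi_growth m H * d)\<^sup>2)"
      using m1 a(1) by (intro ennreal_leI power_mono) auto
    finally show "chi_square m h h' \<le> ennreal ((c * chi_growth m H * d)\<^sup>2)" .
  qed
qed

section \<open>A single observation\<close>

text \<open>The relation between affinity \<open>A\<close> and squared Hellinger distance \<open>B\<close> of two probability densities.\<close>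

lemma affinity_le_of_distance_ge:
  assumes "2 * A + B = (2 :: ennreal)" "ennreal (e\<^sup>2) \<le> B"
  shows "A \<le> ennreal (1 - e\<^sup>2 / 2)"
proof -
  have "2 * A + B \<noteq> \<top>" using assms(1) by simp
  then have fin: "A \<noteq> \<top>" "B \<noteq> \<top>" by (auto simp: ennreal_mult_eq_top_iff)
  obtain a where a: "A = ennreal a" "0 \<le> a" using fin by (cases A) auto
  obtain b where b: "B = ennreal b" "0 \<le> b" using fin by (cases B) auto
  have "ennreal (2 * a + b) = ennreal 2"
    using assms(1) a b by (simp add: ennreal_plus ennreal_mult)
  then have "2 * a + b = 2" using a b by (subst (asm) ennreal_inj) auto
  moreover have "e\<^sup>2 \<le> b" using assms(2) b by (simp add: ennreal_le_iff)
  ultimately show ?thesis unfolding a by (intro ennreal_leI) auto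
qed

text \<open>The regressor ranges over an arbitrary probability space, and a parameter is any measurable function
  \<open>h\<close> on it, the linear parameter as a function of the regressor; \<open>h\<^sub>0\<close> is the truth.\<close>

locale regression_truth = prob_space \<nu> for \<nu> :: "'x measure" +
  fixes m :: regression and h\<^sub>0 :: "'x \<Rightarrow> real"
  assumes valid: "valid_regression m"
    and h0_measurable [measurable]: "h\<^sub>0 \<in> borel_measurable \<nu>"
begin

abbreviation "R \<equiv> response_measure m"
abbreviation dens :: "('x \<Rightarrow> real) \<Rightarrow> 'x \<times> real \<Rightarrow> real" where
  "dens h z \<equiv> reg_density m (snd z) (h (fst z))"

definition S :: "('x \<times> real) measure" where
  "S = density (\<nu> \<Otimes>\<^sub>M R) (\<lambda>z. ennreal (dens h\<^sub>0 z))"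

definition hellinger_sq :: "('x \<Rightarrow> real) \<Rightarrow> real" where
  "hellinger_sq h = (\<integral>x. (\<integral>y. (sqrt (reg_density m y (h x)) - sqrt (reg_density m y (h\<^sub>0 x)))\<^sup>2 \<partial>R) \<partial>\<nu>)"

sublocale R: sigma_finite_measure R
  by (rule sigma_finite_response_measure[OF valid])

sublocale \<nu>R: pair_sigma_finite \<nu> R ..

lemma dens_pos: "0 < dens h z"
  by (rule reg_density_pos[OF valid])

lemma reg_pos: "0 < reg_density m y t"
  by (rule reg_density_pos[OF valid])

lemma sets_S [measurable_cong]: "sets S = sets (\<nu> \<Otimes>\<^sub>M R)"
  unfolding S_def by simp

lemma dens_measurable [measurable]:
  assumes [measurable]: "h \<in> borel_measurable \<nu>"
  shows "dens h \<in> borel_measurable (\<nu> \<Otimes>\<^sub>M R)"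
  by measurable

lemma nn_integral_S:
  assumes [measurable]: "g \<in> borel_measurable (\<nu> \<Otimes>\<^sub>M R)"
  shows "(\<integral>\<^sup>+z. g z \<partial>S) = (\<integral>\<^sup>+x. \<integral>\<^sup>+y. ennreal (reg_density m y (h\<^sub>0 x)) * g (x, y) \<partial>R \<partial>\<nu>)"
  unfolding S_def by (simp add: nn_integral_density R.nn_integral_fst[symmetric])

lemma nn_integral_S_mult:
  assumes [measurable]: "g \<in> borel_measurable (\<nu> \<Otimes>\<^sub>M R)"
    and eq: "\<And>x y. reg_density m y (h\<^sub>0 x) * g (x, y) = k x y"
  shows "(\<integral>\<^sup>+z. ennreal (g z) \<partial>S) = (\<integral>\<^sup>+x. \<integral>\<^sup>+y. ennreal (k x y) \<partial>R \<partial>\<nu>)"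
  by (subst nn_integral_S) (simp_all add: eq[symmetric] ennreal_mult' less_imp_le[OF reg_pos])

lemma prob_space_S: "prob_space S"
proof
  have "emeasure S (space S) = (\<integral>\<^sup>+z. ennreal 1 \<partial>S)" by simp
  also have "\<dots> = (\<integral>\<^sup>+x. \<integral>\<^sup>+y. ennreal (reg_density m y (h\<^sub>0 x)) \<partial>R \<partial>\<nu>)"
    by (rule nn_integral_S_mult) auto
  also have "\<dots> = 1" by (simp add: nn_integral_reg_density[OF valid] emeasure_space_1)
  finally show "emeasure S (space S) = 1" .
qed

lemma nn_integral_ratio:
  assumes [measurable]: "h \<in> borel_measurable \<nu>"
  shows "(\<integral>\<^sup>+z. ennreal (dens h z / dens h\<^sub>0 z) \<partial>S) = 1"
proof -
  have "(\<integral>\<^sup>+z. ennreal (dens h z / dens h\<^sub>0 z) \<partial>S) = (\<integral>\<^sup>+x. \<integral>\<^sup>+y. ennreal (reg_density m y (h x)) \<partial>R \<partial>\<nu>)"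
    by (rule nn_integral_S_mult) (auto simp: less_imp_neq[OF reg_pos, THEN not_sym])
  then show ?thesis by (simp add: nn_integral_reg_density[OF valid] emeasure_space_1)
qed

text \<open>The expected inverse likelihood ratio exceeds one by the chi-square divergence.\<close>

lemma nn_integral_inverse_ratio:
  assumes [measurable]: "h \<in> borel_measurable \<nu>" and q: "0 \<le> q"
    and chi: "AE x in \<nu>. chi_square m (h\<^sub>0 x) (h x) \<le> ennreal q"
  shows "(\<integral>\<^sup>+z. ennreal (dens h\<^sub>0 z / dens h z) \<partial>S) \<le> ennreal (1 + q)"
proof -
  have "(\<integral>\<^sup>+z. ennreal (dens h\<^sub>0 z / dens h z) \<partial>S) =
      (\<integral>\<^sup>+x. \<integral>\<^sup>+y. ennreal ((reg_density m y (h\<^sub>0 x))\<^sup>2 / reg_density m y (h x)) \<partial>R \<partial>\<nu>)"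
    by (rule nn_integral_S_mult) (auto simp: power2_eq_square)
  also have "\<dots> \<le> (\<integral>\<^sup>+x. ennreal (1 + q) \<partial>\<nu>)"
    unfolding nn_integral_density_square_ratio[OF valid]
    by (intro nn_integral_mono_AE, use chi in eventually_elim)
       (use q in \<open>simp add: ennreal_plus add.commute add_mono\<close>)
  finally show ?thesis by (simp add: emeasure_space_1)
qed

text \<open>The nested integrals that define the distance are finite, as the squared difference of the roots is
  at most the sum of two probability densities; they may thus be computed as nonnegative integrals.\<close>

lemma hellinger_sq_nn_integral:
  assumes [measurable]: "h \<in> borel_measurable \<nu>"
  shows "(\<integral>\<^sup>+x. \<integral>\<^sup>+y. ennreal ((sqrt (reg_density m y (h x)) - sqrt (reg_density m y (h\<^sub>0 x)))\<^sup>2) \<partial>R \<partial>\<nu>)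
    = ennreal (hellinger_sq h)"
proof -
  let ?g = "\<lambda>x y. (sqrt (reg_density m y (h x)) - sqrt (reg_density m y (h\<^sub>0 x)))\<^sup>2"
  let ?G = "\<lambda>x. \<integral>y. ?g x y \<partial>R"
  have le: "(\<integral>\<^sup>+y. ennreal (?g x y) \<partial>R) \<le> 2" for x
  proof -
    have "(\<integral>\<^sup>+y. ennreal (?g x y) \<partial>R) \<le>
        (\<integral>\<^sup>+y. ennreal (reg_density m y (h x)) + ennreal (reg_density m y (h\<^sub>0 x)) \<partial>R)"
    proof (intro nn_integral_mono)
      fix y
      have "?g x y \<le> reg_density m y (h x) + reg_density m y (h\<^sub>0 x)"
        using reg_pos[of y "h x"] reg_pos[of y "h\<^sub>0 x"] by (simp add: power2_diff)
      then show "ennreal (?g x y) \<le> ennreal (reg_density m y (h x)) + ennreal (reg_density m y (h\<^sub>0 x))"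
        using reg_pos[of y "h x"] reg_pos[of y "h\<^sub>0 x"]
        by (simp add: ennreal_plus[symmetric] less_imp_le del: ennreal_plus)
    qed
    also have "\<dots> = 2" by (subst nn_integral_add) (auto simp: nn_integral_reg_density[OF valid])
    finally show ?thesis .
  qed
  have inner: "(\<integral>\<^sup>+y. ennreal (?g x y) \<partial>R) = ennreal (?G x)" for x
  proof (rule nn_integral_eq_integral)
    show "integrable R (?g x)"
      by (rule integrableI_nonneg) (use le[of x] in \<open>auto intro: le_less_trans\<close>)
  qed simp
  have G: "0 \<le> ?G x" "?G x \<le> 2" for x
    using le[of x] unfolding inner by (simp_all add: ennreal_le_iff2 integral_nonneg flip: ennreal_numeral)
  have [measurable]: "?G \<in> borel_measurable \<nu>"
    by (rule R.borel_measurable_lebesgue_integral) measurable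
  have "integrable \<nu> ?G" by (rule integrable_const_bound[of _ 2]) (use G in auto)
  then show ?thesis unfolding inner hellinger_sq_def
    using G by (intro nn_integral_eq_integral) auto
qed

lemma nn_integral_sqrt_ratio:
  assumes [measurable]: "h \<in> borel_measurable \<nu>" and far: "e\<^sup>2 \<le> hellinger_sq h"
  shows "(\<integral>\<^sup>+x. \<integral>\<^sup>+y. ennreal (sqrt (reg_density m y (h x) * reg_density m y (h\<^sub>0 x))) \<partial>R \<partial>\<nu>)
     \<le> ennreal (1 - e\<^sup>2 / 2)" (is "?A \<le> _")
proof (rule affinity_le_of_distance_ge)
  let ?g = "\<lambda>x y. (sqrt (reg_density m y (h x)) - sqrt (reg_density m y (h\<^sub>0 x)))\<^sup>2"
  let ?s = "\<lambda>x y. sqrt (reg_density m y (h x) * reg_density m y (h\<^sub>0 x))"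
  have "2 * ?A + (\<integral>\<^sup>+x. \<integral>\<^sup>+y. ennreal (?g x y) \<partial>R \<partial>\<nu>) =
      (\<integral>\<^sup>+x. \<integral>\<^sup>+y. 2 * ennreal (?s x y) + ennreal (?g x y) \<partial>R \<partial>\<nu>)"
    by (simp add: nn_integral_add nn_integral_cmult)
  also have "\<dots> = (\<integral>\<^sup>+x. \<integral>\<^sup>+y. ennreal (reg_density m y (h x)) + ennreal (reg_density m y (h\<^sub>0 x)) \<partial>R \<partial>\<nu>)"
  proof (intro nn_integral_cong)
    fix x y
    have "2 * ?s x y + ?g x y = reg_density m y (h x) + reg_density m y (h\<^sub>0 x)"
      using reg_pos[of y "h x"] reg_pos[of y "h\<^sub>0 x"] by (simp add: power2_diff real_sqrt_mult)
    moreover have "ennreal (2 * ?s x y + ?g x y) = 2 * ennreal (?s x y) + ennreal (?g x y)"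
      using reg_pos[of y "h x"] reg_pos[of y "h\<^sub>0 x"] by (subst ennreal_plus) (auto simp: ennreal_mult)
    ultimately show "2 * ennreal (?s x y) + ennreal (?g x y) =
        ennreal (reg_density m y (h x)) + ennreal (reg_density m y (h\<^sub>0 x))"
      using reg_pos[of y "h x"] reg_pos[of y "h\<^sub>0 x"] by (simp add: less_imp_le)
  qed
  also have "\<dots> = 2"
    by (simp add: nn_integral_add nn_integral_reg_density[OF valid] emeasure_space_1)
  finally show "2 * ?A + (\<integral>\<^sup>+x. \<integral>\<^sup>+y. ennreal (?g x y) \<partial>R \<partial>\<nu>) = 2" .
  show "ennreal (e\<^sup>2) \<le> (\<integral>\<^sup>+x. \<integral>\<^sup>+y. ennreal (?g x y) \<partial>R \<partial>\<nu>)"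
    unfolding hellinger_sq_nn_integral[OF assms(1)] using far by (rule ennreal_leI)
qed

lemma nn_integral_S_sqrt_ratio:
  assumes [measurable]: "h \<in> borel_measurable \<nu>" and far: "e\<^sup>2 \<le> hellinger_sq h"
  shows "(\<integral>\<^sup>+z. ennreal (sqrt (dens h z / dens h\<^sub>0 z)) \<partial>S) \<le> ennreal (1 - e\<^sup>2 / 2)"
proof -
  have "(\<integral>\<^sup>+z. ennreal (sqrt (dens h z / dens h\<^sub>0 z)) \<partial>S) =
     (\<integral>\<^sup>+x. \<integral>\<^sup>+y. ennreal (sqrt (reg_density m y (h x) * reg_density m y (h\<^sub>0 x))) \<partial>R \<partial>\<nu>)"
  proof (rule nn_integral_S_mult)
    have "b * sqrt (a / b) = sqrt (a * b)" if "0 < a" "0 < b" for a b :: real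
      using that by (simp add: real_sqrt_divide real_sqrt_mult real_div_sqrt divide_simps)
    then show "reg_density m y (h\<^sub>0 x) * sqrt (dens h (x, y) / dens h\<^sub>0 (x, y)) =
        sqrt (reg_density m y (h x) * reg_density m y (h\<^sub>0 x))" for x y
      using reg_pos by simp
  qed simp
  also have "\<dots> \<le> ennreal (1 - e\<^sup>2 / 2)" by (rule nn_integral_sqrt_ratio[OF assms])
  finally show ?thesis .
qed

text \<open>If \<open>h\<close> were equal to \<open>c\<close>, then the integrand would be the root of the likelihood ratio of \<open>c\<close>, whose
  expectation is at most \<open>1 - e\<^sup>2 / 2\<close> because \<open>c\<close> is far from the truth. Replacing \<open>c\<close> by \<open>h\<close> in one of
  the factors adds \<open>(f\<^sub>h - f\<^sub>c) (f\<^sub>0 / f\<^sub>c)\<^sup>1\<^sup>/\<^sup>2\<close>, which the arithmetic-geometric mean inequality bounds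
  by the chi-square divergence and the mass of the truth.\<close>

lemma nn_integral_S_transfer:
  assumes [measurable]: "h \<in> borel_measurable \<nu>" "c \<in> borel_measurable \<nu>"
    and far: "e\<^sup>2 \<le> hellinger_sq c" and e: "e\<^sup>2 \<le> 2"
    and \<kappa>: "0 < \<kappa>" and chi: "AE x in \<nu>. chi_square m (h x) (c x) \<le> ennreal (\<kappa>\<^sup>2)"
  shows "(\<integral>\<^sup>+z. ennreal (dens h z / dens h\<^sub>0 z * sqrt (dens h\<^sub>0 z / dens c z)) \<partial>S)
     \<le> ennreal (1 - e\<^sup>2 / 2 + \<kappa>)"
proof -
  let ?f = "\<lambda>x y. reg_density m y (h x)" and ?g = "\<lambda>x y. reg_density m y (c x)"
    and ?p = "\<lambda>x y. reg_density m y (h\<^sub>0 x)"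
  have pt: "f * sqrt (p / g) \<le> sqrt (g * p) + (\<kappa> / 2) * p + (1 / (2 * \<kappa>)) * ((f - g)\<^sup>2 / g)"
    if "0 < f" "0 < g" "0 < p" for f g p :: real
  proof -
    \<comment> \<open>Weighting the two factors by \<open>\<kappa>\<close> balances the two contributions \<open>\<kappa> / 2\<close>.\<close>
    let ?a = "(f - g) / sqrt g" and ?b = "sqrt p"
    have "0 \<le> (?a - \<kappa> * ?b)\<^sup>2" by simp
    then have "2 * \<kappa> * (?a * ?b) \<le> ?a\<^sup>2 + \<kappa>\<^sup>2 * ?b\<^sup>2"
      by (simp add: power2_diff power_mult_distrib mult_ac)
    then have "?a * ?b \<le> (?a\<^sup>2 + \<kappa>\<^sup>2 * ?b\<^sup>2) / (2 * \<kappa>)" using \<kappa> by (simp add: field_simps)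
    also have "\<dots> = (\<kappa> / 2) * p + (1 / (2 * \<kappa>)) * ((f - g)\<^sup>2 / g)"
      using \<kappa> that by (simp add: power_divide add_divide_distrib power2_eq_square[of \<kappa>])
    finally have "?a * ?b \<le> (\<kappa> / 2) * p + (1 / (2 * \<kappa>)) * ((f - g)\<^sup>2 / g)" .
    moreover have "f * sqrt (p / g) = sqrt (g * p) + ?a * ?b"
    proof -
      have "g * sqrt (p / g) = sqrt (g * p)"
        using that by (simp add: real_sqrt_divide real_sqrt_mult real_div_sqrt divide_simps)
      moreover have "(f - g) * sqrt (p / g) = ?a * ?b" by (simp add: real_sqrt_divide)
      ultimately show ?thesis by (simp add: algebra_simps)
    qed
    ultimately show ?thesis by simp
  qed
  have "(\<integral>\<^sup>+z. ennreal (dens h z / dens h\<^sub>0 z * sqrt (dens h\<^sub>0 z / dens c z)) \<partial>S) =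
      (\<integral>\<^sup>+x. \<integral>\<^sup>+y. ennreal (?f x y * sqrt (?p x y / ?g x y)) \<partial>R \<partial>\<nu>)"
    by (rule nn_integral_S_mult) (auto simp: less_imp_neq[OF reg_pos, THEN not_sym])
  also have "\<dots> \<le> (\<integral>\<^sup>+x. \<integral>\<^sup>+y. ennreal (sqrt (?g x y * ?p x y)) + ennreal (\<kappa> / 2) * ennreal (?p x y)
      + ennreal (1 / (2 * \<kappa>)) * ennreal ((?f x y - ?g x y)\<^sup>2 / ?g x y) \<partial>R \<partial>\<nu>)"
  proof (intro nn_integral_mono)
    fix x y
    have nn: "0 \<le> sqrt (?g x y * ?p x y)" "0 \<le> \<kappa> / 2 * ?p x y" "0 \<le> (1 / (2 * \<kappa>)) * ((?f x y - ?g x y)\<^sup>2 / ?g x y)"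
      using \<kappa> less_imp_le[OF reg_pos] by auto
    have "ennreal (?f x y * sqrt (?p x y / ?g x y)) \<le>
      ennreal (sqrt (?g x y * ?p x y) + \<kappa> / 2 * ?p x y + (1 / (2 * \<kappa>)) * ((?f x y - ?g x y)\<^sup>2 / ?g x y))"
      by (intro ennreal_leI pt reg_pos)
    also have "\<dots> = ennreal (sqrt (?g x y * ?p x y)) + ennreal (\<kappa> / 2 * ?p x y)
      + ennreal ((1 / (2 * \<kappa>)) * ((?f x y - ?g x y)\<^sup>2 / ?g x y))"
      using nn by (simp only: ennreal_plus add_nonneg_nonneg)
    finally show "ennreal (?f x y * sqrt (?p x y / ?g x y)) \<le>
      ennreal (sqrt (?g x y * ?p x y)) + ennreal (\<kappa> / 2) * ennreal (?p x y)
      + ennreal (1 / (2 * \<kappa>)) * ennreal ((?f x y - ?g x y)\<^sup>2 / ?g x y)"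
      using \<kappa> by (simp only: ennreal_mult' divide_nonneg_nonneg less_imp_le[OF \<kappa>] zero_le_numeral zero_le_one mult_nonneg_nonneg)
  qed
  also have "\<dots> = (\<integral>\<^sup>+x. (\<integral>\<^sup>+y. ennreal (sqrt (?g x y * ?p x y)) \<partial>R) + (ennreal (\<kappa> / 2)
      + ennreal (1 / (2 * \<kappa>)) * chi_square m (h x) (c x)) \<partial>\<nu>)"
    by (intro nn_integral_cong)
       (simp add: nn_integral_add nn_integral_cmult chi_square_def nn_integral_reg_density[OF valid] add.assoc)
  also have "\<dots> \<le> (\<integral>\<^sup>+x. (\<integral>\<^sup>+y. ennreal (sqrt (?g x y * ?p x y)) \<partial>R) + ennreal \<kappa> \<partial>\<nu>)"
  proof (intro nn_integral_mono_AE, use chi in eventually_elim)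
    case (elim x)
    have "ennreal (1 / (2 * \<kappa>)) * chi_square m (h x) (c x) \<le> ennreal (1 / (2 * \<kappa>)) * ennreal (\<kappa>\<^sup>2)"
      using elim by (rule mult_left_mono) simp
    also have "\<dots> = ennreal (\<kappa> / 2)" using \<kappa> by (simp add: ennreal_mult[symmetric] power2_eq_square)
    finally have "ennreal (\<kappa> / 2) + ennreal (1 / (2 * \<kappa>)) * chi_square m (h x) (c x) \<le> ennreal (\<kappa> / 2) + ennreal (\<kappa> / 2)"
      by (rule add_left_mono)
    also have "\<dots> = ennreal \<kappa>" using \<kappa> by (simp add: ennreal_plus[symmetric] del: ennreal_plus)
    finally show ?case by (rule add_left_mono)
  qed
  also have "\<dots> = (\<integral>\<^sup>+x. (\<integral>\<^sup>+y. ennreal (sqrt (?g x y * ?p x y)) \<partial>R) \<partial>\<nu>) + ennreal \<kappa>"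
    by (subst nn_integral_add) (auto simp: emeasure_space_1)
  also have "\<dots> \<le> ennreal (1 - e\<^sup>2 / 2) + ennreal \<kappa>"
    by (intro add_right_mono nn_integral_sqrt_ratio far) simp
  also have "\<dots> = ennreal (1 - e\<^sup>2 / 2 + \<kappa>)" using e \<kappa> by (simp add: ennreal_plus)
  finally show ?thesis .
qed

end

section \<open>Likelihood ratios of a sample\<close>

lemma Markov_nn_integral:
  assumes [measurable]: "u \<in> borel_measurable M"
  shows "emeasure M {x \<in> space M. 1 \<le> u x} \<le> (\<integral>\<^sup>+x. u x \<partial>M)"
proof -
  have "emeasure M {x \<in> space M. 1 \<le> 1 * u x} \<le> 1 * (\<integral>\<^sup>+x. u x * indicator (space M) x \<partial>M)"
    by (rule nn_integral_Markov_inequality) auto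
  also have "\<dots> = (\<integral>\<^sup>+x. u x \<partial>M)" by (auto intro!: nn_integral_cong)
  finally show ?thesis by simp
qed

lemma sqrt_prod: "sqrt (\<Prod>i\<in>A. f i) = (\<Prod>i\<in>A. sqrt (f i))"
  by (induction A rule: infinite_finite_induct) (auto simp: real_sqrt_mult)

context regression_truth
begin

definition data :: "nat \<Rightarrow> (nat \<Rightarrow> 'x \<times> real) measure" where
  "data n = PiM {1..n} (\<lambda>_. S)"

definition lik :: "('x \<Rightarrow> real) \<Rightarrow> nat \<Rightarrow> (nat \<Rightarrow> 'x \<times> real) \<Rightarrow> real" where
  "lik h n D = (\<Prod>i=1..n. dens h (D i) / dens h\<^sub>0 (D i))"

lemma prob_space_data: "prob_space (data n)"
  unfolding data_def by (intro prob_space_PiM prob_space_S)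

lemma lik_pos: "0 < lik h n D"
  unfolding lik_def by (intro prod_pos ballI divide_pos_pos dens_pos)

lemma measurable_data_component [measurable]:
  "i \<in> {1..n} \<Longrightarrow> (\<lambda>D. D i) \<in> measurable (data n) (\<nu> \<Otimes>\<^sub>M R)"
  unfolding data_def by (subst measurable_cong_sets[OF refl sets_S[symmetric]]) measurable

lemma lik_measurable [measurable]:
  assumes [measurable]: "h \<in> borel_measurable \<nu>"
  shows "lik h n \<in> borel_measurable (data n)"
  unfolding lik_def[abs_def]
proof (intro borel_measurable_prod borel_measurable_divide)
  fix i assume i: "i \<in> {1..n}"
  show "(\<lambda>D. dens h (D i)) \<in> borel_measurable (data n)"
    using measurable_compose[OF measurable_data_component[OF i] dens_measurable] by simp
  show "(\<lambda>D. dens h\<^sub>0 (D i)) \<in> borel_measurable (data n)"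
    using measurable_compose[OF measurable_data_component[OF i] dens_measurable[OF h0_measurable]] by simp
qed

lemma nn_integral_data_prod:
  assumes [measurable]: "g \<in> borel_measurable (\<nu> \<Otimes>\<^sub>M R)" and g: "\<And>z. 0 \<le> g z"
  shows "(\<integral>\<^sup>+D. ennreal (\<Prod>i=1..n. g (D i)) \<partial>data n) = (\<integral>\<^sup>+z. ennreal (g z) \<partial>S) ^ n"
proof -
  interpret P: product_prob_space "\<lambda>_::nat. S" "{1..n}"
    by (intro product_prob_spaceI prob_space_S)
  have "(\<integral>\<^sup>+D. ennreal (\<Prod>i=1..n. g (D i)) \<partial>data n) = (\<integral>\<^sup>+D. (\<Prod>i=1..n. ennreal (g (D i))) \<partial>data n)"
    using g by (simp add: prod_ennreal)
  also have "\<dots> = (\<Prod>i=1..n. \<integral>\<^sup>+z. ennreal (g z) \<partial>S)"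
    unfolding data_def
    by (rule P.product_nn_integral_prod) (auto simp: measurable_cong_sets[OF sets_S refl])
  finally show ?thesis by simp
qed

lemma nn_integral_lik:
  assumes "h \<in> borel_measurable \<nu>"
  shows "(\<integral>\<^sup>+D. ennreal (lik h n D) \<partial>data n) = 1"
  unfolding lik_def using assms
  by (subst nn_integral_data_prod[where g = "\<lambda>z. dens h z / dens h\<^sub>0 z"])
     (auto simp: nn_integral_ratio less_imp_le[OF reg_pos])

text \<open>The probability that a likelihood ratio is at least one is bounded by the expectation of its root.\<close>

lemma test_error:
  assumes T: "finite T" "\<And>c. c \<in> T \<Longrightarrow> c \<in> borel_measurable \<nu>"
    and far: "\<And>c. c \<in> T \<Longrightarrow> e\<^sup>2 \<le> hellinger_sq c" and e: "e\<^sup>2 \<le> 2"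
  shows "emeasure (data n) {D \<in> space (data n). \<exists>c\<in>T. 1 \<le> lik c n D}
    \<le> ennreal (real (card T) * (1 - e\<^sup>2 / 2) ^ n)"
proof -
  have single: "emeasure (data n) {D \<in> space (data n). 1 \<le> lik c n D} \<le> ennreal ((1 - e\<^sup>2 / 2) ^ n)"
    if c: "c \<in> T" for c
  proof -
    have [measurable]: "c \<in> borel_measurable \<nu>" using T(2)[OF c] .
    have "{D \<in> space (data n). 1 \<le> lik c n D} = {D \<in> space (data n). 1 \<le> ennreal (sqrt (lik c n D))}"
      by (simp add: ennreal_1[symmetric] ennreal_le_iff less_imp_le[OF lik_pos] del: ennreal_1)
    then have "emeasure (data n) {D \<in> space (data n). 1 \<le> lik c n D}
        \<le> (\<integral>\<^sup>+D. ennreal (sqrt (lik c n D)) \<partial>data n)"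
      by (simp only:) (rule Markov_nn_integral, measurable)
    also have "\<dots> = (\<integral>\<^sup>+D. ennreal (\<Prod>i=1..n. sqrt (dens c (D i) / dens h\<^sub>0 (D i))) \<partial>data n)"
      unfolding lik_def by (simp add: sqrt_prod)
    also have "\<dots> = (\<integral>\<^sup>+z. ennreal (sqrt (dens c z / dens h\<^sub>0 z)) \<partial>S) ^ n"
      by (rule nn_integral_data_prod[where g = "\<lambda>z. sqrt (dens c z / dens h\<^sub>0 z)"])
         (auto simp: less_imp_le[OF reg_pos])
    also have "\<dots> \<le> ennreal (1 - e\<^sup>2 / 2) ^ n"
      by (intro power_mono nn_integral_S_sqrt_ratio T(2)[OF c] far[OF c]) simp
    also have "\<dots> = ennreal ((1 - e\<^sup>2 / 2) ^ n)" using e by (intro ennreal_power) simp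
    finally show ?thesis .
  qed
  have "{D \<in> space (data n). \<exists>c\<in>T. 1 \<le> lik c n D} = (\<Union>c\<in>T. {D \<in> space (data n). 1 \<le> lik c n D})"
    by auto
  also have "emeasure (data n) \<dots> \<le> (\<Sum>c\<in>T. emeasure (data n) {D \<in> space (data n). 1 \<le> lik c n D})"
  proof (intro emeasure_subadditive_finite T(1) image_subsetI)
    fix c assume "c \<in> T"
    then have [measurable]: "c \<in> borel_measurable \<nu>" using T(2) by auto
    show "{D \<in> space (data n). 1 \<le> lik c n D} \<in> sets (data n)" by measurable
  qed
  also have "\<dots> \<le> (\<Sum>c\<in>T. ennreal ((1 - e\<^sup>2 / 2) ^ n))" by (intro sum_mono single)
  also have "\<dots> = ennreal (real (card T) * (1 - e\<^sup>2 / 2) ^ n)"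
    using e by (subst sum_ennreal) auto
  finally show ?thesis .
qed

end

section \<open>Evidence under a prior on the parameter\<close>

locale regression_prior = regression_truth \<nu> m h\<^sub>0 + Q: sigma_finite_measure Q
  for \<nu> :: "'x measure" and m h\<^sub>0 and Q :: "'b measure" +
  fixes H :: "'b \<Rightarrow> 'x \<Rightarrow> real"
  assumes H_measurable [measurable]: "(\<lambda>(b, x). H b x) \<in> borel_measurable (Q \<Otimes>\<^sub>M \<nu>)"
begin

lemma H_section [measurable]: "b \<in> space Q \<Longrightarrow> H b \<in> borel_measurable \<nu>"
  using measurable_compose[OF measurable_Pair1' H_measurable] by simp

lemma snd_borel: "snd \<in> borel_measurable (\<nu> \<Otimes>\<^sub>M R)"
  using measurable_snd[of \<nu> R] unfolding measurable_cong_sets[OF refl sets_response_measure] .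

lemma lik_joint_measurable [measurable]:
  "(\<lambda>(b, D). lik (H b) n D) \<in> borel_measurable (Q \<Otimes>\<^sub>M data n)"
  unfolding lik_def split_beta'
proof (intro borel_measurable_prod borel_measurable_divide)
  fix i assume i: "i \<in> {1..n}"
  have [measurable]: "(\<lambda>D. D i) \<in> measurable (data n) (\<nu> \<Otimes>\<^sub>M R)" by (rule measurable_data_component[OF i])
  have "(\<lambda>p. (\<lambda>(b, x). H b x) (fst p, fst (snd p i))) \<in> borel_measurable (Q \<Otimes>\<^sub>M data n)"
    by (rule measurable_compose[OF _ H_measurable]) measurable
  then have [measurable]: "(\<lambda>p. H (fst p) (fst (snd p i))) \<in> borel_measurable (Q \<Otimes>\<^sub>M data n)" by simp
  have [measurable]: "(\<lambda>p. snd (snd p i)) \<in> borel_measurable (Q \<Otimes>\<^sub>M data n)"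
    by (rule measurable_compose[OF _ snd_borel]) measurable
  show "(\<lambda>p. dens (H (fst p)) (snd p i)) \<in> borel_measurable (Q \<Otimes>\<^sub>M data n)" by measurable
  show "(\<lambda>p. dens h\<^sub>0 (snd p i)) \<in> borel_measurable (Q \<Otimes>\<^sub>M data n)" by measurable
qed

lemma lik_section:
  assumes D: "D \<in> space (data n)"
  shows "(\<lambda>b. lik (H b) n D) \<in> borel_measurable Q"
  using measurable_compose[OF measurable_Pair2'[OF D] lik_joint_measurable] by simp

text \<open>The likelihood is taken relative to the truth, a factor that cancels in the posterior.\<close>

definition evidence :: "nat \<Rightarrow> 'b set \<Rightarrow> (nat \<Rightarrow> 'x \<times> real) \<Rightarrow> ennreal" where
  "evidence n A D = (\<integral>\<^sup>+b. ennreal (lik (H b) n D) * indicator A b \<partial>Q)"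

lemma evidence_measurable [measurable]:
  assumes [measurable]: "A \<in> sets Q"
  shows "evidence n A \<in> borel_measurable (data n)"
  unfolding evidence_def[abs_def]
  by (rule Q.borel_measurable_nn_integral) measurable

lemma Tonelli_data:
  assumes [measurable]: "(\<lambda>p. g (fst p) (snd p)) \<in> borel_measurable (Q \<Otimes>\<^sub>M data n)"
  shows "(\<integral>\<^sup>+D. \<integral>\<^sup>+b. g b D \<partial>Q \<partial>data n) = (\<integral>\<^sup>+b. \<integral>\<^sup>+D. g b D \<partial>data n \<partial>Q)"
proof -
  interpret d: prob_space "data n" by (rule prob_space_data)
  interpret P: pair_sigma_finite Q "data n" ..
  show ?thesis using P.Fubini[of "\<lambda>p. g (fst p) (snd p)"] by simp
qed

lemma expected_evidence:
  assumes [measurable]: "A \<in> sets Q"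
  shows "(\<integral>\<^sup>+D. evidence n A D \<partial>data n) = emeasure Q A"
proof -
  have "(\<integral>\<^sup>+D. evidence n A D \<partial>data n) = (\<integral>\<^sup>+b. \<integral>\<^sup>+D. ennreal (lik (H b) n D) * indicator A b \<partial>data n \<partial>Q)"
    unfolding evidence_def by (rule Tonelli_data) measurable
  also have "\<dots> = (\<integral>\<^sup>+b. indicator A b \<partial>Q)"
    by (intro nn_integral_cong) (simp add: nn_integral_multc nn_integral_lik H_section)
  also have "\<dots> = emeasure Q A" by simp
  finally show ?thesis .
qed

text \<open>When \<open>lik c < 1\<close> for the net point \<open>c\<close> near \<open>b\<close>, the likelihood ratio of \<open>b\<close> only grows if it is divided
  by the root of that of \<open>c\<close>. The choice of \<open>c\<close> need not be measurable in \<open>b\<close>, since the expectation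
  is bounded for each \<open>b\<close> separately.\<close>

lemma expected_untested_evidence:
  assumes [measurable]: "U \<in> sets Q"
    and T: "finite T" "\<And>c. c \<in> T \<Longrightarrow> c \<in> borel_measurable \<nu>"
    and far: "\<And>c. c \<in> T \<Longrightarrow> e\<^sup>2 \<le> hellinger_sq c" and e: "e\<^sup>2 \<le> 2"
    and \<kappa>: "0 < \<kappa>"
    and net: "\<And>b. b \<in> U \<Longrightarrow> \<exists>c\<in>T. AE x in \<nu>. chi_square m (H b x) (c x) \<le> ennreal (\<kappa>\<^sup>2)"
  shows "(\<integral>\<^sup>+D. evidence n U D * indicator {D. \<forall>c\<in>T. lik c n D < 1} D \<partial>data n)
    \<le> ennreal ((1 - e\<^sup>2 / 2 + \<kappa>) ^ n) * emeasure Q U"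
proof -
  let ?I = "\<lambda>D. indicator {D. \<forall>c\<in>T. lik c n D < 1} D :: ennreal"
  have I [measurable]: "?I \<in> borel_measurable (data n)"
  proof (rule borel_measurable_indicator')
    have "{D \<in> space (data n). \<forall>c\<in>T. lik c n D < 1} \<in> sets (data n)"
    proof (intro sets.sets_Collect_finite_All T(1))
      fix c assume "c \<in> T"
      then have [measurable]: "c \<in> borel_measurable \<nu>" using T(2) by auto
      show "{D \<in> space (data n). lik c n D < 1} \<in> sets (data n)" by measurable
    qed
    then show "{D \<in> space (data n). D \<in> {D. \<forall>c\<in>T. lik c n D < 1}} \<in> sets (data n)" by simp
  qed
  have bound: "(\<integral>\<^sup>+D. ennreal (lik (H b) n D) * indicator U b * ?I D \<partial>data n)
      \<le> ennreal ((1 - e\<^sup>2 / 2 + \<kappa>) ^ n) * indicator U b" if b: "b \<in> space Q" for b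
  proof (cases "b \<in> U")
    case True
    from net[OF True] obtain c where c: "c \<in> T" and chi: "AE x in \<nu>. chi_square m (H b x) (c x) \<le> ennreal (\<kappa>\<^sup>2)"
      by blast
    have [measurable]: "c \<in> borel_measurable \<nu>" "H b \<in> borel_measurable \<nu>" using T(2) c b by auto
    let ?g = "\<lambda>z. dens (H b) z / dens h\<^sub>0 z * sqrt (dens h\<^sub>0 z / dens c z)"
    have le: "ennreal (lik (H b) n D) * indicator U b * ?I D \<le> ennreal (\<Prod>i=1..n. ?g (D i))" for D
    proof (cases "\<forall>c\<in>T. lik c n D < 1")
      case True
      then have "lik c n D < 1" using c by auto
      then have "1 \<le> sqrt (1 / lik c n D)" using lik_pos[of c n D] by simp
      then have "lik (H b) n D * 1 \<le> lik (H b) n D * sqrt (1 / lik c n D)"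
        using less_imp_le[OF lik_pos] by (rule mult_left_mono)
      also have "\<dots> = (\<Prod>i=1..n. ?g (D i))"
        unfolding lik_def by (simp add: prod.distrib sqrt_prod prod_dividef[symmetric] real_sqrt_divide prod_inversef)
      finally show ?thesis by (simp add: indicator_def ennreal_leI)
    qed simp
    have "(\<integral>\<^sup>+D. ennreal (lik (H b) n D) * indicator U b * ?I D \<partial>data n)
        \<le> (\<integral>\<^sup>+D. ennreal (\<Prod>i=1..n. ?g (D i)) \<partial>data n)"
      by (intro nn_integral_mono le)
    also have "\<dots> = (\<integral>\<^sup>+z. ennreal (?g z) \<partial>S) ^ n"
      by (rule nn_integral_data_prod[where g = ?g]) (auto simp: less_imp_le[OF reg_pos])
    also have "\<dots> \<le> ennreal (1 - e\<^sup>2 / 2 + \<kappa>) ^ n"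
      by (intro power_mono nn_integral_S_transfer far[OF c] e \<kappa> chi) measurable
    also have "\<dots> = ennreal ((1 - e\<^sup>2 / 2 + \<kappa>) ^ n)" using e \<kappa> by (intro ennreal_power) simp
    finally show ?thesis using True by simp
  qed simp
  have "(\<integral>\<^sup>+D. evidence n U D * ?I D \<partial>data n) =
      (\<integral>\<^sup>+D. \<integral>\<^sup>+b. ennreal (lik (H b) n D) * indicator U b * ?I D \<partial>Q \<partial>data n)"
    unfolding evidence_def
  proof (intro nn_integral_cong, subst nn_integral_multc)
    fix D assume D: "D \<in> space (data n)"
    note [measurable] = lik_section[OF D]
    show "(\<lambda>b. ennreal (lik (H b) n D) * indicator U b) \<in> borel_measurable Q" by measurable
  qed simp
  also have "\<dots> = (\<integral>\<^sup>+b. \<integral>\<^sup>+D. ennreal (lik (H b) n D) * indicator U b * ?I D \<partial>data n \<partial>Q)"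
    by (rule Tonelli_data) measurable
  also have "\<dots> \<le> (\<integral>\<^sup>+b. ennreal ((1 - e\<^sup>2 / 2 + \<kappa>) ^ n) * indicator U b \<partial>Q)"
    by (intro nn_integral_mono bound)
  also have "\<dots> = ennreal ((1 - e\<^sup>2 / 2 + \<kappa>) ^ n) * emeasure Q U"
    by (rule nn_integral_cmult_indicator) simp
  finally show ?thesis .
qed

text \<open>Integrating \<open>l + \<delta>\<^sup>2 / l \<ge> 2 \<delta>\<close> over \<open>G\<close> shows that a small integral of \<open>l\<close> forces a large integral
  of \<open>1 / l\<close>; Markov's inequality applies to the latter.\<close>

lemma small_evidence:
  assumes [measurable]: "G \<in> sets Q" and g: "emeasure Q G = ennreal g" "0 < g"
    and q: "0 \<le> q" and \<delta>: "0 < \<delta>"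
    and near: "\<And>b. b \<in> G \<Longrightarrow> AE x in \<nu>. chi_square m (h\<^sub>0 x) (H b x) \<le> ennreal q"
  shows "emeasure (data n) {D \<in> space (data n). evidence n G D \<le> ennreal (\<delta> * g)}
    \<le> ennreal (\<delta> * (1 + q) ^ n)"
proof -
  let ?J = "\<lambda>D. \<integral>\<^sup>+b. ennreal (1 / lik (H b) n D) * indicator G b \<partial>Q"
  have [measurable]: "?J \<in> borel_measurable (data n)"
    by (rule Q.borel_measurable_nn_integral) measurable
  have impl: "1 \<le> ennreal (\<delta> / g) * ?J D"
    if D: "D \<in> space (data n)" and le: "evidence n G D \<le> ennreal (\<delta> * g)" for D
  proof -
    note [measurable] = lik_section[OF D]
    have pt: "ennreal (2 * \<delta>) \<le> ennreal l + ennreal (\<delta>\<^sup>2) * ennreal (1 / l)" if l: "0 < l" for l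
    proof -
      have "0 \<le> (l - \<delta>)\<^sup>2 / l" using l by simp
      also have "(l - \<delta>)\<^sup>2 / l = l + \<delta>\<^sup>2 * (1 / l) - 2 * \<delta>" using l by (simp add: power2_eq_square field_simps)
      finally have "ennreal (2 * \<delta>) \<le> ennreal (l + \<delta>\<^sup>2 * (1 / l))" by (intro ennreal_leI) simp
      also have "\<dots> = ennreal l + ennreal (\<delta>\<^sup>2) * ennreal (1 / l)"
        using l by (simp add: ennreal_plus ennreal_mult[symmetric])
      finally show ?thesis .
    qed
    have "ennreal (2 * \<delta> * g) = (\<integral>\<^sup>+b. ennreal (2 * \<delta>) * indicator G b \<partial>Q)"
      using g \<delta> by (simp add: nn_integral_cmult_indicator ennreal_mult)
    also have "\<dots> \<le> (\<integral>\<^sup>+b. ennreal (lik (H b) n D) * indicator G b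
        + ennreal (\<delta>\<^sup>2) * (ennreal (1 / lik (H b) n D) * indicator G b) \<partial>Q)"
      by (intro nn_integral_mono) (use pt[OF lik_pos] in \<open>simp add: indicator_def\<close>)
    also have "\<dots> = evidence n G D + ennreal (\<delta>\<^sup>2) * ?J D"
      unfolding evidence_def by (subst nn_integral_add) (auto simp: nn_integral_cmult)
    also have "\<dots> \<le> ennreal (\<delta> * g) + ennreal (\<delta>\<^sup>2) * ?J D" by (intro add_right_mono le)
    finally have *: "ennreal (2 * \<delta> * g) \<le> ennreal (\<delta> * g) + ennreal (\<delta>\<^sup>2) * ?J D" .
    show ?thesis
    proof (cases "?J D")
      case (real j)
      have "ennreal (2 * \<delta> * g) \<le> ennreal (\<delta> * g + \<delta>\<^sup>2 * j)"
        using * real \<delta> g by (simp add: ennreal_plus ennreal_mult)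
      then have "2 * \<delta> * g \<le> \<delta> * g + \<delta>\<^sup>2 * j" using \<delta> g real by (subst (asm) ennreal_le_iff) auto
      then have "\<delta> * g \<le> \<delta> * (\<delta> * j)" by (simp add: power2_eq_square mult_ac)
      then have "g \<le> \<delta> * j" using \<delta> by simp
      then have "1 \<le> \<delta> / g * j" using g(2) by (simp add: field_simps)
      then have "ennreal 1 \<le> ennreal (\<delta> / g * j)" by (rule ennreal_leI)
      also have "\<dots> = ennreal (\<delta> / g) * ennreal j" using \<delta> g(2) real(1) by (intro ennreal_mult) auto
      finally show ?thesis using real by simp
    next
      case top
      then show ?thesis using \<delta> g by (simp add: ennreal_mult_top)
    qed
  qed
  have "emeasure (data n) {D \<in> space (data n). evidence n G D \<le> ennreal (\<delta> * g)}
      \<le> emeasure (data n) {D \<in> space (data n). 1 \<le> ennreal (\<delta> / g) * ?J D}"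
    using impl by (intro emeasure_mono) auto
  also have "\<dots> \<le> (\<integral>\<^sup>+D. ennreal (\<delta> / g) * ?J D \<partial>data n)" by (rule Markov_nn_integral) measurable
  also have "\<dots> = ennreal (\<delta> / g) * (\<integral>\<^sup>+b. \<integral>\<^sup>+D. ennreal (1 / lik (H b) n D) * indicator G b \<partial>data n \<partial>Q)"
    by (subst nn_integral_cmult, measurable) (subst Tonelli_data, measurable)
  also have "\<dots> \<le> ennreal (\<delta> / g) * (\<integral>\<^sup>+b. ennreal ((1 + q) ^ n) * indicator G b \<partial>Q)"
  proof (intro mult_left_mono nn_integral_mono)
    fix b assume b: "b \<in> space Q"
    show "(\<integral>\<^sup>+D. ennreal (1 / lik (H b) n D) * indicator G b \<partial>data n) \<le> ennreal ((1 + q) ^ n) * indicator G b"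
    proof (cases "b \<in> G")
      case True
      have [measurable]: "H b \<in> borel_measurable \<nu>" using b by simp
      have "(\<integral>\<^sup>+D. ennreal (1 / lik (H b) n D) * indicator G b \<partial>data n) =
          (\<integral>\<^sup>+D. ennreal (\<Prod>i=1..n. dens h\<^sub>0 (D i) / dens (H b) (D i)) \<partial>data n)"
        using True unfolding lik_def by (simp add: prod_dividef)
      also have "\<dots> = (\<integral>\<^sup>+z. ennreal (dens h\<^sub>0 z / dens (H b) z) \<partial>S) ^ n"
        by (rule nn_integral_data_prod[where g = "\<lambda>z. dens h\<^sub>0 z / dens (H b) z"]) (auto simp: less_imp_le[OF reg_pos])
      also have "\<dots> \<le> ennreal (1 + q) ^ n"
        by (intro power_mono nn_integral_inverse_ratio near[OF True] q) auto
      also have "\<dots> = ennreal ((1 + q) ^ n)" using q by (intro ennreal_power) simp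
      finally show ?thesis using True by simp
    qed simp
  qed simp
  also have "\<dots> = ennreal (\<delta> / g) * (ennreal ((1 + q) ^ n) * ennreal g)"
    by (subst nn_integral_cmult_indicator) (auto simp: g)
  also have "\<dots> = ennreal (\<delta> * (1 + q) ^ n)"
    using \<delta> g q by (simp add: ennreal_mult[symmetric])
  finally show ?thesis .
qed

end

context regression_prior
begin

lemma hellinger_sq_measurable [measurable]:
  "(\<lambda>b. hellinger_sq (H b)) \<in> borel_measurable Q"
proof -
  have [measurable]: "(\<lambda>p. H (fst (fst p)) (snd (fst p))) \<in> borel_measurable ((Q \<Otimes>\<^sub>M \<nu>) \<Otimes>\<^sub>M R)"
    using measurable_compose[OF measurable_fst H_measurable] by (simp add: split_beta')
  have [measurable]: "(\<lambda>p. snd p) \<in> borel_measurable ((Q \<Otimes>\<^sub>M \<nu>) \<Otimes>\<^sub>M R)"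
    using measurable_snd[of "Q \<Otimes>\<^sub>M \<nu>" R] unfolding measurable_cong_sets[OF refl sets_response_measure] .
  have "(\<lambda>p. \<integral>y. (sqrt (reg_density m y (H (fst p) (snd p))) - sqrt (reg_density m y (h\<^sub>0 (snd p))))\<^sup>2 \<partial>R)
      \<in> borel_measurable (Q \<Otimes>\<^sub>M \<nu>)"
    by (rule R.borel_measurable_lebesgue_integral) (unfold split_beta', measurable)
  then show ?thesis unfolding hellinger_sq_def
    by (intro borel_measurable_lebesgue_integral) (simp add: split_beta')
qed

lemma evidence_mono: "A \<subseteq> B \<Longrightarrow> evidence n A D \<le> evidence n B D"
  unfolding evidence_def by (intro nn_integral_mono mult_left_mono) (auto simp: indicator_def)

lemma evidence_Un:
  assumes D: "D \<in> space (data n)" and "A \<in> sets Q" "B \<in> sets Q"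
  shows "evidence n (A \<union> B) D \<le> evidence n A D + evidence n B D"
proof -
  note [measurable] = lik_section[OF D] assms(2,3)
  have "evidence n (A \<union> B) D \<le>
      (\<integral>\<^sup>+b. ennreal (lik (H b) n D) * indicator A b + ennreal (lik (H b) n D) * indicator B b \<partial>Q)"
    unfolding evidence_def by (intro nn_integral_mono) (auto simp: indicator_def)
  also have "\<dots> = evidence n A D + evidence n B D"
    unfolding evidence_def by (rule nn_integral_add) measurable
  finally show ?thesis .
qed

lemma evidence_disjoint_Un:
  assumes D: "D \<in> space (data n)" and "A \<in> sets Q" "B \<in> sets Q" and disj: "A \<inter> B = {}"
  shows "evidence n (A \<union> B) D = evidence n A D + evidence n B D"
proof -
  note [measurable] = lik_section[OF D] assms(2,3)
  have "evidence n (A \<union> B) D =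
      (\<integral>\<^sup>+b. ennreal (lik (H b) n D) * indicator A b + ennreal (lik (H b) n D) * indicator B b \<partial>Q)"
    unfolding evidence_def using disj by (intro nn_integral_cong) (auto simp: indicator_def)
  also have "\<dots> = evidence n A D + evidence n B D"
    unfolding evidence_def by (rule nn_integral_add) measurable
  finally show ?thesis .
qed

lemma evidence_pos:
  assumes D: "D \<in> space (data n)" and pos: "0 < emeasure Q (space Q)"
  shows "0 < evidence n (space Q) D"
proof (rule ccontr)
  assume "\<not> ?thesis"
  then have "evidence n (space Q) D = 0" by simp
  moreover note [measurable] = lik_section[OF D]
  ultimately have "emeasure Q {b \<in> space Q. ennreal (lik (H b) n D) * indicator (space Q) b \<noteq> 0} = 0"
    unfolding evidence_def by (subst (asm) nn_integral_0_iff) auto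
  moreover have "{b \<in> space Q. ennreal (lik (H b) n D) * indicator (space Q) b \<noteq> 0} = space Q"
    using less_imp_neq[OF lik_pos, THEN not_sym] lik_pos by (auto simp: ennreal_eq_0_iff not_le)
  ultimately show False using pos by simp
qed

end

section \<open>The Gaussian prior of the coefficients\<close>

lemma subvec_carrier [simp]: "subvec \<gamma> b \<in> carrier_vec (card \<gamma>)"
  unfolding subvec_def by simp

lemma sum_sorted_list_nth:
  assumes "finite \<gamma>"
  shows "(\<Sum>i<card \<gamma>. f (sorted_list_of_set \<gamma> ! i)) = (\<Sum>j\<in>\<gamma>. f j)"
proof -
  let ?l = "sorted_list_of_set \<gamma>"
  have "(\<Sum>j\<in>\<gamma>. f j) = sum_list (map f ?l)"
    using assms by (simp add: sum_list_distinct_conv_sum_set)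
  also have "\<dots> = (\<Sum>i<card \<gamma>. f (?l ! i))"
    by (simp add: sum_list_sum_nth atLeast0LessThan)
  finally show ?thesis ..
qed

lemma scalar_prod_subvec:
  assumes "finite \<gamma>"
  shows "scalar_prod (subvec \<gamma> b) (subvec \<gamma> b) = (\<Sum>j\<in>\<gamma>. (b j)\<^sup>2)"
  using sum_sorted_list_nth[OF assms, of "\<lambda>j. (b j)\<^sup>2"]
  by (simp add: scalar_prod_def subvec_def power2_eq_square lessThan_atLeast0)

definition prior_density :: "nat set \<Rightarrow> real mat \<Rightarrow> (nat \<Rightarrow> real) \<Rightarrow> real" where
  "prior_density \<gamma> A b = exp (- scalar_prod (inv_mat A *\<^sub>v subvec \<gamma> b) (subvec \<gamma> b) / 2)
        / sqrt ((2 * pi) ^ card \<gamma> * Determinant.det A)"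

lemma coef_prior_eq: "coef_prior \<gamma> A = density (PiM \<gamma> (\<lambda>_. lborel)) (\<lambda>b. ennreal (prior_density \<gamma> A b))"
  unfolding coef_prior_def prior_density_def ..

lemma sets_coef_prior [measurable_cong]: "sets (coef_prior \<gamma> A) = sets (PiM \<gamma> (\<lambda>_. borel))"
  unfolding coef_prior_eq by (simp cong: sets_PiM_cong)

lemma space_coef_prior: "space (coef_prior \<gamma> A) = extensional \<gamma>"
  unfolding coef_prior_eq by (auto simp: space_PiM PiE_def)

text \<open>The number \<open>t\<close> bounds both the covariance matrix and its inverse.\<close>

locale bounded_covariance =
  fixes \<gamma> :: "nat set" and A :: "real mat" and t :: real
  assumes finite: "finite \<gamma>" and pd: "pos_def_mat (card \<gamma>) A" and t: "1 \<le> t"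
    and ch: "\<gamma> \<noteq> {} \<Longrightarrow> ch1 A \<le> t" "\<gamma> \<noteq> {} \<Longrightarrow> ch1 (inv_mat A) \<le> t"
begin

lemma t_pos: "0 < t" using t by simp

lemma quad_subvec_eq:
  "scalar_prod (inv_mat A *\<^sub>v subvec \<gamma> b) (subvec \<gamma> b) =
     scalar_prod (subvec \<gamma> b) (inv_mat A *\<^sub>v subvec \<gamma> b)"
  using pos_def_mat_inverse(3)[OF pd] by (intro comm_scalar_prod[of _ "card \<gamma>"]) auto

lemmas bounds = pos_def_mat_bounds[OF pd t_pos]

lemma quad_bounds:
  shows "(\<Sum>j\<in>\<gamma>. (b j)\<^sup>2) / t \<le> scalar_prod (inv_mat A *\<^sub>v subvec \<gamma> b) (subvec \<gamma> b)"
    and "scalar_prod (inv_mat A *\<^sub>v subvec \<gamma> b) (subvec \<gamma> b) \<le> t * (\<Sum>j\<in>\<gamma>. (b j)\<^sup>2)"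
  unfolding quad_subvec_eq scalar_prod_subvec[OF finite, symmetric]
  using bounds(1,2)[of "subvec \<gamma> b"] ch finite by auto

lemma det_bounds: "Determinant.det A \<le> t ^ card \<gamma>" "(1 / t) ^ card \<gamma> \<le> Determinant.det A"
  using bounds(3,4) ch finite by auto

lemma prior_density_measurable [measurable]:
  "prior_density \<gamma> A \<in> borel_measurable (PiM \<gamma> (\<lambda>_. lborel))"
proof -
  let ?l = "sorted_list_of_set \<gamma>"
  let ?M = "inv_mat A"
  have M: "?M \<in> carrier_mat (card \<gamma>) (card \<gamma>)" by (rule pos_def_mat_inverse(3)[OF pd])
  have eq: "scalar_prod (?M *\<^sub>v subvec \<gamma> b) (subvec \<gamma> b) =
      (\<Sum>i<card \<gamma>. (\<Sum>j<card \<gamma>. ?M $$ (i, j) * b (?l ! j)) * b (?l ! i))" for b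
    using carrier_matD[OF M] by (simp add: scalar_prod_def subvec_def lessThan_atLeast0)
  have mem: "?l ! i \<in> \<gamma>" if "i < card \<gamma>" for i
    using that finite by (metis nth_mem sorted_list_of_set.length_sorted_key_list_of_set sorted_list_of_set.set_sorted_key_list_of_set)
  have [measurable]: "(\<lambda>b. b (?l ! i)) \<in> borel_measurable (PiM \<gamma> (\<lambda>_. lborel :: real measure))" if "i < card \<gamma>" for i
    using measurable_component_singleton[OF mem[OF that], of "\<lambda>_. lborel :: real measure"] by simp
  show ?thesis unfolding prior_density_def[abs_def] eq
    by (intro borel_measurable_divide borel_measurable_const measurable_compose[OF _ borel_measurable_exp]
        borel_measurable_uminus borel_measurable_sum borel_measurable_times) auto
qed

text \<open>Up to the factor \<open>t ^ card \<gamma>\<close> the prior is dominated by independent centred normal coefficients with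
  variance \<open>t\<close>. The factor is harmless: its logarithm is of smaller order than \<open>s\<close>.\<close>

lemma prior_density_le:
  "prior_density \<gamma> A b \<le> t ^ card \<gamma> * (\<Prod>j\<in>\<gamma>. normal_density 0 (sqrt t) (b j))"
proof -
  let ?k = "card \<gamma>"
  have "prior_density \<gamma> A b \<le> exp (- ((\<Sum>j\<in>\<gamma>. (b j)\<^sup>2) / t) / 2) / sqrt ((2 * pi) ^ ?k * (1 / t) ^ ?k)"
    unfolding prior_density_def
  proof (rule frac_le)
    show "exp (- scalar_prod (inv_mat A *\<^sub>v subvec \<gamma> b) (subvec \<gamma> b) / 2) \<le> exp (- ((\<Sum>j\<in>\<gamma>. (b j)\<^sup>2) / t) / 2)"
      using quad_bounds(1)[of b] by simp
    show "sqrt ((2 * pi) ^ ?k * (1 / t) ^ ?k) \<le> sqrt ((2 * pi) ^ ?k * Determinant.det A)"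
      using det_bounds(2) by (intro real_sqrt_le_mono mult_left_mono) auto
    show "0 < sqrt ((2 * pi) ^ ?k * (1 / t) ^ ?k)" using t_pos by simp
  qed simp
  also have "\<dots> = t ^ ?k * (\<Prod>j\<in>\<gamma>. normal_density 0 (sqrt t) (b j))"
  proof -
    have prod: "(\<Prod>j\<in>\<gamma>. normal_density 0 (sqrt t) (b j)) =
        (1 / sqrt (2 * pi * t)) ^ ?k * exp (- ((\<Sum>j\<in>\<gamma>. (b j)\<^sup>2) / t) / 2)"
      unfolding normal_density_def using t_pos finite
      by (simp add: prod.distrib prod_dividef exp_sum[symmetric] sum_negf sum_divide_distrib[symmetric] power_divide
          field_simps)
    have const: "1 / sqrt ((2 * pi) ^ ?k * (1 / t) ^ ?k) = t ^ ?k * (1 / sqrt (2 * pi * t)) ^ ?k"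
    proof -
      have "1 / sqrt (2 * pi * (1 / t)) = t * (1 / sqrt (2 * pi * t))"
        using t_pos by (simp add: real_sqrt_mult real_sqrt_divide field_simps)
      then have "(1 / sqrt (2 * pi * (1 / t))) ^ ?k = (t * (1 / sqrt (2 * pi * t))) ^ ?k" by simp
      moreover have "1 / sqrt ((2 * pi) ^ ?k * (1 / t) ^ ?k) = (1 / sqrt (2 * pi * (1 / t))) ^ ?k"
      proof -
        have "sqrt ((2 * pi) ^ ?k * (1 / t) ^ ?k) = sqrt (2 * pi * (1 / t)) ^ ?k"
          by (simp only: power_mult_distrib[symmetric] real_sqrt_power)
        then show ?thesis by (simp only: power_one_over)
      qed
      ultimately show ?thesis by (simp only: power_mult_distrib)
    qed
    have "exp (- ((\<Sum>j\<in>\<gamma>. (b j)\<^sup>2) / t) / 2) / sqrt ((2 * pi) ^ ?k * (1 / t) ^ ?k) =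
        (1 / sqrt ((2 * pi) ^ ?k * (1 / t) ^ ?k)) * exp (- ((\<Sum>j\<in>\<gamma>. (b j)\<^sup>2) / t) / 2)"
      by simp
    also have "\<dots> = t ^ ?k * ((1 / sqrt (2 * pi * t)) ^ ?k * exp (- ((\<Sum>j\<in>\<gamma>. (b j)\<^sup>2) / t) / 2))"
      unfolding const by (rule mult.assoc)
    finally show ?thesis unfolding prod .
  qed
  finally show ?thesis .
qed

text \<open>The squared Euclidean norm is at most \<open>M\<^sup>2\<close>, and \<open>2 \<pi> t \<le> (4 t)\<^sup>2\<close>.\<close>

lemma prior_density_ge:
  assumes M: "(\<Sum>j\<in>\<gamma>. \<bar>b j\<bar>) \<le> M"
  shows "(1 / (4 * t)) ^ card \<gamma> * exp (- t * M\<^sup>2 / 2) \<le> prior_density \<gamma> A b"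
proof -
  let ?k = "card \<gamma>"
  have M0: "0 \<le> M" using order.trans[OF sum_nonneg M] by simp
  have "(\<Sum>j\<in>\<gamma>. (b j)\<^sup>2) \<le> (\<Sum>j\<in>\<gamma>. \<bar>b j\<bar> * M)"
  proof (intro sum_mono)
    fix j assume j: "j \<in> \<gamma>"
    have "\<bar>b j\<bar> \<le> M" using member_le_sum[OF j, of "\<lambda>j. \<bar>b j\<bar>"] finite M by auto
    then have "\<bar>b j\<bar> * \<bar>b j\<bar> \<le> \<bar>b j\<bar> * M" by (intro mult_left_mono) auto
    then show "(b j)\<^sup>2 \<le> \<bar>b j\<bar> * M" by (simp add: power2_eq_square)
  qed
  also have "\<dots> \<le> M * M" unfolding sum_distrib_right[symmetric] using M M0 by (intro mult_right_mono)
  finally have sq: "(\<Sum>j\<in>\<gamma>. (b j)\<^sup>2) \<le> M\<^sup>2" by (simp add: power2_eq_square)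
  have q: "scalar_prod (inv_mat A *\<^sub>v subvec \<gamma> b) (subvec \<gamma> b) \<le> t * M\<^sup>2"
    using quad_bounds(2)[of b] mult_left_mono[OF sq, of t] t_pos by linarith
  have "sqrt ((2 * pi) ^ ?k * Determinant.det A) \<le> sqrt ((2 * pi) ^ ?k * t ^ ?k)"
    using det_bounds(1) by (intro real_sqrt_le_mono mult_left_mono) auto
  also have "\<dots> = sqrt (2 * pi * t) ^ ?k" by (simp only: power_mult_distrib[symmetric] real_sqrt_power)
  also have "\<dots> \<le> (4 * t) ^ ?k"
  proof (intro power_mono)
    have "2 * pi * t \<le> 16 * t" using pi_less_4 t_pos by simp
    also have "16 * t \<le> 16 * (t * t)" using t by simp
    finally have "2 * pi * t \<le> (4 * t)\<^sup>2" by (simp add: power2_eq_square)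
    then show "sqrt (2 * pi * t) \<le> 4 * t" using t_pos by (intro real_le_lsqrt) auto
  qed (use t_pos in simp)
  finally have d: "sqrt ((2 * pi) ^ ?k * Determinant.det A) \<le> (4 * t) ^ ?k" .
  have d0: "0 < sqrt ((2 * pi) ^ ?k * Determinant.det A)"
  proof -
    have "0 < Determinant.det A" using t_pos by (intro less_le_trans[OF _ det_bounds(2)]) simp
    then show ?thesis by simp
  qed
  have "exp (- t * M\<^sup>2 / 2) / (4 * t) ^ ?k \<le> prior_density \<gamma> A b"
    unfolding prior_density_def
  proof (rule frac_le)
    show "exp (- t * M\<^sup>2 / 2) \<le> exp (- scalar_prod (inv_mat A *\<^sub>v subvec \<gamma> b) (subvec \<gamma> b) / 2)"
      using q by simp
  qed (use d d0 in simp_all)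
  moreover have "(1 / (4 * t)) ^ ?k * exp (- t * M\<^sup>2 / 2) = exp (- t * M\<^sup>2 / 2) / (4 * t) ^ ?k"
    unfolding power_one_over by simp
  ultimately show ?thesis by simp
qed

lemma nn_integral_normal_product:
  assumes s: "0 < s"
  shows "(\<integral>\<^sup>+b. ennreal (\<Prod>j\<in>\<gamma>. normal_density 0 s (b j)) \<partial>PiM \<gamma> (\<lambda>_. lborel)) = 1"
proof -
  interpret P: product_sigma_finite "\<lambda>_::nat. lborel :: real measure" ..
  have "(\<integral>\<^sup>+b. ennreal (\<Prod>j\<in>\<gamma>. normal_density 0 s (b j)) \<partial>PiM \<gamma> (\<lambda>_. lborel)) =
      (\<integral>\<^sup>+b. (\<Prod>j\<in>\<gamma>. ennreal (normal_density 0 s (b j))) \<partial>PiM \<gamma> (\<lambda>_. lborel))"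
    by (simp add: prod_ennreal)
  also have "\<dots> = (\<Prod>j\<in>\<gamma>. \<integral>\<^sup>+x. ennreal (normal_density 0 s x) \<partial>lborel)"
    by (rule P.product_nn_integral_prod[OF finite]) simp
  also have "(\<integral>\<^sup>+x. ennreal (normal_density 0 s x) \<partial>lborel) = 1"
    using prob_space.emeasure_space_1[OF prob_space_normal_density[OF s, of 0]] by (simp add: emeasure_density)
  finally show ?thesis by simp
qed

lemma emeasure_coef_prior_le:
  assumes W [measurable]: "W \<in> sets (coef_prior \<gamma> A)" and s: "0 < s" and c: "0 \<le> c"
    and le: "\<And>b. b \<in> W \<Longrightarrow> prior_density \<gamma> A b \<le> c * (\<Prod>j\<in>\<gamma>. normal_density 0 s (b j))"
  shows "emeasure (coef_prior \<gamma> A) W \<le> ennreal c"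
proof -
  have W': "W \<in> sets (PiM \<gamma> (\<lambda>_. lborel :: real measure))" using W unfolding coef_prior_eq by simp
  have "emeasure (coef_prior \<gamma> A) W =
      (\<integral>\<^sup>+b. ennreal (prior_density \<gamma> A b) * indicator W b \<partial>PiM \<gamma> (\<lambda>_. lborel))"
    unfolding coef_prior_eq by (rule emeasure_density) (use W' in measurable)
  also have "\<dots> \<le> (\<integral>\<^sup>+b. ennreal c * ennreal (\<Prod>j\<in>\<gamma>. normal_density 0 s (b j)) \<partial>PiM \<gamma> (\<lambda>_. lborel))"
    using le c by (intro nn_integral_mono) (auto simp: indicator_def ennreal_mult'[symmetric] intro!: ennreal_leI)
  also have "\<dots> = ennreal c * (\<integral>\<^sup>+b. ennreal (\<Prod>j\<in>\<gamma>. normal_density 0 s (b j)) \<partial>PiM \<gamma> (\<lambda>_. lborel))"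
    by (rule nn_integral_cmult) measurable
  finally show ?thesis using nn_integral_normal_product[OF s] by simp
qed

lemma coef_prior_total: "emeasure (coef_prior \<gamma> A) (space (coef_prior \<gamma> A)) \<le> ennreal ((2 * t) ^ card \<gamma>)"
proof (rule emeasure_coef_prior_le)
  fix b
  have "t ^ card \<gamma> * (\<Prod>j\<in>\<gamma>. normal_density 0 (sqrt t) (b j)) \<le>
      (2 * t) ^ card \<gamma> * (\<Prod>j\<in>\<gamma>. normal_density 0 (sqrt t) (b j))"
    using t_pos by (intro mult_right_mono power_mono prod_nonneg) auto
  with prior_density_le[of b]
  show "prior_density \<gamma> A b \<le> (2 * t) ^ card \<gamma> * (\<Prod>j\<in>\<gamma>. normal_density 0 (sqrt t) (b j))" by linarith
qed (use t_pos in auto)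

lemma finite_measure_coef_prior: "finite_measure (coef_prior \<gamma> A)"
  using coef_prior_total by (intro finite_measureI) (auto simp: top_unique)

text \<open>Where some coefficient exceeds \<open>C\<close>, half of the Gaussian exponent is worth \<open>exp (- C\<^sup>2 / (4 t))\<close>; the
  other half is the exponent of independent normal coefficients with variance \<open>2 t\<close>.\<close>

lemma coef_prior_tail:
  assumes C: "0 \<le> C"
  shows "emeasure (coef_prior \<gamma> A) {b \<in> space (coef_prior \<gamma> A). \<exists>j\<in>\<gamma>. C < \<bar>b j\<bar>}
     \<le> ennreal ((2 * t) ^ card \<gamma> * exp (- C\<^sup>2 / (4 * t)))"
proof (rule emeasure_coef_prior_le[where s = "sqrt (2 * t)"])
  show "{b \<in> space (coef_prior \<gamma> A). \<exists>j\<in>\<gamma>. C < \<bar>b j\<bar>} \<in> sets (coef_prior \<gamma> A)"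
    using finite by measurable
  fix b assume "b \<in> {b \<in> space (coef_prior \<gamma> A). \<exists>j\<in>\<gamma>. C < \<bar>b j\<bar>}"
  then obtain j where j: "j \<in> \<gamma>" "C < \<bar>b j\<bar>" by auto
  have "C\<^sup>2 \<le> \<bar>b j\<bar>\<^sup>2" using j C by (intro power_mono) auto
  also have "\<dots> \<le> (\<Sum>j\<in>\<gamma>. (b j)\<^sup>2)" using member_le_sum[OF j(1), of "\<lambda>j. (b j)\<^sup>2"] finite by simp
  finally have "C\<^sup>2 / (4 * t) \<le> (\<Sum>j\<in>\<gamma>. (b j)\<^sup>2) / (4 * t)"
    using t_pos by (intro divide_right_mono) auto
  then have sieve: "exp (- (\<Sum>j\<in>\<gamma>. (b j)\<^sup>2) / (4 * t)) \<le> exp (- C\<^sup>2 / (4 * t))" by simp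
  have split: "normal_density 0 (sqrt t) x = sqrt 2 * normal_density 0 (sqrt (2 * t)) x * exp (- x\<^sup>2 / (4 * t))" for x
  proof -
    have "1 / sqrt (2 * pi * t) = sqrt 2 * (1 / sqrt (2 * pi * (2 * t)))"
    proof -
      have "sqrt (2 * pi * (2 * t)) = sqrt 2 * sqrt (2 * pi * t)"
        by (simp only: real_sqrt_mult[symmetric]) (simp add: mult_ac)
      then show ?thesis by simp
    qed
    moreover have "exp (- x\<^sup>2 / (2 * t)) = exp (- x\<^sup>2 / (2 * (2 * t))) * exp (- x\<^sup>2 / (4 * t))"
      using t_pos by (simp add: mult_exp_exp field_simps)
    ultimately show ?thesis unfolding normal_density_def using t_pos by simp
  qed
  have "(\<Prod>j\<in>\<gamma>. normal_density 0 (sqrt t) (b j)) =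
      sqrt 2 ^ card \<gamma> * (\<Prod>j\<in>\<gamma>. normal_density 0 (sqrt (2 * t)) (b j)) * exp (- (\<Sum>j\<in>\<gamma>. (b j)\<^sup>2) / (4 * t))"
    unfolding split using finite
    by (simp add: prod.distrib exp_sum[symmetric] sum_negf sum_divide_distrib[symmetric])
  also have "\<dots> \<le> 2 ^ card \<gamma> * (\<Prod>j\<in>\<gamma>. normal_density 0 (sqrt (2 * t)) (b j)) * exp (- C\<^sup>2 / (4 * t))"
  proof (intro mult_mono)
    show "sqrt 2 ^ card \<gamma> \<le> 2 ^ card \<gamma>" by (intro power_mono real_le_lsqrt) auto
    show "exp (- (\<Sum>j\<in>\<gamma>. (b j)\<^sup>2) / (4 * t)) \<le> exp (- C\<^sup>2 / (4 * t))" by (rule sieve)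
  qed (auto intro!: prod_nonneg mult_nonneg_nonneg)
  finally have "t ^ card \<gamma> * (\<Prod>j\<in>\<gamma>. normal_density 0 (sqrt t) (b j)) \<le>
      t ^ card \<gamma> * (2 ^ card \<gamma> * (\<Prod>j\<in>\<gamma>. normal_density 0 (sqrt (2 * t)) (b j)) * exp (- C\<^sup>2 / (4 * t)))"
    using t_pos by (intro mult_left_mono) auto
  also have "\<dots> = (2 * t) ^ card \<gamma> * exp (- C\<^sup>2 / (4 * t)) * (\<Prod>j\<in>\<gamma>. normal_density 0 (sqrt (2 * t)) (b j))"
    by (simp add: power_mult_distrib mult_ac)
  finally show "prior_density \<gamma> A b \<le>
      (2 * t) ^ card \<gamma> * exp (- C\<^sup>2 / (4 * t)) * (\<Prod>j\<in>\<gamma>. normal_density 0 (sqrt (2 * t)) (b j))"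
    using prior_density_le[of b] by linarith
qed (use t_pos in auto)

text \<open>The volume of the box times the least value of the prior density on it.\<close>

lemma coef_prior_box:
  assumes \<eta>: "0 < \<eta>" and M: "(\<Sum>j\<in>\<gamma>. \<bar>\<beta> j\<bar>) + real (card \<gamma>) * \<eta> \<le> M"
  shows "ennreal ((\<eta> / (2 * t)) ^ card \<gamma> * exp (- t * M\<^sup>2 / 2))
     \<le> emeasure (coef_prior \<gamma> A) {b \<in> space (coef_prior \<gamma> A). \<forall>j\<in>\<gamma>. \<bar>b j - \<beta> j\<bar> \<le> \<eta>}" (is "_ \<le> emeasure _ ?G")
proof -
  interpret P: product_sigma_finite "\<lambda>_::nat. lborel :: real measure" ..
  let ?k = "card \<gamma>" let ?c = "(1 / (4 * t)) ^ card \<gamma> * exp (- t * M\<^sup>2 / 2)"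
  let ?B = "PiE \<gamma> (\<lambda>j. {\<beta> j - \<eta> .. \<beta> j + \<eta>})"
  have G: "?G = ?B"
    by (auto simp: space_coef_prior PiE_def Pi_def extensional_def abs_le_iff)
  have B: "?B \<in> sets (PiM \<gamma> (\<lambda>_. lborel :: real measure))"
    using finite by (intro sets_PiM_I_finite) auto
  have "emeasure (PiM \<gamma> (\<lambda>_. lborel :: real measure)) ?B = (\<Prod>j\<in>\<gamma>. emeasure lborel {\<beta> j - \<eta> .. \<beta> j + \<eta>})"
    using finite by (intro P.emeasure_PiM) auto
  also have "\<dots> = ennreal ((2 * \<eta>) ^ ?k)" using \<eta> by (simp add: ennreal_power)
  finally have vol: "emeasure (PiM \<gamma> (\<lambda>_. lborel :: real measure)) ?B = ennreal ((2 * \<eta>) ^ ?k)" .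
  have ge: "?c \<le> prior_density \<gamma> A b" if b: "b \<in> ?B" for b
  proof (rule prior_density_ge)
    have "(\<Sum>j\<in>\<gamma>. \<bar>b j\<bar>) \<le> (\<Sum>j\<in>\<gamma>. \<bar>\<beta> j\<bar> + \<eta>)"
    proof (intro sum_mono)
      fix j assume "j \<in> \<gamma>"
      with b have "b j \<in> {\<beta> j - \<eta> .. \<beta> j + \<eta>}" by blast
      then show "\<bar>b j\<bar> \<le> \<bar>\<beta> j\<bar> + \<eta>" by auto
    qed
    then show "(\<Sum>j\<in>\<gamma>. \<bar>b j\<bar>) \<le> M" using M by (simp add: sum.distrib)
  qed
  have "ennreal ((\<eta> / (2 * t)) ^ ?k * exp (- t * M\<^sup>2 / 2)) = ennreal ?c * ennreal ((2 * \<eta>) ^ ?k)"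
  proof -
    have "\<eta> / (2 * t) = 1 / (4 * t) * (2 * \<eta>)" by simp
    then have "(\<eta> / (2 * t)) ^ ?k = (1 / (4 * t)) ^ ?k * (2 * \<eta>) ^ ?k" by (simp only: power_mult_distrib)
    then show ?thesis using t_pos \<eta> by (simp add: ennreal_mult[symmetric] mult_ac)
  qed
  also have "\<dots> = (\<integral>\<^sup>+b. ennreal ?c * indicator ?B b \<partial>PiM \<gamma> (\<lambda>_. lborel))"
    using B vol by (simp add: nn_integral_cmult_indicator)
  also have "\<dots> \<le> (\<integral>\<^sup>+b. ennreal (prior_density \<gamma> A b) * indicator ?B b \<partial>PiM \<gamma> (\<lambda>_. lborel))"
    using ge by (intro nn_integral_mono) (auto simp: indicator_def intro!: ennreal_leI)
  also have "\<dots> = emeasure (coef_prior \<gamma> A) ?G"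
    unfolding coef_prior_eq G[unfolded coef_prior_eq] by (rule emeasure_density[symmetric]) (use B in measurable)
  finally show ?thesis .
qed

end

section \<open>Nets and model weights\<close>

text \<open>Cut the cube into cells of side \<open>\<eta>\<close> and choose one point of \<open>U\<close> in every cell that meets \<open>U\<close>. It is
  essential that the net consists of points of \<open>U\<close>: its points have to be far from the truth.\<close>

lemma coordinate_net:
  fixes U :: "(nat \<Rightarrow> real) set"
  assumes fin: "finite \<gamma>" and \<eta>: "0 < \<eta>" and C: "0 \<le> C"
    and U: "\<And>b j. b \<in> U \<Longrightarrow> j \<in> \<gamma> \<Longrightarrow> \<bar>b j\<bar> \<le> C"
  obtains T where "T \<subseteq> U" "finite T" "real (card T) \<le> (2 * C / \<eta> + 3) ^ card \<gamma>"
    "\<And>b. b \<in> U \<Longrightarrow> \<exists>c\<in>T. \<forall>j\<in>\<gamma>. \<bar>b j - c j\<bar> \<le> \<eta>"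
proof -
  define cell where "cell b = restrict (\<lambda>j. \<lfloor>b j / \<eta>\<rfloor>) \<gamma>" for b :: "nat \<Rightarrow> real"
  define rep where "rep z = (SOME b. b \<in> U \<and> cell b = z)" for z
  have rep: "rep z \<in> U \<and> cell (rep z) = z" if "z \<in> cell ` U" for z
  proof -
    have "\<exists>b. b \<in> U \<and> cell b = z" using that by blast
    then show ?thesis unfolding rep_def by (rule someI_ex)
  qed
  define Z where "Z = \<lceil>C / \<eta>\<rceil>"
  have "0 \<le> C / \<eta>" using C \<eta> by simp
  then have Z: "0 \<le> Z" unfolding Z_def by linarith
  have sub: "cell ` U \<subseteq> PiE \<gamma> (\<lambda>_. {- Z .. Z})"
  proof (intro image_subsetI, unfold cell_def, intro restrict_PiE_iff[THEN iffD2] ballI)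
    fix b j assume b: "b \<in> U" and j: "j \<in> \<gamma>"
    have "- C \<le> b j" "b j \<le> C" using U[OF b j] by auto
    then have "- (C / \<eta>) \<le> b j / \<eta>" "b j / \<eta> \<le> C / \<eta>"
      using \<eta> divide_right_mono[of "- C" "b j" \<eta>] divide_right_mono[of "b j" C \<eta>] by auto
    then have "\<lfloor>- (C / \<eta>)\<rfloor> \<le> \<lfloor>b j / \<eta>\<rfloor>" "\<lfloor>b j / \<eta>\<rfloor> \<le> \<lfloor>C / \<eta>\<rfloor>" by (auto intro: floor_mono)
    moreover have "\<lfloor>- (C / \<eta>)\<rfloor> = - Z" unfolding Z_def by (simp add: ceiling_def)
    moreover have "\<lfloor>C / \<eta>\<rfloor> \<le> Z" unfolding Z_def by (rule floor_le_ceiling)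
    ultimately show "\<lfloor>b j / \<eta>\<rfloor> \<in> {- Z .. Z}" by auto
  qed
  have finP: "finite (PiE \<gamma> (\<lambda>_. {- Z .. Z}))" using fin by (intro finite_PiE) auto
  show thesis
  proof (rule that)
    show "rep ` cell ` U \<subseteq> U" using rep by auto
    show "finite (rep ` cell ` U)" using finite_subset[OF sub finP] by simp
    have "card (rep ` cell ` U) \<le> card (cell ` U)" by (intro card_image_le finite_subset[OF sub finP])
    also have "\<dots> \<le> card (PiE \<gamma> (\<lambda>_. {- Z .. Z}))" by (rule card_mono[OF finP sub])
    also have "\<dots> = nat (2 * Z + 1) ^ card \<gamma>" using fin by (simp add: card_PiE add.commute)
    finally have "real (card (rep ` cell ` U)) \<le> real (nat (2 * Z + 1)) ^ card \<gamma>"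
      by (simp flip: of_nat_power)
    also have "\<dots> \<le> (2 * C / \<eta> + 3) ^ card \<gamma>"
    proof (intro power_mono)
      have "real_of_int Z \<le> C / \<eta> + 1" unfolding Z_def by linarith
      then show "real (nat (2 * Z + 1)) \<le> 2 * C / \<eta> + 3" using Z by simp
    qed simp
    finally show "real (card (rep ` cell ` U)) \<le> (2 * C / \<eta> + 3) ^ card \<gamma>" .
    fix b assume b: "b \<in> U"
    let ?c = "rep (cell b)"
    have eq: "cell ?c = cell b" using rep b by blast
    have "\<bar>b j - ?c j\<bar> \<le> \<eta>" if j: "j \<in> \<gamma>" for j
    proof -
      have "\<lfloor>b j / \<eta>\<rfloor> = \<lfloor>?c j / \<eta>\<rfloor>" using fun_cong[OF eq, of j] j by (simp add: cell_def)
      then have "\<bar>b j / \<eta> - ?c j / \<eta>\<bar> \<le> 1" by linarith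
      then have "\<bar>b j - ?c j\<bar> / \<eta> \<le> 1" using \<eta> by (simp add: diff_divide_distrib[symmetric])
      then show ?thesis using \<eta> by simp
    qed
    then show "\<exists>c\<in>rep ` cell ` U. \<forall>j\<in>\<gamma>. \<bar>b j - c j\<bar> \<le> \<eta>" using b by blast
  qed
qed

text \<open>A set with at most \<open>r\<close> elements is the range of a map from \<open>r\<close> indices, with the value zero for the
  unused ones.\<close>

lemma card_small_subsets_le:
  "card {\<gamma>. \<gamma> \<subseteq> {1..K} \<and> card \<gamma> \<le> r} \<le> (K + 1) ^ r"
proof -
  let ?F = "PiE {..<r} (\<lambda>_. {0..K})"
  have "{\<gamma>. \<gamma> \<subseteq> {1..K} \<and> card \<gamma> \<le> r} \<subseteq> (\<lambda>f. f ` {..<r} - {0}) ` ?F"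
  proof
    fix \<gamma> assume "\<gamma> \<in> {\<gamma>. \<gamma> \<subseteq> {1..K} \<and> card \<gamma> \<le> r}"
    then have g: "\<gamma> \<subseteq> {1..K}" "card \<gamma> \<le> r" "finite \<gamma>" by (auto intro: finite_subset)
    then obtain e where e: "bij_betw e {..<card \<gamma>} \<gamma>" 
      using ex_bij_betw_nat_finite[of \<gamma>] by (auto simp: atLeast0LessThan)
    let ?f = "\<lambda>i\<in>{..<r}. if i < card \<gamma> then e i else 0"
    have e': "e i \<in> \<gamma>" if "i < card \<gamma>" for i
      using e that unfolding bij_betw_def by blast
    have "e i \<le> K" if "i < card \<gamma>" for i
      using subsetD[OF g(1) e'[OF that]] by simp
    then have "?f \<in> ?F" by (intro restrict_PiE_iff[THEN iffD2] ballI) simp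
    moreover have "?f ` {..<r} - {0} = \<gamma>"
    proof
      show "?f ` {..<r} - {0} \<subseteq> \<gamma>"
      proof
        fix x assume "x \<in> ?f ` {..<r} - {0}"
        then obtain i where "i < r" "x = (if i < card \<gamma> then e i else 0)" "x \<noteq> 0" by auto
        then show "x \<in> \<gamma>" using e' by (simp split: if_splits)
      qed
      show "\<gamma> \<subseteq> ?f ` {..<r} - {0}"
      proof
        fix x assume x: "x \<in> \<gamma>"
        then obtain i where i: "i < card \<gamma>" "x = e i" using e unfolding bij_betw_def by blast
        have "i < r" using i g by simp
        moreover have "x = ?f i" using i \<open>i < r\<close> by simp
        moreover have "x \<noteq> 0" using subsetD[OF g(1) x] by simp
        ultimately show "x \<in> ?f ` {..<r} - {0}" by (intro DiffI image_eqI) simp_all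
      qed
    qed
    ultimately show "\<gamma> \<in> (\<lambda>f. f ` {..<r} - {0}) ` ?F" by blast
  qed
  then have "card {\<gamma>. \<gamma> \<subseteq> {1..K} \<and> card \<gamma> \<le> r} \<le> card ((\<lambda>f. f ` {..<r} - {0}) ` ?F)"
    by (intro card_mono finite_imageI finite_PiE) auto
  also have "\<dots> \<le> card ?F" by (intro card_image_le finite_PiE) auto
  also have "\<dots> = (K + 1) ^ r" by (simp add: card_PiE)
  finally show ?thesis .
qed

lemma model_weight_nonneg: "r \<le> K \<Longrightarrow> 0 \<le> model_weight K r rbar \<gamma>"
  unfolding model_weight_def by (auto intro!: prod_nonneg simp: divide_le_eq)

text \<open>Without the truncation the weights are the probabilities of all outcomes of independent trials.\<close>

lemma sum_model_weight_le:
  assumes "r \<le> K"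
  shows "(\<Sum>\<gamma>\<in>Pow {1..K}. model_weight K r rbar \<gamma>) \<le> 1"
proof -
  let ?a = "real r / real K"
  have a: "0 \<le> ?a" "?a \<le> 1" using assms by (auto simp: divide_le_eq)
  have w: "(\<Prod>j\<in>{1..K}. if j \<in> \<gamma> then ?a else 1 - ?a) = (\<Prod>j\<in>\<gamma>. ?a) * (\<Prod>j\<in>{1..K} - \<gamma>. 1 - ?a)"
    if "\<gamma> \<subseteq> {1..K}" for \<gamma>
  proof -
    have "(\<Prod>j\<in>{1..K}. if j \<in> \<gamma> then ?a else 1 - ?a) =
        (\<Prod>j\<in>{1..K} \<inter> {j. j \<in> \<gamma>}. ?a) * (\<Prod>j\<in>{1..K} \<inter> - {j. j \<in> \<gamma>}. 1 - ?a)"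
      by (rule prod.If_cases) simp
    moreover have "{1..K} \<inter> {j. j \<in> \<gamma>} = \<gamma>" "{1..K} \<inter> - {j. j \<in> \<gamma>} = {1..K} - \<gamma>" using that by auto
    ultimately show ?thesis by simp
  qed
  have "(\<Sum>\<gamma>\<in>Pow {1..K}. model_weight K r rbar \<gamma>) \<le>
      (\<Sum>\<gamma>\<in>Pow {1..K}. (\<Prod>j\<in>\<gamma>. ?a) * (\<Prod>j\<in>{1..K} - \<gamma>. 1 - ?a))"
  proof (intro sum_mono)
    fix \<gamma> assume "\<gamma> \<in> Pow {1..K}"
    then have w': "(\<Prod>j\<in>{1..K}. if j \<in> \<gamma> then ?a else 1 - ?a) = (\<Prod>j\<in>\<gamma>. ?a) * (\<Prod>j\<in>{1..K} - \<gamma>. 1 - ?a)"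
      by (intro w) simp
    have "0 \<le> (\<Prod>j\<in>\<gamma>. ?a) * (\<Prod>j\<in>{1..K} - \<gamma>. 1 - ?a)"
      using a by (intro mult_nonneg_nonneg prod_nonneg) auto
    then show "model_weight K r rbar \<gamma> \<le> (\<Prod>j\<in>\<gamma>. ?a) * (\<Prod>j\<in>{1..K} - \<gamma>. 1 - ?a)"
      unfolding model_weight_def w' by simp
  qed
  also have "\<dots> = (\<Prod>j\<in>{1..K}. ?a + (1 - ?a))" by (rule prod_add[symmetric]) simp
  finally show ?thesis by simp
qed

text \<open>From \<open>1 - a \<ge> exp (- a / (1 - a))\<close> with \<open>a = r / K\<close> the factor of the \<open>K - r\<close> absent indices is at
  least \<open>exp (- r)\<close>.\<close>

lemma model_weight_ge:
  assumes r: "1 \<le> r" "r < K" "r \<le> rbar" and \<gamma>: "\<gamma> \<subseteq> {1..K}" "card \<gamma> = r"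
  shows "(1 / real K) ^ r * exp (- real r) \<le> model_weight K r rbar \<gamma>"
proof -
  let ?a = "real r / real K"
  have K: "0 < real K" and a: "0 < ?a" "?a < 1" using r by auto
  have fin: "finite \<gamma>" using \<gamma>(1) finite_subset by blast
  have "model_weight K r rbar \<gamma> = (\<Prod>j\<in>{1..K} \<inter> {j. j \<in> \<gamma>}. ?a) * (\<Prod>j\<in>{1..K} \<inter> - {j. j \<in> \<gamma>}. 1 - ?a)"
    unfolding model_weight_def using \<gamma> r by (simp add: prod.If_cases)
  also have "\<dots> = ?a ^ r * (1 - ?a) ^ (K - r)"
  proof -
    have "{1..K} \<inter> {j. j \<in> \<gamma>} = \<gamma>" "{1..K} \<inter> - {j. j \<in> \<gamma>} = {1..K} - \<gamma>" using \<gamma> by auto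
    then show ?thesis using \<gamma> fin by (simp add: card_Diff_subset)
  qed
  finally have w: "model_weight K r rbar \<gamma> = ?a ^ r * (1 - ?a) ^ (K - r)" .
  have "exp (- a / (1 - a)) \<le> 1 - a" if "a < 1" for a :: real
  proof -
    have "1 + a / (1 - a) \<le> exp (a / (1 - a))" by (rule exp_ge_add_one_self)
    moreover have "1 + a / (1 - a) = 1 / (1 - a)" using that by (simp add: field_simps)
    ultimately have "inverse (exp (a / (1 - a))) \<le> inverse (1 / (1 - a))"
      using that by (intro le_imp_inverse_le) auto
    then show ?thesis by (simp add: exp_minus[symmetric])
  qed
  from this[OF a(2)] have "exp (- ?a / (1 - ?a)) ^ (K - r) \<le> (1 - ?a) ^ (K - r)"
    by (intro power_mono) auto
  moreover have "exp (- ?a / (1 - ?a)) ^ (K - r) = exp (- real r)"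
  proof -
    have "1 - ?a = real (K - r) / real K" using K r by (simp add: of_nat_diff field_simps)
    then have "?a / (1 - ?a) = real r / real (K - r)" using K by simp
    then have "real (K - r) * (- ?a / (1 - ?a)) = - real r" using r by simp
    then show ?thesis unfolding exp_of_nat_mult[symmetric] by (simp only:)
  qed
  moreover have "(1 / real K) ^ r \<le> ?a ^ r" using r K by (intro power_mono divide_right_mono) auto
  ultimately show ?thesis unfolding w using a by (intro mult_mono) auto
qed

lemma model_prior_nonneg: "r \<le> K \<Longrightarrow> 0 \<le> model_prior K r rbar \<gamma>"
  unfolding model_prior_def by (intro divide_nonneg_nonneg sum_nonneg model_weight_nonneg) auto

lemma sum_model_prior_le: "r \<le> K \<Longrightarrow> (\<Sum>\<gamma>\<in>Pow {1..K}. model_prior K r rbar \<gamma>) \<le> 1"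
  unfolding model_prior_def sum_divide_distrib[symmetric] by simp

lemma model_prior_ge:
  assumes r: "1 \<le> r" "r < K" "r \<le> rbar" and \<gamma>: "\<gamma> \<subseteq> {1..K}" "card \<gamma> = r"
  shows "(1 / real K) ^ r * exp (- real r) \<le> model_prior K r rbar \<gamma>"
proof -
  let ?Z = "\<Sum>\<gamma>'\<in>Pow {1..K}. model_weight K r rbar \<gamma>'"
  have pos: "0 < model_weight K r rbar \<gamma>"
    using model_weight_ge[OF assms] r by (intro less_le_trans[OF _ model_weight_ge[OF assms]]) auto
  also have "\<dots> \<le> ?Z"
    using \<gamma> r by (intro member_le_sum model_weight_nonneg) auto
  finally have Z: "0 < ?Z" "?Z \<le> 1" using sum_model_weight_le[of r K rbar] r by auto
  have "model_weight K r rbar \<gamma> / 1 \<le> model_prior K r rbar \<gamma>"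
    unfolding model_prior_def using Z pos by (intro divide_left_mono) auto
  with model_weight_ge[OF assms] show ?thesis by simp
qed

section \<open>The posterior of the selection model\<close>

text \<open>The selection model for a fixed sample size.\<close>

locale selection_model = prob_space \<nu> for \<nu> :: "(nat \<Rightarrow> real) measure" +
  fixes m :: regression and K r rbar n :: nat and \<beta> :: "nat \<Rightarrow> real"
    and V :: "nat set \<Rightarrow> real mat" and t :: real
  assumes valid: "valid_regression m"
    and sets_\<nu> [measurable_cong]: "sets \<nu> = sets (PiM {1..K} (\<lambda>_. borel))"
    and regressor_le: "AE x in \<nu>. \<forall>j\<in>{1..K}. \<bar>x j\<bar> \<le> 1"
    and pd: "\<And>\<gamma>. \<gamma> \<subseteq> {1..K} \<Longrightarrow> pos_def_mat (card \<gamma>) (V \<gamma>)"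
    and sizes: "1 \<le> r" "r \<le> rbar" "rbar < K"
    and t: "1 \<le> t"
    and ch: "\<And>\<gamma>. \<gamma> \<subseteq> {1..K} \<Longrightarrow> \<gamma> \<noteq> {} \<Longrightarrow> card \<gamma> \<le> rbar \<Longrightarrow> ch1 (V \<gamma>) \<le> t"
      "\<And>\<gamma>. \<gamma> \<subseteq> {1..K} \<Longrightarrow> \<gamma> \<noteq> {} \<Longrightarrow> card \<gamma> \<le> rbar \<Longrightarrow> ch1 (inv_mat (V \<gamma>)) \<le> t"
begin

definition models :: "nat set set" where
  "models = {\<gamma>. \<gamma> \<subseteq> {1..K} \<and> card \<gamma> \<le> rbar}"

lemma models_finite [simp]: "finite models"
  unfolding models_def by (rule finite_subset[of _ "Pow {1..K}"]) auto

lemma modelsD: "\<gamma> \<in> models \<Longrightarrow> \<gamma> \<subseteq> {1..K}" "\<gamma> \<in> models \<Longrightarrow> finite \<gamma>" "\<gamma> \<in> models \<Longrightarrow> card \<gamma> \<le> rbar"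
  unfolding models_def using finite_subset by auto

abbreviation prior :: "nat set \<Rightarrow> (nat \<Rightarrow> real) measure" where
  "prior \<gamma> \<equiv> coef_prior \<gamma> (V \<gamma>)"

lemma coordinate_measurable [measurable]: "j \<in> {1..K} \<Longrightarrow> (\<lambda>x. x j) \<in> borel_measurable \<nu>"
  by (subst measurable_cong_sets[OF sets_\<nu> refl]) (rule measurable_component_singleton)

lemma lin_param_measurable:
  assumes "\<gamma> \<subseteq> {1..K}"
  shows "lin_param \<gamma> b \<in> borel_measurable \<nu>"
  unfolding lin_param_def[abs_def]
proof (intro borel_measurable_sum borel_measurable_times borel_measurable_const)
  fix j assume "j \<in> \<gamma>"
  with assms show "(\<lambda>x. x j) \<in> borel_measurable \<nu>" by (intro coordinate_measurable) auto
qed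

sublocale regression_truth \<nu> m "lin_param {1..K} \<beta>"
  by unfold_locales (auto simp: valid lin_param_measurable)

lemma bounded_covariance_model:
  assumes "\<gamma> \<in> models"
  shows "bounded_covariance \<gamma> (V \<gamma>) t"
  using modelsD[OF assms] pd ch t by unfold_locales auto

lemma regression_prior_model:
  assumes \<gamma>: "\<gamma> \<in> models"
  shows "regression_prior \<nu> m (lin_param {1..K} \<beta>) (prior \<gamma>) (lin_param \<gamma>)"
proof -
  interpret B: bounded_covariance \<gamma> "V \<gamma>" t by (rule bounded_covariance_model[OF \<gamma>])
  interpret finite_measure "prior \<gamma>" by (rule B.finite_measure_coef_prior)
  show ?thesis
  proof unfold_locales
    show "(\<lambda>(b, x). lin_param \<gamma> b x) \<in> borel_measurable (prior \<gamma> \<Otimes>\<^sub>M \<nu>)"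
      unfolding lin_param_def split_beta'
    proof (intro borel_measurable_sum borel_measurable_times)
      fix j assume j: "j \<in> \<gamma>"
      then have "j \<in> {1..K}" using modelsD(1)[OF \<gamma>] by auto
      from measurable_compose[OF measurable_snd coordinate_measurable[OF this]]
      show "(\<lambda>p. snd p j) \<in> borel_measurable (prior \<gamma> \<Otimes>\<^sub>M \<nu>)" .
      have "(\<lambda>b. b j) \<in> borel_measurable (prior \<gamma>)"
        by (subst measurable_cong_sets[OF sets_coef_prior refl]) (rule measurable_component_singleton[OF j])
      from measurable_compose[OF measurable_fst this]
      show "(\<lambda>p. fst p j) \<in> borel_measurable (prior \<gamma> \<Otimes>\<^sub>M \<nu>)" .
    qed
  qed
qed

lemma sample_law_eq: "sample_law m K \<beta> \<nu> = S"
  unfolding sample_law_def S_def true_density_def by (simp add: split_beta')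

lemma data_law_eq: "data_law m K \<beta> \<nu> n = data n"
  unfolding data_law_def data_def sample_law_eq ..

lemma hellinger_eq: "hellinger m K \<beta> \<nu> \<gamma> b = sqrt (hellinger_sq (lin_param \<gamma> b))"
  unfolding hellinger_def hellinger_sq_def model_density_def true_density_def by simp

abbreviation ev :: "nat set \<Rightarrow> (nat \<Rightarrow> real) set \<Rightarrow> (nat \<Rightarrow> (nat \<Rightarrow> real) \<times> real) \<Rightarrow> ennreal" where
  "ev \<gamma> A D \<equiv> regression_prior.evidence m (lin_param {1..K} \<beta>) (prior \<gamma>) (lin_param \<gamma>) n A D"

abbreviation wt :: "nat set \<Rightarrow> real" where
  "wt \<equiv> model_prior K r rbar"

text \<open>An event of pairs of model and coefficients is cut into one event for the coefficients of each model.\<close>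

definition section_of :: "(nat set \<times> (nat \<Rightarrow> real)) set \<Rightarrow> nat set \<Rightarrow> (nat \<Rightarrow> real) set" where
  "section_of A \<gamma> = {b \<in> space (prior \<gamma>). (\<gamma>, b) \<in> A}"

definition total_evidence ::
    "(nat set \<times> (nat \<Rightarrow> real)) set \<Rightarrow> (nat \<Rightarrow> (nat \<Rightarrow> real) \<times> real) \<Rightarrow> ennreal" where
  "total_evidence A D = (\<Sum>\<gamma>\<in>models. ennreal (wt \<gamma>) * ev \<gamma> (section_of A \<gamma>) D)"

definition measurable_event :: "(nat set \<times> (nat \<Rightarrow> real)) set \<Rightarrow> bool" where
  "measurable_event A \<longleftrightarrow> (\<forall>\<gamma>\<in>models. section_of A \<gamma> \<in> sets (prior \<gamma>))"

lemma wt_nonneg: "0 \<le> wt \<gamma>"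
  using sizes by (intro model_prior_nonneg) auto

lemma sum_wt_le: "(\<Sum>\<gamma>\<in>models. wt \<gamma>) \<le> 1"
proof -
  have "(\<Sum>\<gamma>\<in>models. wt \<gamma>) \<le> (\<Sum>\<gamma>\<in>Pow {1..K}. wt \<gamma>)"
    unfolding models_def using wt_nonneg by (intro sum_mono2) auto
  also have "\<dots> \<le> 1" using sizes by (intro sum_model_prior_le) auto
  finally show ?thesis .
qed

text \<open>The true likelihood is a common factor of all integrals; models with more than \<open>rbar\<close> indices have
  weight zero.\<close>

lemma posterior_mass_eq:
  assumes A: "measurable_event A" and D: "D \<in> space (data n)"
  shows "posterior_mass m K r rbar V n D A =
    ennreal (\<Prod>i=1..n. dens (lin_param {1..K} \<beta>) (D i)) * total_evidence A D"
proof -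
  let ?p = "\<Prod>i=1..n. dens (lin_param {1..K} \<beta>) (D i)"
  have p: "0 \<le> ?p" by (intro prod_nonneg ballI less_imp_le dens_pos)
  let ?F = "\<lambda>\<gamma>. ennreal (wt \<gamma>) *
       (\<integral>\<^sup>+ b. ennreal (\<Prod>i=1..n. model_density m \<gamma> b (fst (D i)) (snd (D i))) * indicator A (\<gamma>, b) \<partial>prior \<gamma>)"
  have zero: "?F \<gamma> = 0" if "\<gamma> \<in> Pow {1..K} - models" for \<gamma>
    using that by (simp add: models_def model_prior_def model_weight_def)
  have eq: "?F \<gamma> = ennreal ?p * (ennreal (wt \<gamma>) * ev \<gamma> (section_of A \<gamma>) D)" if \<gamma>: "\<gamma> \<in> models" for \<gamma>
  proof -
    interpret P: regression_prior \<nu> m "lin_param {1..K} \<beta>" "prior \<gamma>" "lin_param \<gamma>"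
      by (rule regression_prior_model[OF \<gamma>])
    have [measurable]: "section_of A \<gamma> \<in> sets (prior \<gamma>)" using A \<gamma> unfolding measurable_event_def by auto
    note [measurable] = P.lik_section[OF D]
    have "(\<integral>\<^sup>+ b. ennreal (\<Prod>i=1..n. model_density m \<gamma> b (fst (D i)) (snd (D i))) * indicator A (\<gamma>, b) \<partial>prior \<gamma>)
      = (\<integral>\<^sup>+ b. ennreal ?p * (ennreal (lik (lin_param \<gamma> b) n D) * indicator (section_of A \<gamma>) b) \<partial>prior \<gamma>)"
    proof (intro nn_integral_cong)
      fix b assume b: "b \<in> space (prior \<gamma>)"
      have "(\<Prod>i=1..n. model_density m \<gamma> b (fst (D i)) (snd (D i))) = ?p * lik (lin_param \<gamma> b) n D"
        unfolding lik_def model_density_def prod.distrib[symmetric]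
        using less_imp_neq[OF dens_pos] by (intro prod.cong) (auto simp: less_imp_neq[OF reg_pos, THEN not_sym])
      moreover have "indicator A (\<gamma>, b) = (indicator (section_of A \<gamma>) b :: ennreal)"
        using b by (simp add: section_of_def indicator_def)
      ultimately show "ennreal (\<Prod>i=1..n. model_density m \<gamma> b (fst (D i)) (snd (D i))) * indicator A (\<gamma>, b)
        = ennreal ?p * (ennreal (lik (lin_param \<gamma> b) n D) * indicator (section_of A \<gamma>) b)"
        using p less_imp_le[OF lik_pos] by (simp add: ennreal_mult mult.assoc)
    qed
    also have "\<dots> = ennreal ?p * ev \<gamma> (section_of A \<gamma>) D"
      unfolding P.evidence_def by (rule nn_integral_cmult) measurable
    finally show ?thesis by (simp add: mult_ac)
  qed
  have "posterior_mass m K r rbar V n D A = (\<Sum>\<gamma>\<in>Pow {1..K}. ?F \<gamma>)"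
    unfolding posterior_mass_def ..
  also have "\<dots> = (\<Sum>\<gamma>\<in>models. ?F \<gamma>)"
    using zero by (intro sum.mono_neutral_right) (auto simp: models_def)
  also have "\<dots> = (\<Sum>\<gamma>\<in>models. ennreal ?p * (ennreal (wt \<gamma>) * ev \<gamma> (section_of A \<gamma>) D))"
    by (intro sum.cong refl eq)
  finally show ?thesis unfolding total_evidence_def by (simp add: sum_distrib_left)
qed

lemma measurable_event_UNIV: "measurable_event UNIV"
  unfolding measurable_event_def section_of_def by auto

lemma posterior_prob_eq:
  assumes A: "measurable_event A" and D: "D \<in> space (data n)"
  shows "posterior_prob m K r rbar V n D A = enn2real (total_evidence A D / total_evidence UNIV D)"
proof -
  let ?p = "\<Prod>i=1..n. dens (lin_param {1..K} \<beta>) (D i)"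
  have p: "0 < ?p" by (intro prod_pos ballI dens_pos)
  have "(c * a) / (c * b) = a / b" if "c \<noteq> 0" "c \<noteq> \<infinity>" for a b c :: ennreal
    using divide_mult_eq[OF that, of a b] by (simp only: mult.commute)
  moreover have "ennreal ?p \<noteq> 0" "ennreal ?p \<noteq> \<infinity>" using p by (auto simp only: ennreal_eq_0_iff not_le[symmetric] ennreal_neq_top infinity_ennreal_def)
  ultimately have "(ennreal ?p * a) / (ennreal ?p * b) = a / b" for a b by blast
  then show ?thesis
    unfolding posterior_prob_def posterior_mass_eq[OF A D] posterior_mass_eq[OF measurable_event_UNIV D] by simp
qed

lemma total_evidence_measurable:
  assumes A: "measurable_event A"
  shows "total_evidence A \<in> borel_measurable (data n)"
  unfolding total_evidence_def[abs_def]
proof (intro borel_measurable_sum borel_measurable_times_ennreal borel_measurable_const)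
  fix \<gamma> assume \<gamma>: "\<gamma> \<in> models"
  interpret P: regression_prior \<nu> m "lin_param {1..K} \<beta>" "prior \<gamma>" "lin_param \<gamma>"
    by (rule regression_prior_model[OF \<gamma>])
  show "ev \<gamma> (section_of A \<gamma>) \<in> borel_measurable (data n)"
    using A \<gamma> unfolding measurable_event_def by (intro P.evidence_measurable) auto
qed

lemma posterior_prob_measurable:
  assumes A: "measurable_event A"
  shows "(\<lambda>D. posterior_prob m K r rbar V n D A) \<in> borel_measurable (data n)"
proof -
  note [measurable] = total_evidence_measurable[OF A] total_evidence_measurable[OF measurable_event_UNIV]
  have "(\<lambda>D. enn2real (total_evidence A D / total_evidence UNIV D)) \<in> borel_measurable (data n)" by measurable
  then show ?thesis by (subst measurable_cong[OF posterior_prob_eq[OF A]])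
qed

end

context selection_model
begin

definition far :: "real \<Rightarrow> (nat set \<times> (nat \<Rightarrow> real)) set" where
  "far \<epsilon> = {(\<gamma>, b). hellinger m K \<beta> \<nu> \<gamma> b > \<epsilon>}"

lemma measurable_event_hellinger:
  assumes [measurable]: "{x. P x} \<in> sets (borel :: real measure)"
  shows "measurable_event {(\<gamma>, b). P (hellinger m K \<beta> \<nu> \<gamma> b)}"
  unfolding measurable_event_def
proof
  fix \<gamma> assume \<gamma>: "\<gamma> \<in> models"
  interpret P: regression_prior \<nu> m "lin_param {1..K} \<beta>" "prior \<gamma>" "lin_param \<gamma>"
    by (rule regression_prior_model[OF \<gamma>])
  have "(\<lambda>b. sqrt (hellinger_sq (lin_param \<gamma> b))) \<in> borel_measurable (prior \<gamma>)" by measurable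
  from measurable_sets[OF this assms]
  show "section_of {(\<gamma>, b). P (hellinger m K \<beta> \<nu> \<gamma> b)} \<gamma> \<in> sets (prior \<gamma>)"
    unfolding section_of_def hellinger_eq by (simp add: vimage_def Int_def conj_commute)
qed

lemma measurable_event_far: "measurable_event (far \<epsilon>)"
  unfolding far_def by (rule measurable_event_hellinger) simp

lemma lin_param_bound:
  assumes "\<gamma> \<in> models" and x: "\<forall>j\<in>{1..K}. \<bar>x j\<bar> \<le> 1" and C: "0 \<le> C" "\<And>j. j \<in> \<gamma> \<Longrightarrow> \<bar>b j\<bar> \<le> C"
  shows "\<bar>lin_param \<gamma> b x\<bar> \<le> real rbar * C"
proof -
  have "\<bar>lin_param \<gamma> b x\<bar> \<le> (\<Sum>j\<in>\<gamma>. \<bar>x j * b j\<bar>)" unfolding lin_param_def by (rule sum_abs)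
  also have "\<dots> \<le> (\<Sum>j\<in>\<gamma>. 1 * C)"
    unfolding abs_mult using x modelsD(1)[OF assms(1)] C by (intro sum_mono mult_mono) auto
  also have "\<dots> \<le> real rbar * C" using modelsD(3)[OF assms(1)] C by (simp add: mult_right_mono)
  finally show ?thesis .
qed

lemma lin_param_diff: "lin_param \<gamma> b x - lin_param \<gamma> c x = lin_param \<gamma> (\<lambda>j. b j - c j) x"
  unfolding lin_param_def by (simp add: sum_subtractf right_diff_distrib)

lemma evidence_total_mono:
  assumes "\<gamma> \<in> models" "A \<subseteq> space (prior \<gamma>)"
  shows "ennreal (wt \<gamma>) * ev \<gamma> A D \<le> total_evidence UNIV D"
proof -
  interpret P: regression_prior \<nu> m "lin_param {1..K} \<beta>" "prior \<gamma>" "lin_param \<gamma>"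
    by (rule regression_prior_model[OF assms(1)])
  have "ennreal (wt \<gamma>) * ev \<gamma> A D \<le> ennreal (wt \<gamma>) * ev \<gamma> (section_of UNIV \<gamma>) D"
    using assms(2) by (intro mult_left_mono P.evidence_mono) (auto simp: section_of_def)
  also have "\<dots> \<le> total_evidence UNIV D"
    unfolding total_evidence_def using assms(1) by (intro member_le_sum) auto
  finally show ?thesis .
qed

text \<open>The three summands are the probability that a net point passes for the truth, the probability that the
  evidence of the box around \<open>\<beta>\<close> is small, and the expected evidence of the remaining far parameters
  divided by the guaranteed total evidence \<open>\<delta> w\<close>. In the last one, \<open>(2 t) ^ rbar\<close> bounds the total mass
  of the dominating measure.\<close>

lemma posterior_far_bound:
  assumes \<epsilon>: "0 < \<epsilon>" "\<epsilon> \<le> 1" and C: "0 \<le> C" and \<eta>: "0 < \<eta>" and \<kappa>: "0 < \<kappa>"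
    and close: "\<And>h h'. \<bar>h\<bar> \<le> real rbar * C \<Longrightarrow> \<bar>h'\<bar> \<le> real rbar * C \<Longrightarrow> \<bar>h - h'\<bar> \<le> real rbar * \<eta> \<Longrightarrow>
      chi_square m h h' \<le> ennreal (\<kappa>\<^sup>2)"
    and \<gamma>0: "\<gamma>\<^sub>0 \<subseteq> {1..K}" "card \<gamma>\<^sub>0 = r"
    and \<zeta>: "0 < \<zeta>" and M: "(\<Sum>j=1..K. \<bar>\<beta> j\<bar>) + real r * \<zeta> \<le> M"
    and \<omega>: "real r * \<zeta> + (\<Sum>j\<in>{1..K} - \<gamma>\<^sub>0. \<bar>\<beta> j\<bar>) \<le> \<omega>"
    and q: "0 \<le> q" and near: "\<And>h h'. \<bar>h\<bar> \<le> M \<Longrightarrow> \<bar>h'\<bar> \<le> M \<Longrightarrow> \<bar>h - h'\<bar> \<le> \<omega> \<Longrightarrow>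
      chi_square m h h' \<le> ennreal q"
    and \<delta>: "0 < \<delta>"
    and w: "w = (1 / real K) ^ r * exp (- real r) * ((\<zeta> / (2 * t)) ^ r * exp (- t * M\<^sup>2 / 2))"
  shows "(\<integral>\<^sup>+D. ennreal (posterior_prob m K r rbar V n D (far \<epsilon>)) \<partial>data n) \<le>
    ennreal ((real K + 1) ^ rbar * (2 * C / \<eta> + 3) ^ rbar * (1 - \<epsilon>\<^sup>2 / 2) ^ n + \<delta> * (1 + q) ^ n
      + ((1 - \<epsilon>\<^sup>2 / 2 + \<kappa>) ^ n + exp (- C\<^sup>2 / (4 * t))) * (2 * t) ^ rbar / (\<delta> * w))"
proof -
  have e1: "\<epsilon>\<^sup>2 \<le> 1" using \<epsilon> by (simp add: power_le_one)
  have K0: "0 < real K" using sizes by simp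
  have t0: "0 < t" using t by simp
  have w0: "0 < w" unfolding w using K0 \<zeta> t0 by simp
  \<comment> \<open>\<open>U\<close> holds the far parameters with moderate coefficients, \<open>W\<close> the large coefficients.\<close>
  define U where "U \<gamma> = {b \<in> section_of (far \<epsilon>) \<gamma>. \<forall>j\<in>\<gamma>. \<bar>b j\<bar> \<le> C}" for \<gamma>
  define W where "W \<gamma> = {b \<in> space (prior \<gamma>). \<exists>j\<in>\<gamma>. C < \<bar>b j\<bar>}" for \<gamma>
  let ?N = "2 * C / \<eta> + 3"
  have "\<exists>T. T \<subseteq> U \<gamma> \<and> finite T \<and> real (card T) \<le> ?N ^ card \<gamma> \<and>
      (\<forall>b\<in>U \<gamma>. \<exists>c\<in>T. \<forall>j\<in>\<gamma>. \<bar>b j - c j\<bar> \<le> \<eta>)" if "\<gamma> \<in> models" for \<gamma>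
    by (rule coordinate_net[OF modelsD(2)[OF that] \<eta> C, of "U \<gamma>"]) (auto simp: U_def)
  then obtain T where T: "\<And>\<gamma>. \<gamma> \<in> models \<Longrightarrow> T \<gamma> \<subseteq> U \<gamma>" "\<And>\<gamma>. \<gamma> \<in> models \<Longrightarrow> finite (T \<gamma>)"
      "\<And>\<gamma>. \<gamma> \<in> models \<Longrightarrow> real (card (T \<gamma>)) \<le> ?N ^ card \<gamma>"
      "\<And>\<gamma> b. \<gamma> \<in> models \<Longrightarrow> b \<in> U \<gamma> \<Longrightarrow> \<exists>c\<in>T \<gamma>. \<forall>j\<in>\<gamma>. \<bar>b j - c j\<bar> \<le> \<eta>"
    by metis
  define TT where "TT = (\<Union>\<gamma>\<in>models. lin_param \<gamma> ` T \<gamma>)"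
  have TT_fin: "finite TT" unfolding TT_def using T(2) by auto
  have N1: "1 \<le> ?N" using C \<eta> by simp
  have TT_card: "real (card TT) \<le> (real K + 1) ^ rbar * ?N ^ rbar"
  proof -
    have "card TT \<le> (\<Sum>\<gamma>\<in>models. card (lin_param \<gamma> ` T \<gamma>))"
      unfolding TT_def by (rule card_UN_le) simp
    also have "\<dots> \<le> (\<Sum>\<gamma>\<in>models. card (T \<gamma>))" using T(2) by (intro sum_mono card_image_le) auto
    finally have "real (card TT) \<le> (\<Sum>\<gamma>\<in>models. real (card (T \<gamma>)))" by (simp flip: of_nat_sum)
    also have "\<dots> \<le> (\<Sum>\<gamma>\<in>models. ?N ^ rbar)"
    proof (intro sum_mono)
      fix \<gamma> assume \<gamma>: "\<gamma> \<in> models"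
      have "?N ^ card \<gamma> \<le> ?N ^ rbar" using N1 modelsD(3)[OF \<gamma>] by (intro power_increasing) auto
      with T(3)[OF \<gamma>] show "real (card (T \<gamma>)) \<le> ?N ^ rbar" by linarith
    qed
    also have "\<dots> = real (card models) * ?N ^ rbar" by simp
    also have "\<dots> \<le> (real K + 1) ^ rbar * ?N ^ rbar"
    proof (intro mult_right_mono)
      have "real (card models) \<le> real ((K + 1) ^ rbar)"
        unfolding models_def using card_small_subsets_le by (simp only: of_nat_le_iff)
      then show "real (card models) \<le> (real K + 1) ^ rbar" by (simp add: add.commute)
    qed (use N1 in simp)
    finally show ?thesis .
  qed
  have TT_meas: "c \<in> borel_measurable \<nu>" if "c \<in> TT" for c
    using that modelsD(1) lin_param_measurable unfolding TT_def by blast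
  have TT_far: "\<epsilon>\<^sup>2 \<le> hellinger_sq c" if cT: "c \<in> TT" for c
  proof -
    obtain \<gamma> b where g: "\<gamma> \<in> models" "b \<in> T \<gamma>" and c: "c = lin_param \<gamma> b" using cT unfolding TT_def by blast
    have "b \<in> section_of (far \<epsilon>) \<gamma>" using T(1)[OF g(1)] g(2) unfolding U_def by blast
    then have "\<epsilon> < sqrt (hellinger_sq c)" unfolding section_of_def far_def hellinger_eq c by simp
    then have "\<epsilon>\<^sup>2 < hellinger_sq c" using \<epsilon> by (metis less_imp_le real_less_rsqrt real_sqrt_less_iff real_sqrt_abs abs_of_pos)
    then show ?thesis by simp
  qed
  have U_sets: "U \<gamma> \<in> sets (prior \<gamma>)" and W_sets: "W \<gamma> \<in> sets (prior \<gamma>)" if \<gamma>: "\<gamma> \<in> models" for \<gamma>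
  proof -
    have [measurable]: "section_of (far \<epsilon>) \<gamma> \<in> sets (prior \<gamma>)"
      using measurable_event_far \<gamma> unfolding measurable_event_def by auto
    have [measurable]: "(\<lambda>b. b j) \<in> borel_measurable (prior \<gamma>)" if "j \<in> \<gamma>" for j
      by (subst measurable_cong_sets[OF sets_coef_prior refl]) (rule measurable_component_singleton[OF that])
    note fin [measurable] = modelsD(2)[OF \<gamma>]
    have "{b \<in> space (prior \<gamma>). \<forall>j\<in>\<gamma>. \<bar>b j\<bar> \<le> C} \<in> sets (prior \<gamma>)"
      by (intro sets.sets_Collect_finite_All fin) measurable
    then have "section_of (far \<epsilon>) \<gamma> \<inter> {b \<in> space (prior \<gamma>). \<forall>j\<in>\<gamma>. \<bar>b j\<bar> \<le> C} \<in> sets (prior \<gamma>)"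
      by (intro sets.Int) auto
    also have "section_of (far \<epsilon>) \<gamma> \<inter> {b \<in> space (prior \<gamma>). \<forall>j\<in>\<gamma>. \<bar>b j\<bar> \<le> C} = U \<gamma>"
      unfolding U_def section_of_def by auto
    finally show "U \<gamma> \<in> sets (prior \<gamma>)" .
    show "W \<gamma> \<in> sets (prior \<gamma>)" unfolding W_def
      by (intro sets.sets_Collect_finite_Ex fin) measurable
  qed
  let ?I = "\<lambda>D. indicator {D. \<forall>c\<in>TT. lik c n D < 1} D :: ennreal"
  define X where "X D = (\<Sum>\<gamma>\<in>models. ennreal (wt \<gamma>) * (ev \<gamma> (U \<gamma>) D * ?I D + ev \<gamma> (W \<gamma>) D))" for D
  define G where "G = {b \<in> space (prior \<gamma>\<^sub>0). \<forall>j\<in>\<gamma>\<^sub>0. \<bar>b j - \<beta> j\<bar> \<le> \<zeta>}"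
  have \<gamma>0m: "\<gamma>\<^sub>0 \<in> models" using \<gamma>0 sizes unfolding models_def by simp
  interpret P0: regression_prior \<nu> m "lin_param {1..K} \<beta>" "prior \<gamma>\<^sub>0" "lin_param \<gamma>\<^sub>0"
    by (rule regression_prior_model[OF \<gamma>0m])
  interpret B0: bounded_covariance \<gamma>\<^sub>0 "V \<gamma>\<^sub>0" t by (rule bounded_covariance_model[OF \<gamma>0m])
  interpret F0: finite_measure "prior \<gamma>\<^sub>0" by (rule B0.finite_measure_coef_prior)
  have G_sets: "G \<in> sets (prior \<gamma>\<^sub>0)"
  proof -
    have [measurable]: "(\<lambda>b. b j) \<in> borel_measurable (prior \<gamma>\<^sub>0)" if "j \<in> \<gamma>\<^sub>0" for j
      by (subst measurable_cong_sets[OF sets_coef_prior refl]) (rule measurable_component_singleton[OF that])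
    show ?thesis unfolding G_def
      by (intro sets.sets_Collect_finite_All B0.finite) measurable
  qed
  define g where "g = measure (prior \<gamma>\<^sub>0) G"
  have g_eq: "emeasure (prior \<gamma>\<^sub>0) G = ennreal g" unfolding g_def by (rule F0.emeasure_eq_measure)
  have sub\<beta>: "(\<Sum>j\<in>\<gamma>\<^sub>0. \<bar>\<beta> j\<bar>) \<le> (\<Sum>j=1..K. \<bar>\<beta> j\<bar>)"
    using \<gamma>0 by (intro sum_mono2) auto
  have "ennreal ((\<zeta> / (2 * t)) ^ r * exp (- t * M\<^sup>2 / 2)) \<le> ennreal g"
    unfolding g_eq[symmetric] G_def using B0.coef_prior_box[OF \<zeta>, of \<beta> M] sub\<beta> M \<gamma>0 by simp
  then have g_ge: "(\<zeta> / (2 * t)) ^ r * exp (- t * M\<^sup>2 / 2) \<le> g"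
    unfolding g_def by (subst (asm) ennreal_le_iff) auto
  have g0: "0 < g" using less_le_trans[OF _ g_ge] \<zeta> t0 by simp
  have wg: "w \<le> wt \<gamma>\<^sub>0 * g"
    unfolding w using model_prior_ge[of r K rbar \<gamma>\<^sub>0] sizes \<gamma>0 g_ge K0 \<zeta> t0 wt_nonneg
    by (intro mult_mono) auto
  let ?small = "{D \<in> space (data n). ev \<gamma>\<^sub>0 G D \<le> ennreal (\<delta> * g)}"
  let ?test = "{D \<in> space (data n). \<exists>c\<in>TT. 1 \<le> lik c n D}"
  have pointwise: "ennreal (posterior_prob m K r rbar V n D (far \<epsilon>)) \<le>
      indicator ?test D + indicator ?small D + ennreal (1 / (\<delta> * w)) * X D" if D: "D \<in> space (data n)" for D
  proof -
    let ?p = "total_evidence (far \<epsilon>) D / total_evidence UNIV D"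
    have post: "ennreal (posterior_prob m K r rbar V n D (far \<epsilon>)) \<le> ?p"
      unfolding posterior_prob_eq[OF measurable_event_far D] by (cases ?p) auto
    have F_le_all: "total_evidence (far \<epsilon>) D \<le> total_evidence UNIV D"
      unfolding total_evidence_def
    proof (intro sum_mono mult_left_mono)
      fix \<gamma> assume \<gamma>: "\<gamma> \<in> models"
      interpret P: regression_prior \<nu> m "lin_param {1..K} \<beta>" "prior \<gamma>" "lin_param \<gamma>"
        by (rule regression_prior_model[OF \<gamma>])
      show "ev \<gamma> (section_of (far \<epsilon>) \<gamma>) D \<le> ev \<gamma> (section_of UNIV \<gamma>) D"
        by (rule P.evidence_mono) (auto simp: section_of_def)
    qed simp
    have le1: "?p \<le> 1"
    proof (cases "total_evidence UNIV D = 0")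
      case True
      then show ?thesis using F_le_all by simp
    next
      case False
      then show ?thesis using F_le_all
        by (intro divide_le_posI_ennreal) (auto simp: zero_less_iff_neq_zero)
    qed
    have pl: "ennreal (posterior_prob m K r rbar V n D (far \<epsilon>)) \<le> 1" by (rule order.trans[OF post le1])
    consider "D \<in> ?test" | "D \<in> ?small" | "D \<notin> ?test" "D \<notin> ?small" by blast
    then show ?thesis
    proof cases
      case 1
      have "ennreal (posterior_prob m K r rbar V n D (far \<epsilon>)) \<le> indicator ?test D" using pl 1 by (simp only: indicator_simps)
      then show ?thesis by (simp add: add.assoc add_increasing2)
    next
      case 2
      have "ennreal (posterior_prob m K r rbar V n D (far \<epsilon>)) \<le> indicator ?small D" using pl 2 by (simp only: indicator_simps)
      then show ?thesis by (simp add: add_increasing add_increasing2)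
    next
      case 3
      have I1: "?I D = 1" using 3(1) D by (auto simp: not_le)
      have big: "ennreal (\<delta> * w) \<le> total_evidence UNIV D"
      proof -
        have "ennreal (\<delta> * w) \<le> ennreal (wt \<gamma>\<^sub>0 * (\<delta> * g))"
          using wg \<delta> by (intro ennreal_leI) (simp add: mult.left_commute)
        also have "\<dots> = ennreal (wt \<gamma>\<^sub>0) * ennreal (\<delta> * g)" using wt_nonneg \<delta> g0 by (intro ennreal_mult) auto
        also have "\<dots> \<le> ennreal (wt \<gamma>\<^sub>0) * ev \<gamma>\<^sub>0 G D" using 3(2) D by (intro mult_left_mono) auto
        also have "\<dots> \<le> total_evidence UNIV D"
          by (rule evidence_total_mono[OF \<gamma>0m]) (auto simp: G_def)
        finally show ?thesis .
      qed
      have "total_evidence (far \<epsilon>) D \<le> X D"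
        unfolding total_evidence_def X_def I1 mult_1_right
      proof (intro sum_mono mult_left_mono)
        fix \<gamma> assume \<gamma>: "\<gamma> \<in> models"
        interpret P: regression_prior \<nu> m "lin_param {1..K} \<beta>" "prior \<gamma>" "lin_param \<gamma>"
          by (rule regression_prior_model[OF \<gamma>])
        have "section_of (far \<epsilon>) \<gamma> \<subseteq> U \<gamma> \<union> W \<gamma>" unfolding U_def W_def section_of_def by (auto simp: not_le)
        then have "ev \<gamma> (section_of (far \<epsilon>) \<gamma>) D \<le> ev \<gamma> (U \<gamma> \<union> W \<gamma>) D" by (rule P.evidence_mono)
        also have "\<dots> \<le> ev \<gamma> (U \<gamma>) D + ev \<gamma> (W \<gamma>) D"
          by (rule P.evidence_Un[OF D U_sets[OF \<gamma>] W_sets[OF \<gamma>]])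
        finally show "ev \<gamma> (section_of (far \<epsilon>) \<gamma>) D \<le> ev \<gamma> (U \<gamma>) D + ev \<gamma> (W \<gamma>) D" .
      qed simp
      also have "X D = ennreal (1 / (\<delta> * w)) * X D * ennreal (\<delta> * w)"
      proof -
        have "ennreal (1 / (\<delta> * w)) * ennreal (\<delta> * w) = 1"
          using \<delta> w0 by (simp add: ennreal_mult[symmetric])
        then have "ennreal (1 / (\<delta> * w)) * ennreal (\<delta> * w) * X D = X D" by simp
        then show ?thesis by (simp only: mult_ac)
      qed
      also have "\<dots> \<le> ennreal (1 / (\<delta> * w)) * X D * total_evidence UNIV D"
        by (intro mult_left_mono big) simp
      finally have "total_evidence (far \<epsilon>) D \<le> ennreal (1 / (\<delta> * w)) * X D * total_evidence UNIV D" .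
      moreover have "0 < total_evidence UNIV D" using big \<delta> w0 by (intro less_le_trans[OF _ big]) simp
      ultimately have "?p \<le> ennreal (1 / (\<delta> * w)) * X D"
        by (intro divide_le_posI_ennreal) (auto simp: mult_ac)
      then have "ennreal (posterior_prob m K r rbar V n D (far \<epsilon>)) \<le> ennreal (1 / (\<delta> * w)) * X D"
        using post by (rule order.trans[rotated])
      then show ?thesis by (simp add: add_increasing)
    qed
  qed
  have test_sets: "?test \<in> sets (data n)"
  proof (intro sets.sets_Collect_finite_Ex TT_fin)
    fix c assume "c \<in> TT"
    then have [measurable]: "c \<in> borel_measurable \<nu>" by (rule TT_meas)
    show "{D \<in> space (data n). 1 \<le> lik c n D} \<in> sets (data n)" by measurable
  qed
  have small_sets: "?small \<in> sets (data n)"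
  proof -
    note [measurable] = P0.evidence_measurable[OF G_sets]
    show ?thesis by measurable
  qed
  have I_meas: "?I \<in> borel_measurable (data n)"
  proof (rule borel_measurable_indicator')
    have "{D \<in> space (data n). \<forall>c\<in>TT. lik c n D < 1} \<in> sets (data n)"
    proof (intro sets.sets_Collect_finite_All TT_fin)
      fix c assume "c \<in> TT"
      then have [measurable]: "c \<in> borel_measurable \<nu>" by (rule TT_meas)
      show "{D \<in> space (data n). lik c n D < 1} \<in> sets (data n)" by measurable
    qed
    then show "{D \<in> space (data n). D \<in> {D. \<forall>c\<in>TT. lik c n D < 1}} \<in> sets (data n)" by simp
  qed
  have evU: "ev \<gamma> (U \<gamma>) \<in> borel_measurable (data n)" and evW: "ev \<gamma> (W \<gamma>) \<in> borel_measurable (data n)"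
    if \<gamma>: "\<gamma> \<in> models" for \<gamma>
  proof -
    interpret P: regression_prior \<nu> m "lin_param {1..K} \<beta>" "prior \<gamma>" "lin_param \<gamma>"
      by (rule regression_prior_model[OF \<gamma>])
    show "ev \<gamma> (U \<gamma>) \<in> borel_measurable (data n)" "ev \<gamma> (W \<gamma>) \<in> borel_measurable (data n)"
      using P.evidence_measurable U_sets[OF \<gamma>] W_sets[OF \<gamma>] by auto
  qed
  have X_meas: "X \<in> borel_measurable (data n)"
    unfolding X_def[abs_def] using evU evW I_meas
    by (intro borel_measurable_sum borel_measurable_times_ennreal borel_measurable_add borel_measurable_const) auto
  let ?a = "1 - \<epsilon>\<^sup>2 / 2 + \<kappa>" and ?s = "exp (- C\<^sup>2 / (4 * t))"
  have one_model: "(\<integral>\<^sup>+D. ev \<gamma> (U \<gamma>) D * ?I D + ev \<gamma> (W \<gamma>) D \<partial>data n) \<le> ennreal ((?a ^ n + ?s) * (2 * t) ^ rbar)"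
    if \<gamma>: "\<gamma> \<in> models" for \<gamma>
  proof -
    interpret P: regression_prior \<nu> m "lin_param {1..K} \<beta>" "prior \<gamma>" "lin_param \<gamma>"
      by (rule regression_prior_model[OF \<gamma>])
    interpret B: bounded_covariance \<gamma> "V \<gamma>" t by (rule bounded_covariance_model[OF \<gamma>])
    have pw: "(2 * t) ^ card \<gamma> \<le> (2 * t) ^ rbar" using t modelsD(3)[OF \<gamma>] by (intro power_increasing) auto
    have "(\<integral>\<^sup>+D. ev \<gamma> (U \<gamma>) D * ?I D \<partial>data n) \<le> ennreal (?a ^ n) * emeasure (prior \<gamma>) (U \<gamma>)"
    proof (rule P.expected_untested_evidence[OF U_sets[OF \<gamma>] TT_fin TT_meas TT_far _ \<kappa>])
      fix b assume b: "b \<in> U \<gamma>"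
      from T(4)[OF \<gamma> b] obtain c where c: "c \<in> T \<gamma>" "\<forall>j\<in>\<gamma>. \<bar>b j - c j\<bar> \<le> \<eta>" by blast
      have cU: "c \<in> U \<gamma>" using T(1)[OF \<gamma>] c by auto
      have "AE x in \<nu>. chi_square m (lin_param \<gamma> b x) (lin_param \<gamma> c x) \<le> ennreal (\<kappa>\<^sup>2)"
        using regressor_le
      proof eventually_elim
        case (elim x)
        show ?case
        proof (rule close)
          show "\<bar>lin_param \<gamma> b x\<bar> \<le> real rbar * C" "\<bar>lin_param \<gamma> c x\<bar> \<le> real rbar * C"
            using b cU C by (auto intro!: lin_param_bound[OF \<gamma> elim] simp: U_def)
          show "\<bar>lin_param \<gamma> b x - lin_param \<gamma> c x\<bar> \<le> real rbar * \<eta>"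
            unfolding lin_param_diff using c(2) \<eta> by (intro lin_param_bound[OF \<gamma> elim]) auto
        qed
      qed
      moreover have "lin_param \<gamma> c \<in> TT" unfolding TT_def using \<gamma> c by blast
      ultimately show "\<exists>c\<in>TT. AE x in \<nu>. chi_square m (lin_param \<gamma> b x) (c x) \<le> ennreal (\<kappa>\<^sup>2)" by blast
    qed (use e1 in auto)
    also have "\<dots> \<le> ennreal (?a ^ n) * ennreal ((2 * t) ^ rbar)"
    proof (intro mult_left_mono)
      have "emeasure (prior \<gamma>) (U \<gamma>) \<le> emeasure (prior \<gamma>) (space (prior \<gamma>))" by (rule emeasure_space)
      also have "\<dots> \<le> ennreal ((2 * t) ^ card \<gamma>)" by (rule B.coef_prior_total)
      also have "\<dots> \<le> ennreal ((2 * t) ^ rbar)" using pw by (rule ennreal_leI)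
      finally show "emeasure (prior \<gamma>) (U \<gamma>) \<le> ennreal ((2 * t) ^ rbar)" .
    qed simp
    finally have 1: "(\<integral>\<^sup>+D. ev \<gamma> (U \<gamma>) D * ?I D \<partial>data n) \<le> ennreal (?a ^ n) * ennreal ((2 * t) ^ rbar)" .
    have "(\<integral>\<^sup>+D. ev \<gamma> (W \<gamma>) D \<partial>data n) = emeasure (prior \<gamma>) (W \<gamma>)"
      by (rule P.expected_evidence[OF W_sets[OF \<gamma>]])
    also have "\<dots> \<le> ennreal ((2 * t) ^ card \<gamma> * ?s)" unfolding W_def by (rule B.coef_prior_tail[OF C])
    also have "\<dots> \<le> ennreal (?s * (2 * t) ^ rbar)" using pw by (intro ennreal_leI) (simp add: mult.commute)
    finally have 2: "(\<integral>\<^sup>+D. ev \<gamma> (W \<gamma>) D \<partial>data n) \<le> ennreal (?s * (2 * t) ^ rbar)" .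
    have "(\<integral>\<^sup>+D. ev \<gamma> (U \<gamma>) D * ?I D + ev \<gamma> (W \<gamma>) D \<partial>data n) =
        (\<integral>\<^sup>+D. ev \<gamma> (U \<gamma>) D * ?I D \<partial>data n) + (\<integral>\<^sup>+D. ev \<gamma> (W \<gamma>) D \<partial>data n)"
      using evU[OF \<gamma>] evW[OF \<gamma>] I_meas by (intro nn_integral_add borel_measurable_times_ennreal)
    also have "\<dots> \<le> ennreal (?a ^ n) * ennreal ((2 * t) ^ rbar) + ennreal (?s * (2 * t) ^ rbar)"
      by (intro add_mono 1 2)
    also have "\<dots> = ennreal ((?a ^ n + ?s) * (2 * t) ^ rbar)"
      using e1 \<kappa> t0 by (simp add: ennreal_mult[symmetric] ennreal_plus[symmetric] distrib_right del: ennreal_plus)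
    finally show ?thesis .
  qed
  let ?Y = "(?a ^ n + ?s) * (2 * t) ^ rbar"
  have Y0: "0 \<le> ?Y" using e1 \<kappa> t0 by (intro mult_nonneg_nonneg add_nonneg_nonneg zero_le_power) auto
  have intX: "(\<integral>\<^sup>+D. X D \<partial>data n) \<le> ennreal ?Y"
  proof -
    have "(\<integral>\<^sup>+D. X D \<partial>data n) = (\<Sum>\<gamma>\<in>models. \<integral>\<^sup>+D. ennreal (wt \<gamma>) * (ev \<gamma> (U \<gamma>) D * ?I D + ev \<gamma> (W \<gamma>) D) \<partial>data n)"
      unfolding X_def using evU evW I_meas
      by (intro nn_integral_sum borel_measurable_times_ennreal borel_measurable_add borel_measurable_const) auto
    also have "\<dots> = (\<Sum>\<gamma>\<in>models. ennreal (wt \<gamma>) * (\<integral>\<^sup>+D. ev \<gamma> (U \<gamma>) D * ?I D + ev \<gamma> (W \<gamma>) D \<partial>data n))"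
      using evU evW I_meas
      by (intro sum.cong refl nn_integral_cmult borel_measurable_times_ennreal borel_measurable_add) auto
    also have "\<dots> \<le> (\<Sum>\<gamma>\<in>models. ennreal (wt \<gamma>) * ennreal ?Y)"
      by (intro sum_mono mult_left_mono one_model) auto
    also have "\<dots> = ennreal ((\<Sum>\<gamma>\<in>models. wt \<gamma>) * ?Y)"
      using Y0 wt_nonneg by (simp add: sum_distrib_right[symmetric] sum_ennreal ennreal_mult sum_nonneg)
    also have "\<dots> \<le> ennreal (1 * ?Y)" using sum_wt_le Y0 by (intro ennreal_leI mult_right_mono)
    finally show ?thesis by simp
  qed
  have "(\<integral>\<^sup>+D. ennreal (posterior_prob m K r rbar V n D (far \<epsilon>)) \<partial>data n) \<le>
      (\<integral>\<^sup>+D. indicator ?test D + indicator ?small D + ennreal (1 / (\<delta> * w)) * X D \<partial>data n)"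
    by (intro nn_integral_mono pointwise)
  also have "\<dots> = emeasure (data n) ?test + emeasure (data n) ?small + ennreal (1 / (\<delta> * w)) * (\<integral>\<^sup>+D. X D \<partial>data n)"
    using test_sets small_sets X_meas by (simp add: nn_integral_add nn_integral_cmult)
  also have "\<dots> \<le> ennreal ((real K + 1) ^ rbar * ?N ^ rbar * (1 - \<epsilon>\<^sup>2 / 2) ^ n) + ennreal (\<delta> * (1 + q) ^ n)
      + ennreal (1 / (\<delta> * w)) * ennreal ?Y"
  proof (intro add_mono mult_left_mono intX)
    have "emeasure (data n) ?test \<le> ennreal (real (card TT) * (1 - \<epsilon>\<^sup>2 / 2) ^ n)"
      using e1 by (intro test_error TT_fin TT_meas TT_far) auto
    also have "\<dots> \<le> ennreal ((real K + 1) ^ rbar * ?N ^ rbar * (1 - \<epsilon>\<^sup>2 / 2) ^ n)"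
      using TT_card e1 by (intro ennreal_leI mult_right_mono) auto
    finally show "emeasure (data n) ?test \<le> ennreal ((real K + 1) ^ rbar * ?N ^ rbar * (1 - \<epsilon>\<^sup>2 / 2) ^ n)" .
    show "emeasure (data n) ?small \<le> ennreal (\<delta> * (1 + q) ^ n)"
    proof (rule P0.small_evidence[OF G_sets g_eq g0 q \<delta>])
      fix b assume b: "b \<in> G"
      show "AE x in \<nu>. chi_square m (lin_param {1..K} \<beta> x) (lin_param \<gamma>\<^sub>0 b x) \<le> ennreal q"
        using regressor_le
      proof eventually_elim
        case (elim x)
        let ?h = "lin_param {1..K} \<beta> x" and ?h' = "lin_param \<gamma>\<^sub>0 b x"
        have x1: "\<bar>x j * c\<bar> \<le> \<bar>c\<bar>" if "j \<in> {1..K}" for j c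
          unfolding abs_mult using elim that mult_right_mono[of "\<bar>x j\<bar>" 1 "\<bar>c\<bar>"] by auto
        have "\<bar>?h\<bar> \<le> (\<Sum>j=1..K. \<bar>\<beta> j\<bar>)" unfolding lin_param_def
          by (rule order.trans[OF sum_abs]) (intro sum_mono x1)
        then have h: "\<bar>?h\<bar> \<le> M" using M \<zeta> by (smt (verit) mult_nonneg_nonneg of_nat_0_le_iff)
        have b\<beta>: "\<bar>b j - \<beta> j\<bar> \<le> \<zeta>" if "j \<in> \<gamma>\<^sub>0" for j using b that unfolding G_def by auto
        have "\<bar>?h'\<bar> \<le> (\<Sum>j\<in>\<gamma>\<^sub>0. \<bar>\<beta> j\<bar> + \<zeta>)" unfolding lin_param_def
        proof (rule order.trans[OF sum_abs], intro sum_mono)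
          fix j assume j: "j \<in> \<gamma>\<^sub>0"
          then have "\<bar>x j * b j\<bar> \<le> \<bar>b j\<bar>" using \<gamma>0 by (intro x1) auto
          then show "\<bar>x j * b j\<bar> \<le> \<bar>\<beta> j\<bar> + \<zeta>" using b\<beta>[OF j] by linarith
        qed
        also have "\<dots> \<le> M" using sub\<beta> M \<gamma>0 by (simp add: sum.distrib)
        finally have h': "\<bar>?h'\<bar> \<le> M" .
        have split: "{1..K} = \<gamma>\<^sub>0 \<union> ({1..K} - \<gamma>\<^sub>0)" using \<gamma>0 by auto
        have "?h = (\<Sum>j\<in>\<gamma>\<^sub>0. x j * \<beta> j) + (\<Sum>j\<in>{1..K} - \<gamma>\<^sub>0. x j * \<beta> j)"
          unfolding lin_param_def using \<gamma>0 by (subst split, subst sum.union_disjoint) (auto intro: B0.finite)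
        then have "?h - ?h' = (\<Sum>j\<in>\<gamma>\<^sub>0. x j * (\<beta> j - b j)) + (\<Sum>j\<in>{1..K} - \<gamma>\<^sub>0. x j * \<beta> j)"
          unfolding lin_param_def by (simp add: sum_subtractf right_diff_distrib)
        then have "\<bar>?h - ?h'\<bar> \<le> \<bar>\<Sum>j\<in>\<gamma>\<^sub>0. x j * (\<beta> j - b j)\<bar> + \<bar>\<Sum>j\<in>{1..K} - \<gamma>\<^sub>0. x j * \<beta> j\<bar>" by simp
        also have "\<dots> \<le> (\<Sum>j\<in>\<gamma>\<^sub>0. \<zeta>) + (\<Sum>j\<in>{1..K} - \<gamma>\<^sub>0. \<bar>\<beta> j\<bar>)"
        proof (intro add_mono order.trans[OF sum_abs] sum_mono)
          fix j assume j: "j \<in> \<gamma>\<^sub>0"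
          then have "\<bar>x j * (\<beta> j - b j)\<bar> \<le> \<bar>\<beta> j - b j\<bar>" using \<gamma>0 by (intro x1) auto
          then show "\<bar>x j * (\<beta> j - b j)\<bar> \<le> \<zeta>" using b\<beta>[OF j] by (simp add: abs_minus_commute)
        qed (auto intro: x1)
        also have "\<dots> \<le> \<omega>" using \<omega> \<gamma>0 by simp
        finally show ?case by (intro near h h')
      qed
    qed
  qed simp
  also have "\<dots> = ennreal ((real K + 1) ^ rbar * ?N ^ rbar * (1 - \<epsilon>\<^sup>2 / 2) ^ n + \<delta> * (1 + q) ^ n + ?Y / (\<delta> * w))"
  proof -
    have "0 \<le> (real K + 1) ^ rbar * ?N ^ rbar * (1 - \<epsilon>\<^sup>2 / 2) ^ n" using N1 e1 by simp
    moreover have "0 \<le> \<delta> * (1 + q) ^ n" using \<delta> q by simp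
    moreover have "0 \<le> 1 / (\<delta> * w)" using \<delta> w0 by simp
    ultimately show ?thesis
      using Y0 by (simp add: ennreal_mult[symmetric] ennreal_plus[symmetric] del: ennreal_plus)
  qed
  finally show ?thesis .
qed

text \<open>The two posterior probabilities add up to one unless the total evidence is zero or infinite. It is
  never zero, and it is almost surely finite since its expectation is.\<close>

lemma posterior_near_complement:
  shows "AE D in data n. posterior_prob m K r rbar V n D {(\<gamma>, b). hellinger m K \<beta> \<nu> \<gamma> b \<le> \<epsilon>} =
    1 - posterior_prob m K r rbar V n D (far \<epsilon>)"
proof -
  let ?near = "{(\<gamma>, b). hellinger m K \<beta> \<nu> \<gamma> b \<le> \<epsilon>}"
  have near: "measurable_event ?near" by (rule measurable_event_hellinger) simp
  note [measurable] = total_evidence_measurable[OF measurable_event_UNIV]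
  have split: "total_evidence UNIV D = total_evidence ?near D + total_evidence (far \<epsilon>) D"
    if D: "D \<in> space (data n)" for D
    unfolding total_evidence_def sum.distrib[symmetric] distrib_left[symmetric]
  proof (intro sum.cong refl arg_cong2[where f = "(*)"])
    fix \<gamma> assume \<gamma>: "\<gamma> \<in> models"
    interpret P: regression_prior \<nu> m "lin_param {1..K} \<beta>" "prior \<gamma>" "lin_param \<gamma>"
      by (rule regression_prior_model[OF \<gamma>])
    have "section_of UNIV \<gamma> = section_of ?near \<gamma> \<union> section_of (far \<epsilon>) \<gamma>"
      unfolding section_of_def far_def by auto
    moreover have "section_of ?near \<gamma> \<inter> section_of (far \<epsilon>) \<gamma> = {}" unfolding section_of_def far_def by auto
    ultimately show "ev \<gamma> (section_of UNIV \<gamma>) D = ev \<gamma> (section_of ?near \<gamma>) D + ev \<gamma> (section_of (far \<epsilon>) \<gamma>) D"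
      using near measurable_event_far[of \<epsilon>] \<gamma> P.evidence_disjoint_Un[OF D]
      unfolding measurable_event_def by metis
  qed
  have finite: "AE D in data n. total_evidence UNIV D \<noteq> \<infinity>"
  proof (rule nn_integral_PInf_AE)
    have ev_meas: "ev \<gamma> (section_of UNIV \<gamma>) \<in> borel_measurable (data n)" and
      ev_le: "(\<integral>\<^sup>+D. ev \<gamma> (section_of UNIV \<gamma>) D \<partial>data n) \<le> ennreal ((2 * t) ^ card \<gamma>)" if \<gamma>: "\<gamma> \<in> models" for \<gamma>
    proof -
      interpret P: regression_prior \<nu> m "lin_param {1..K} \<beta>" "prior \<gamma>" "lin_param \<gamma>"
        by (rule regression_prior_model[OF \<gamma>])
      interpret B: bounded_covariance \<gamma> "V \<gamma>" t by (rule bounded_covariance_model[OF \<gamma>])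
      have sp: "section_of UNIV \<gamma> = space (prior \<gamma>)" unfolding section_of_def by simp
      show "ev \<gamma> (section_of UNIV \<gamma>) \<in> borel_measurable (data n)"
        unfolding sp by (rule P.evidence_measurable) simp
      show "(\<integral>\<^sup>+D. ev \<gamma> (section_of UNIV \<gamma>) D \<partial>data n) \<le> ennreal ((2 * t) ^ card \<gamma>)"
        unfolding sp by (subst P.expected_evidence) (use B.coef_prior_total in auto)
    qed
    have "(\<integral>\<^sup>+D. total_evidence UNIV D \<partial>data n) =
        (\<Sum>\<gamma>\<in>models. ennreal (wt \<gamma>) * (\<integral>\<^sup>+D. ev \<gamma> (section_of UNIV \<gamma>) D \<partial>data n))"
      unfolding total_evidence_def using ev_meas
      by (subst nn_integral_sum) (auto intro!: sum.cong nn_integral_cmult)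
    also have "\<dots> \<le> (\<Sum>\<gamma>\<in>models. ennreal (wt \<gamma>) * ennreal ((2 * t) ^ card \<gamma>))"
      by (intro sum_mono mult_left_mono ev_le) auto
    also have "\<dots> < \<infinity>" by (simp add: ennreal_mult_less_top)
    finally show "(\<integral>\<^sup>+D. total_evidence UNIV D \<partial>data n) \<noteq> \<infinity>" by simp
    show "total_evidence UNIV \<in> borel_measurable (data n)"
      by (rule total_evidence_measurable[OF measurable_event_UNIV])
  qed
  have pos: "total_evidence UNIV D \<noteq> 0" if D: "D \<in> space (data n)" for D
  proof -
    obtain \<gamma> where \<gamma>: "\<gamma> \<subseteq> {1..K}" "card \<gamma> = r"
      using obtain_subset_with_card_n[of r "{1..K}"] sizes by auto
    have \<gamma>m: "\<gamma> \<in> models" using \<gamma> sizes unfolding models_def by simp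
    interpret P: regression_prior \<nu> m "lin_param {1..K} \<beta>" "prior \<gamma>" "lin_param \<gamma>"
      by (rule regression_prior_model[OF \<gamma>m])
    interpret B: bounded_covariance \<gamma> "V \<gamma>" t by (rule bounded_covariance_model[OF \<gamma>m])
    have "0 < (1 / real K) ^ r * exp (- real r)" using sizes by simp
    also have "\<dots> \<le> wt \<gamma>" using sizes \<gamma> by (intro model_prior_ge) auto
    finally have wt: "0 < wt \<gamma>" .
    have "0 < ennreal ((1 / (2 * t)) ^ card \<gamma> * exp (- t * (real (card \<gamma>))\<^sup>2 / 2))" using t by simp
    also have "\<dots> \<le> emeasure (prior \<gamma>) {b \<in> space (prior \<gamma>). \<forall>j\<in>\<gamma>. \<bar>b j - 0\<bar> \<le> 1}"
      using B.coef_prior_box[of 1 "\<lambda>_. 0" "real (card \<gamma>)"] by simp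
    also have "\<dots> \<le> emeasure (prior \<gamma>) (space (prior \<gamma>))" by (rule emeasure_space)
    finally have "0 < ev \<gamma> (space (prior \<gamma>)) D" by (intro P.evidence_pos[OF D])
    then have "0 < ennreal (wt \<gamma>) * ev \<gamma> (space (prior \<gamma>)) D" using wt by (simp add: ennreal_zero_less_mult_iff)
    also have "\<dots> \<le> total_evidence UNIV D" by (rule evidence_total_mono[OF \<gamma>m]) simp
    finally show ?thesis by simp
  qed
  show ?thesis using finite AE_space
  proof eventually_elim
    case (elim D)
    let ?a = "total_evidence ?near D" and ?b = "total_evidence (far \<epsilon>) D"
    have s: "total_evidence UNIV D = ?a + ?b" by (rule split[OF elim(2)])
    have fin: "?a \<noteq> \<infinity>" "?b \<noteq> \<infinity>" using elim(1) unfolding s by auto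
    obtain a b where ab: "?a = ennreal a" "0 \<le> a" "?b = ennreal b" "0 \<le> b"
      using fin by (metis ennreal_cases infinity_ennreal_def)
    have "a + b \<noteq> 0" using pos[OF elim(2)] unfolding s ab using ab by (auto simp: add_nonneg_eq_0_iff)
    then have ab0: "0 < a + b" using ab by simp
    have u: "total_evidence UNIV D = ennreal (a + b)" unfolding s ab using ab by simp
    have quot: "enn2real (ennreal c / ennreal (a + b)) = c / (a + b)" if "0 \<le> c" for c
      using that ab0 by (simp add: divide_ennreal)
    show ?case
      unfolding posterior_prob_eq[OF near elim(2)] posterior_prob_eq[OF measurable_event_far elim(2)] u ab(1,3)
        quot[OF ab(2)] quot[OF ab(4)]
      using ab0 by (simp add: field_simps)
  qed
qed

end

section \<open>Rates\<close>

lemma one_minus_power_le_exp: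
  assumes "x \<le> 1"
  shows "(1 - x) ^ n \<le> exp (- real n * x)"
proof -
  have "(1 - x) ^ n \<le> exp (- x) ^ n" using assms exp_ge_add_one_self[of "- x"] by (intro power_mono) auto
  also have "\<dots> = exp (- real n * x)" by (simp add: exp_of_nat_mult[symmetric])
  finally show ?thesis .
qed

lemma power_eq_exp_ln: "0 < x \<Longrightarrow> x ^ k = exp (real k * ln x)"
  by (simp add: exp_of_nat_mult)

lemma tail_sum_attained:
  assumes "r \<le> K"
  obtains \<gamma> where "\<gamma> \<subseteq> {1..K}" "card \<gamma> = r" "(\<Sum>j\<in>{1..K} - \<gamma>. \<bar>bs j\<bar>) = tail_sum K bs r"
proof -
  let ?S = "{\<gamma>. \<gamma> \<subseteq> {1..K} \<and> card \<gamma> = r}" and ?f = "\<lambda>\<gamma>. \<Sum>j\<in>{1..K} - \<gamma>. \<bar>bs j\<bar>"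
  have fin: "finite ?S" by (rule finite_subset[of _ "Pow {1..K}"]) auto
  obtain \<gamma>' where "\<gamma>' \<subseteq> {1..K}" "card \<gamma>' = r" using obtain_subset_with_card_n[of r "{1..K}"] assms by auto
  then have ne: "?S \<noteq> {}" by auto
  have "tail_sum K bs r = Min (?f ` ?S)"
    unfolding tail_sum_def using fin ne by (intro cInf_eq_Min) auto
  moreover have "Min (?f ` ?S) \<in> ?f ` ?S" using fin ne by (intro Min_in) auto
  ultimately show thesis using that by auto
qed

context selection_model
begin

text \<open>The number \<open>L = ln K\<close> is the unit in which logarithms are measured: \<open>rbar\<close>, \<open>r\<close>, \<open>n\<close>, \<open>1 / \<epsilon>\<^sup>2\<close> and \<open>t\<close>
  are at most fixed powers of \<open>K\<close>, and \<open>K\<close> exceeds all constants. The size of the net and the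
  inverse prior mass are then exponentials of multiples of \<open>rbar L\<close>, with two exceptions: the
  Gaussian exponent of the box, a multiple of \<open>rbar powr v\<close>, and the growth of the divergence in
  Poisson regression.\<close>

lemma posterior_far_exponential:
  fixes \<epsilon> B v p c M :: real
  defines "s \<equiv> real n * \<epsilon>\<^sup>2" and "L \<equiv> ln (real K)"
  assumes \<epsilon>: "0 < \<epsilon>" "\<epsilon> \<le> 1" and s1: "1 \<le> real n * \<epsilon>\<^sup>2"
    and B: "1 \<le> B" and v: "0 \<le> v" and teq: "t = B * real rbar powr v"
    and c: "1 \<le> c"
    and chi: "\<And>H h h' d. 0 \<le> H \<Longrightarrow> \<bar>h\<bar> \<le> H \<Longrightarrow> \<bar>h'\<bar> \<le> H \<Longrightarrow> \<bar>h - h'\<bar> \<le> d \<Longrightarrow>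
       c * chi_growth m H * d \<le> 1 \<Longrightarrow> chi_square m h h' \<le> ennreal ((c * chi_growth m H * d)\<^sup>2)"
    and M: "(\<Sum>j=1..K. \<bar>\<beta> j\<bar>) + 1 \<le> M"
    and tail: "tail_sum K \<beta> r \<le> \<epsilon>\<^sup>2 / (128 * c * chi_growth m M)"
    and L1: "1 \<le> L" and nK: "ln (real n) \<le> p * L" and p: "0 \<le> p"
    and large: "ln (11 * c) \<le> L" "ln (2 * B) \<le> L" "ln (256 * B * c * chi_growth m M) \<le> L"
    and prior_budget: "(6 + 2 * v + p) * (real rbar * L) + (M\<^sup>2 * B / 2) * real rbar powr v \<le> s / 16"
    and cover_budget: "(9 + 2 * v + 3 * p) * (real rbar * L)
        + (if m = Poisson then (real rbar)\<^sup>2 * sqrt (t * s) else 0) \<le> s / 4"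
  shows "(\<integral>\<^sup>+D. ennreal (posterior_prob m K r rbar V n D (far \<epsilon>)) \<partial>data n) \<le> ennreal (4 * exp (- s / 16))"
proof -
  have s1: "1 \<le> s" using s1 unfolding s_def .
  have e1: "\<epsilon>\<^sup>2 \<le> 1" using \<epsilon> by (simp add: power_le_one)
  have e0: "0 < \<epsilon>\<^sup>2" using \<epsilon> by simp
  have n0: "0 < real n" using s1 unfolding s_def by (cases n) auto
  have sn: "s \<le> real n" unfolding s_def using e1 by (simp add: mult_left_le)
  have rb: "1 \<le> real r" "real r \<le> real rbar" "1 \<le> real rbar" "real rbar \<le> real K" using sizes by auto
  have K0: "0 < real K" using rb by simp
  have lnr: "ln (real r) \<le> L" "ln (real rbar) \<le> L" unfolding L_def using rb by auto
  have inv: "1 / \<epsilon>\<^sup>2 \<le> real n" using s1 e0 unfolding s_def by (simp add: field_simps)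
  have ln_inv: "ln (1 / \<epsilon>\<^sup>2) \<le> p * L"
    using inv nK e0 n0 by (intro order.trans[OF _ nK]) (subst ln_le_cancel_iff, auto)
  have t1: "1 \<le> t" by (rule t)
  have ln2t: "ln (2 * t) \<le> L + v * L"
  proof -
    have "ln (2 * t) = ln (2 * B) + v * ln (real rbar)"
      unfolding teq using B rb by (simp add: ln_mult ln_powr)
    then show ?thesis using large(2) mult_left_mono[OF lnr(2) v] by linarith
  qed
  have lnt: "ln t \<le> L + v * L" using ln2t t1 by (smt (verit) ln_le_cancel_iff)
  \<comment> \<open>This makes the prior mass of coefficients beyond \<open>C\<close> of order \<open>exp (- s / 4)\<close>.\<close>
  define C where "C = sqrt (t * s)"
  have ts: "1 \<le> t * s" using mult_mono[OF t1 s1] t1 by simp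
  have C1: "1 \<le> C" unfolding C_def using ts by simp
  have C2: "C\<^sup>2 = t * s" unfolding C_def using ts by simp
  have lnC: "ln C \<le> L + v * L + p * L"
  proof -
    have "C * 1 \<le> C * C" using C1 by (intro mult_left_mono) auto
    then have "C \<le> t * s" using C2 by (simp add: power2_eq_square)
    then have "ln C \<le> ln (t * s)" using C1 ts by (subst ln_le_cancel_iff) auto
    also have "\<dots> = ln t + ln s" using t1 s1 by (simp add: ln_mult)
    also have "ln s \<le> ln (real n)" using sn s1 by simp
    finally show ?thesis using lnt nK by linarith
  qed
  define H where "H = real rbar * C"
  have H1: "1 \<le> H" unfolding H_def using rb(3) C1 mult_mono[of 1 "real rbar" 1 C] by simp
  define Qg where "Qg = chi_growth m H"
  have Q1: "1 \<le> Qg" unfolding Qg_def using H1 by (intro chi_growth_ge_1) simp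
  have lnQ: "ln Qg \<le> L + (L + ln C) + (if m = Poisson then H else 0)"
  proof (cases "m = Poisson")
    case True
    have "0 \<le> L + (L + ln C)" using L1 C1 by simp
    then show ?thesis using True unfolding Qg_def chi_growth_def by simp
  next
    case False
    have "Qg \<le> 2 * H" unfolding Qg_def chi_growth_def using False H1 by simp
    then have "ln Qg \<le> ln (2 * H)" using Q1 H1 by (subst ln_le_cancel_iff) auto
    also have "\<dots> = ln 2 + (ln (real rbar) + ln C)" unfolding H_def using rb C1 by (simp add: ln_mult)
    finally show ?thesis using False lnr L1 ln_2_less_1 by simp
  qed
  \<comment> \<open>The mesh for which the root of the divergence within a cell is at most \<open>\<epsilon>\<^sup>2 / 4\<close>, half of the gain
    \<open>\<epsilon>\<^sup>2 / 2\<close> from the distance to the truth.\<close>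
  define \<eta> where "\<eta> = \<epsilon>\<^sup>2 / (4 * c * Qg) / real rbar"
  have \<eta>0: "0 < \<eta>" unfolding \<eta>_def using e0 c Q1 rb by simp
  define M' where "M' = chi_growth m M"
  have "0 \<le> (\<Sum>j=1..K. \<bar>\<beta> j\<bar>)" by (rule sum_nonneg) simp
  then have M1: "1 \<le> M" using M by linarith
  have M'1: "1 \<le> M'" unfolding M'_def using M1 by (intro chi_growth_ge_1) simp
  \<comment> \<open>The distance of linear parameters for which the divergence from the truth is at most \<open>\<epsilon>\<^sup>2 / 64\<close>. One
    half of it is used for the box, the other half for the tail of the true coefficients.\<close>
  define \<omega> where "\<omega> = \<epsilon>\<^sup>2 / (64 * c * M')"
  have \<omega>0: "0 < \<omega>" unfolding \<omega>_def using e0 c M'1 by simp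
  have cM1: "1 \<le> c * M'" using mult_mono[OF c M'1] c by simp
  have \<omega>1: "\<omega> \<le> 1"
  proof -
    have "\<epsilon>\<^sup>2 \<le> 64 * c * M'" using e1 cM1 by (simp add: mult.assoc)
    then show ?thesis unfolding \<omega>_def using c M'1 by (simp add: divide_le_eq_1)
  qed
  define \<zeta> where "\<zeta> = \<omega> / (2 * real r)"
  have \<zeta>0: "0 < \<zeta>" unfolding \<zeta>_def using \<omega>0 rb by simp
  have r\<zeta>: "real r * \<zeta> = \<omega> / 2" unfolding \<zeta>_def using rb by simp
  \<comment> \<open>The exponent has to exceed the \<open>s / 64\<close> lost by the inverse likelihood ratios and to stay below the
    \<open>s / 4 - s / 16\<close> that the far parameters gain after division by the prior mass.\<close>
  define \<delta> where "\<delta> = exp (- s / 8)"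
  define w where "w = (1 / real K) ^ r * exp (- real r) * ((\<zeta> / (2 * t)) ^ r * exp (- t * M\<^sup>2 / 2))"
  have w0: "0 < w" unfolding w_def using K0 \<zeta>0 t1 by simp
  obtain \<gamma>\<^sub>0 where \<gamma>0: "\<gamma>\<^sub>0 \<subseteq> {1..K}" "card \<gamma>\<^sub>0 = r" and tl: "(\<Sum>j\<in>{1..K} - \<gamma>\<^sub>0. \<bar>\<beta> j\<bar>) = tail_sum K \<beta> r"
    using tail_sum_attained[of r K \<beta>] sizes by auto
  have main: "(\<integral>\<^sup>+D. ennreal (posterior_prob m K r rbar V n D (far \<epsilon>)) \<partial>data n) \<le>
    ennreal ((real K + 1) ^ rbar * (2 * C / \<eta> + 3) ^ rbar * (1 - \<epsilon>\<^sup>2 / 2) ^ n + \<delta> * (1 + \<epsilon>\<^sup>2 / 64) ^ n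
      + ((1 - \<epsilon>\<^sup>2 / 2 + \<epsilon>\<^sup>2 / 4) ^ n + exp (- C\<^sup>2 / (4 * t))) * (2 * t) ^ rbar / (\<delta> * w))"
  proof (rule posterior_far_bound[OF \<epsilon> _ \<eta>0 _ _ \<gamma>0 \<zeta>0 _ _ _ _ _ w_def])
    fix h h' :: real
    assume h: "\<bar>h\<bar> \<le> real rbar * C" "\<bar>h'\<bar> \<le> real rbar * C" "\<bar>h - h'\<bar> \<le> real rbar * \<eta>"
    have eq: "c * Qg * (real rbar * \<eta>) = \<epsilon>\<^sup>2 / 4" unfolding \<eta>_def using c Q1 rb by simp
    show "chi_square m h h' \<le> ennreal ((\<epsilon>\<^sup>2 / 4)\<^sup>2)"
      using chi[of H h h' "real rbar * \<eta>"] h H1 e1 eq unfolding Qg_def H_def by simp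
  next
    show "(\<Sum>j=1..K. \<bar>\<beta> j\<bar>) + real r * \<zeta> \<le> M" using M r\<zeta> \<omega>1 by simp
    have "tail_sum K \<beta> r \<le> \<omega> / 2" using tail unfolding \<omega>_def M'_def by simp
    then show "real r * \<zeta> + (\<Sum>j\<in>{1..K} - \<gamma>\<^sub>0. \<bar>\<beta> j\<bar>) \<le> \<omega>" unfolding tl r\<zeta> by simp
  next
    fix h h' :: real
    assume h: "\<bar>h\<bar> \<le> M" "\<bar>h'\<bar> \<le> M" "\<bar>h - h'\<bar> \<le> \<omega>"
    have eq: "c * M' * \<omega> = \<epsilon>\<^sup>2 / 64" unfolding \<omega>_def using c M'1 by simp
    have "chi_square m h h' \<le> ennreal ((\<epsilon>\<^sup>2 / 64)\<^sup>2)"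
      using chi[of M h h' \<omega>] h M1 e1 eq unfolding M'_def by simp
    also have "\<dots> \<le> ennreal (\<epsilon>\<^sup>2 / 64)"
    proof (intro ennreal_leI)
      have "(\<epsilon>\<^sup>2 / 64) * (\<epsilon>\<^sup>2 / 64) \<le> (\<epsilon>\<^sup>2 / 64) * 1" using e0 e1 by (intro mult_left_mono) auto
      then show "(\<epsilon>\<^sup>2 / 64)\<^sup>2 \<le> \<epsilon>\<^sup>2 / 64" by (simp only: power2_eq_square mult_1_right)
    qed
    finally show "chi_square m h h' \<le> ennreal (\<epsilon>\<^sup>2 / 64)" .
  qed (use C1 e0 in \<open>auto simp: \<delta>_def\<close>)
  have cover: "(real K + 1) ^ rbar * (2 * C / \<eta> + 3) ^ rbar \<le> exp (s / 4)"
  proof -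
    have "0 < 2 * C / \<eta> + 3" using C1 \<eta>0 by (simp add: add_pos_pos)
    have lnK1: "ln (real K + 1) \<le> 2 * L"
    proof -
      have "real K + 1 \<le> real K * real K"
      proof -
        have K2: "2 \<le> real K" using rb sizes by simp
        then have "real K * 2 \<le> real K * real K" by (intro mult_left_mono) auto
        then show ?thesis using K2 by linarith
      qed
      then have "ln (real K + 1) \<le> ln (real K * real K)" using K0 by (subst ln_le_cancel_iff) auto
      then show ?thesis unfolding L_def using K0 by (simp add: ln_mult)
    qed
    have lnN: "ln (2 * C / \<eta> + 3) \<le> L + ln Qg + ln (real rbar) + ln C + p * L"
    proof -
      let ?z = "c * Qg * real rbar * C * (1 / \<epsilon>\<^sup>2)"
      have inv1: "1 \<le> 1 / \<epsilon>\<^sup>2" using e0 e1 by simp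
      have "1 * 1 * 1 * 1 * 1 \<le> ?z"
        using c Q1 rb(3) C1 inv1 by (intro mult_mono) auto
      moreover have "2 * C / \<eta> = 8 * ?z" unfolding \<eta>_def using c Q1 rb e0 by (simp add: field_simps)
      moreover have "a + 3 \<le> 11 * z" if "1 * 1 * 1 * 1 * 1 \<le> z" "a = 8 * z" for a z :: real
        using that by simp
      ultimately have "2 * C / \<eta> + 3 \<le> 11 * ?z" by blast
      then have "ln (2 * C / \<eta> + 3) \<le> ln (11 * ?z)"
        using \<open>0 < 2 * C / \<eta> + 3\<close> by (subst ln_le_cancel_iff) auto
      also have "11 * ?z = (11 * c) * (Qg * (real rbar * (C * (1 / \<epsilon>\<^sup>2))))" by (simp only: mult_ac)
      also have "ln \<dots> = ln (11 * c) + (ln Qg + (ln (real rbar) + (ln C + ln (1 / \<epsilon>\<^sup>2))))"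
        using c Q1 rb C1 inv1 by (simp only: ln_mult_pos mult_pos_pos zero_less_numeral less_le_trans[OF zero_less_one])
      finally show ?thesis using large(1) ln_inv by linarith
    qed
    have "(real K + 1) ^ rbar * (2 * C / \<eta> + 3) ^ rbar =
        exp (real rbar * (ln (real K + 1) + ln (2 * C / \<eta> + 3)))"
      using K0 \<open>0 < 2 * C / \<eta> + 3\<close> by (simp add: power_eq_exp_ln mult_exp_exp distrib_left)
    also have "\<dots> \<le> exp (s / 4)"
    proof -
      have "ln (real K + 1) + ln (2 * C / \<eta> + 3) \<le> (9 + 2 * v + 3 * p) * L + (if m = Poisson then H else 0)"
        using lnK1 lnN lnQ lnr lnC L1 by (simp add: distrib_right split del: if_split)
      then have "real rbar * (ln (real K + 1) + ln (2 * C / \<eta> + 3)) \<le>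
          real rbar * ((9 + 2 * v + 3 * p) * L + (if m = Poisson then H else 0))"
        by (intro mult_left_mono) auto
      also have "\<dots> = (9 + 2 * v + 3 * p) * (real rbar * L)
        + (if m = Poisson then (real rbar)\<^sup>2 * sqrt (t * s) else 0)"
        unfolding H_def C_def by (simp add: distrib_left power2_eq_square mult_ac)
      also have "\<dots> \<le> s / 4" by (rule cover_budget)
      finally show ?thesis by simp
    qed
    finally show ?thesis .
  qed
  have prior_mass: "(2 * t) ^ rbar / w \<le> exp (s / 16)"
  proof -
    have z0: "0 < \<zeta> / (2 * t)" using \<zeta>0 t1 by simp
    have lnz: "- ln (\<zeta> / (2 * t)) \<le> 2 * L + v * L + p * L"
    proof -
      have "- ln (\<zeta> / (2 * t)) = ln (2 * t / \<zeta>)" using \<zeta>0 t1 by (simp add: ln_div)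
      also have "2 * t / \<zeta> = (256 * B * c * M') * (real rbar powr v * (real r * (1 / \<epsilon>\<^sup>2)))"
        unfolding \<zeta>_def \<omega>_def teq using c M'1 e0 rb by (simp add: field_simps)
      also have "ln \<dots> = ln (256 * B * c * M') + (ln (real rbar powr v) + (ln (real r) + ln (1 / \<epsilon>\<^sup>2)))"
      proof -
        have "0 < 256 * B * c * M'" "0 < real rbar powr v" "0 < real r" "0 < 1 / \<epsilon>\<^sup>2" using B c M'1 rb e0 by auto
        then show ?thesis by (simp only: ln_mult_pos mult_pos_pos)
      qed
      also have "ln (real rbar powr v) = v * ln (real rbar)" using rb by (simp add: ln_powr)
      finally show ?thesis using large(3) lnr mult_left_mono[OF lnr(2) v] ln_inv unfolding M'_def by linarith
    qed
    have weq: "w = exp (- (real r * (L + 1 - ln (\<zeta> / (2 * t))) + t * M\<^sup>2 / 2))"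
    proof -
      have "(1 / real K) ^ r = exp (- (real r * L))"
        unfolding L_def using K0 by (simp add: power_eq_exp_ln ln_div)
      moreover have "(\<zeta> / (2 * t)) ^ r = exp (real r * ln (\<zeta> / (2 * t)))" by (rule power_eq_exp_ln[OF z0])
      ultimately have "w = exp (- (real r * L)) * exp (- real r) * (exp (real r * ln (\<zeta> / (2 * t))) * exp (- t * M\<^sup>2 / 2))"
        unfolding w_def by (simp only:)
      also have "\<dots> = exp (- (real r * L) + - real r + (real r * ln (\<zeta> / (2 * t)) + - t * M\<^sup>2 / 2))"
        by (simp only: mult_exp_exp)
      finally show ?thesis by (simp add: algebra_simps)
    qed
    have "(2 * t) ^ rbar / w = exp (real rbar * ln (2 * t) + (real r * (L + 1 - ln (\<zeta> / (2 * t))) + t * M\<^sup>2 / 2))"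
    proof -
      have "(2 * t) ^ rbar = exp (real rbar * ln (2 * t))" using t1 by (intro power_eq_exp_ln) simp
      then show ?thesis unfolding weq by (simp only: exp_diff[symmetric] diff_minus_eq_add)
    qed
    also have "\<dots> \<le> exp (s / 16)"
    proof -
      have "real rbar * ln (2 * t) \<le> real rbar * ((1 + v) * L)"
        using ln2t by (intro mult_left_mono) (auto simp: distrib_right)
      moreover have "real r * (L + 1 - ln (\<zeta> / (2 * t))) \<le> real rbar * ((5 + v + p) * L)"
      proof (intro mult_mono)
        show "L + 1 - ln (\<zeta> / (2 * t)) \<le> (5 + v + p) * L" using lnz L1 by (simp add: distrib_right)
        show "0 \<le> L + 1 - ln (\<zeta> / (2 * t))"
        proof -
          have "\<zeta> \<le> 1" unfolding \<zeta>_def using \<omega>1 rb by (simp add: divide_le_eq)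
          then have "\<zeta> / (2 * t) \<le> 1" using t1 by (simp add: divide_le_eq)
          then have "ln (\<zeta> / (2 * t)) \<le> 0" using z0 by (subst ln_le_zero_iff) auto
          then show ?thesis using L1 by simp
        qed
      qed (use rb in auto)
      moreover have "real rbar * ((1 + v) * L) + real rbar * ((5 + v + p) * L) = (6 + 2 * v + p) * (real rbar * L)"
        by (simp add: algebra_simps)
      moreover have "t * M\<^sup>2 / 2 = (M\<^sup>2 * B / 2) * real rbar powr v" unfolding teq by simp
      ultimately have "real rbar * ln (2 * t) + (real r * (L + 1 - ln (\<zeta> / (2 * t))) + t * M\<^sup>2 / 2) \<le> s / 16"
        using prior_budget by linarith
      then show ?thesis by simp
    qed
    finally show ?thesis .
  qed
  have T1: "(real K + 1) ^ rbar * (2 * C / \<eta> + 3) ^ rbar * (1 - \<epsilon>\<^sup>2 / 2) ^ n \<le> exp (- s / 16)"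
  proof -
    have "(real K + 1) ^ rbar * (2 * C / \<eta> + 3) ^ rbar * (1 - \<epsilon>\<^sup>2 / 2) ^ n \<le> exp (s / 4) * exp (- real n * (\<epsilon>\<^sup>2 / 2))"
      using e1 by (intro mult_mono cover one_minus_power_le_exp) auto
    also have "\<dots> = exp (- s / 4)" unfolding s_def by (simp add: mult_exp_exp)
    also have "\<dots> \<le> exp (- s / 16)" using s1 by simp
    finally show ?thesis .
  qed
  have T2: "\<delta> * (1 + \<epsilon>\<^sup>2 / 64) ^ n \<le> exp (- s / 16)"
  proof -
    have "(1 + \<epsilon>\<^sup>2 / 64) ^ n \<le> exp (s / 64)"
      using one_minus_power_le_exp[of "- (\<epsilon>\<^sup>2 / 64)" n] e0 unfolding s_def by simp
    then have "\<delta> * (1 + \<epsilon>\<^sup>2 / 64) ^ n \<le> exp (- s / 8) * exp (s / 64)" unfolding \<delta>_def by (intro mult_left_mono) auto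
    also have "\<dots> \<le> exp (- s / 16)" using s1 by (simp add: mult_exp_exp)
    finally show ?thesis .
  qed
  have T3: "((1 - \<epsilon>\<^sup>2 / 2 + \<epsilon>\<^sup>2 / 4) ^ n + exp (- C\<^sup>2 / (4 * t))) * (2 * t) ^ rbar / (\<delta> * w) \<le> 2 * exp (- s / 16)"
  proof -
    have a: "(1 - \<epsilon>\<^sup>2 / 2 + \<epsilon>\<^sup>2 / 4) ^ n \<le> exp (- s / 4)"
      using one_minus_power_le_exp[of "\<epsilon>\<^sup>2 / 4" n] e1 unfolding s_def by simp
    have "exp (- C\<^sup>2 / (4 * t)) = exp (- s / 4)" unfolding C2 using t1 by simp
    with a have "(1 - \<epsilon>\<^sup>2 / 2 + \<epsilon>\<^sup>2 / 4) ^ n + exp (- C\<^sup>2 / (4 * t)) \<le> 2 * exp (- s / 4)" by linarith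
    then have "((1 - \<epsilon>\<^sup>2 / 2 + \<epsilon>\<^sup>2 / 4) ^ n + exp (- C\<^sup>2 / (4 * t))) * ((2 * t) ^ rbar / w) / \<delta>
        \<le> 2 * exp (- s / 4) * exp (s / 16) / exp (- s / 8)"
      unfolding \<delta>_def using prior_mass t1 w0 by (intro divide_right_mono mult_mono) auto
    also have "\<dots> = 2 * (exp (- s / 4) * exp (s / 16) / exp (- s / 8))" by simp
    also have "exp (- s / 4) * exp (s / 16) / exp (- s / 8) = exp (- s / 4 + s / 16 - (- s / 8))"
      by (simp only: mult_exp_exp exp_diff)
    also have "- s / 4 + s / 16 - (- s / 8) = - s / 16" by simp
    finally show ?thesis by (simp add: mult.commute)
  qed
  have "(real K + 1) ^ rbar * (2 * C / \<eta> + 3) ^ rbar * (1 - \<epsilon>\<^sup>2 / 2) ^ n + \<delta> * (1 + \<epsilon>\<^sup>2 / 64) ^ n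
      + ((1 - \<epsilon>\<^sup>2 / 2 + \<epsilon>\<^sup>2 / 4) ^ n + exp (- C\<^sup>2 / (4 * t))) * (2 * t) ^ rbar / (\<delta> * w) \<le> 4 * exp (- s / 16)"
    using T1 T2 T3 by linarith
  then show ?thesis by (intro order.trans[OF main] ennreal_leI)
qed

end

text \<open>The relation \<open>1 \<prec> b\<close> says that \<open>b\<close> exceeds every constant.\<close>

lemma le_of_one_le_scaled:
  fixes X y :: real
  assumes "1 \<le> (1 / (\<bar>X\<bar> + 1)) * y"
  shows "X \<le> y"
proof -
  have d: "0 < \<bar>X\<bar> + 1" by simp
  have "(\<bar>X\<bar> + 1) * 1 \<le> (\<bar>X\<bar> + 1) * ((1 / (\<bar>X\<bar> + 1)) * y)" using assms d by (intro mult_left_mono) auto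
  also have "\<dots> = y" using d by simp
  finally show ?thesis by simp
qed

lemma prec_eventually_le:
  assumes "prec a b" and pos: "\<And>n. n \<ge> 1 \<Longrightarrow> 0 < b n" and "0 < \<kappa>"
  shows "\<forall>\<^sub>F n in sequentially. a n \<le> \<kappa> * b n"
proof -
  from assms(1) have "(\<lambda>n. a n / b n) \<longlonglongrightarrow> 0" unfolding prec_def .
  from order_tendstoD(2)[OF this \<open>0 < \<kappa>\<close>] eventually_ge_at_top[of 1]
  show ?thesis
  proof eventually_elim
    case (elim n)
    with pos[of n] show ?case by (simp add: divide_less_eq)
  qed
qed

lemma prec_powr_eventually_le:
  assumes "prec a (\<lambda>n. b n powr (1 / u))" and pos: "\<And>n. n \<ge> 1 \<Longrightarrow> 0 < b n"
    and a: "\<And>n. n \<ge> 1 \<Longrightarrow> 0 \<le> a n" and u: "0 < u" and \<kappa>: "0 < \<kappa>"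
  shows "\<forall>\<^sub>F n in sequentially. a n powr u \<le> \<kappa> * b n"
proof -
  have "\<forall>\<^sub>F n in sequentially. a n \<le> \<kappa> powr (1 / u) * b n powr (1 / u)"
    using pos \<kappa> by (intro prec_eventually_le[OF assms(1)]) (auto simp: less_imp_neq[THEN not_sym])
  then show ?thesis using eventually_ge_at_top[of 1]
  proof eventually_elim
    case (elim n)
    have "a n powr u \<le> (\<kappa> powr (1 / u) * b n powr (1 / u)) powr u"
      using elim a[of n] u by (intro powr_mono2) auto
    also have "\<dots> = \<kappa> * b n" using pos[of n] elim \<kappa> u by (simp add: powr_mult powr_powr)
    finally show ?case .
  qed
qed

text \<open>Markov's inequality at the square root of the bound of the expectation.\<close>

lemma expectation_to_probability_bounds:
  fixes f g :: "'a \<Rightarrow> real"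
  assumes "prob_space P" and f [measurable]: "f \<in> borel_measurable P" and g [measurable]: "g \<in> borel_measurable P"
    and f0: "\<And>x. 0 \<le> f x" and le: "(\<integral>\<^sup>+x. ennreal (f x) \<partial>P) \<le> ennreal (exp (- (2 * a)))"
    and compl: "AE x in P. g x = 1 - f x"
  shows "(\<integral>x. f x \<partial>P) \<le> exp (- (2 * a))"
    and "measure P {x \<in> space P. f x \<ge> exp (- a)} \<le> exp (- a)"
    and "1 - exp (- a) \<le> measure P {x \<in> space P. g x \<ge> 1 - exp (- a)}"
proof -
  interpret prob_space P by fact
  show "(\<integral>x. f x \<partial>P) \<le> exp (- (2 * a))" by (rule integral_real_bounded[OF _ le]) simp
  have "{x \<in> space P. f x \<ge> exp (- a)} = {x \<in> space P. 1 \<le> ennreal (exp a) * ennreal (f x)}"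
  proof (intro Collect_cong conj_cong refl)
    fix x
    have "exp (- a) \<le> f x \<longleftrightarrow> 1 \<le> exp a * f x" by (simp add: exp_minus inverse_eq_divide divide_le_eq mult.commute)
    also have "\<dots> \<longleftrightarrow> ennreal 1 \<le> ennreal (exp a * f x)" using f0[of x] by (subst ennreal_le_iff) auto
    also have "\<dots> \<longleftrightarrow> 1 \<le> ennreal (exp a) * ennreal (f x)" using f0[of x] by (simp add: ennreal_mult)
    finally show "exp (- a) \<le> f x \<longleftrightarrow> 1 \<le> ennreal (exp a) * ennreal (f x)" .
  qed
  then have "emeasure P {x \<in> space P. f x \<ge> exp (- a)} \<le> (\<integral>\<^sup>+x. ennreal (exp a) * ennreal (f x) \<partial>P)"
    by (simp only:) (rule Markov_nn_integral, measurable)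
  also have "\<dots> = ennreal (exp a) * (\<integral>\<^sup>+x. ennreal (f x) \<partial>P)" by (rule nn_integral_cmult) measurable
  also have "\<dots> \<le> ennreal (exp a) * ennreal (exp (- (2 * a)))" by (intro mult_left_mono le) simp
  also have "\<dots> = ennreal (exp (- a))" by (simp add: ennreal_mult[symmetric] mult_exp_exp)
  finally show far: "measure P {x \<in> space P. f x \<ge> exp (- a)} \<le> exp (- a)"
    unfolding emeasure_eq_measure by (subst (asm) ennreal_le_iff) auto
  have "1 - exp (- a) \<le> 1 - prob {x \<in> space P. f x \<ge> exp (- a)}" using far by simp
  also have "\<dots> = prob (space P - {x \<in> space P. f x \<ge> exp (- a)})" by (rule prob_compl[symmetric]) measurable
  also have "\<dots> \<le> prob {x \<in> space P. g x \<ge> 1 - exp (- a)}"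
    by (rule finite_measure_mono_AE) (use compl in eventually_elim, auto)
  finally show "1 - exp (- a) \<le> prob {x \<in> space P. g x \<ge> 1 - exp (- a)}" .
qed

theorem theorem2:
  fixes m :: regression
    and K r rbar :: "nat \<Rightarrow> nat"
    and \<nu> :: "nat \<Rightarrow> (nat \<Rightarrow> real) measure"
    and \<beta> :: "nat \<Rightarrow> nat \<Rightarrow> real"
    and V :: "nat \<Rightarrow> nat set \<Rightarrow> real mat"
    and \<epsilon> :: "nat \<Rightarrow> real"
    and B v \<delta> :: real
  assumes "valid_regression m"
    and "\<And>n. n \<ge> 1 \<Longrightarrow> prob_space (\<nu> n)"
    and "\<And>n. n \<ge> 1 \<Longrightarrow> sets (\<nu> n) = sets (PiM {1..K n} (\<lambda>_. borel))"
    and "\<And>n \<gamma>. n \<ge> 1 \<Longrightarrow> \<gamma> \<subseteq> {1..K n} \<Longrightarrow> pos_def_mat (card \<gamma>) (V n \<gamma>)"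
    and "B > 0" and "v > 0"
    and "\<exists>R. \<forall>n\<ge>1. rbar n \<ge> R \<longrightarrow>
      max (SUP \<gamma>\<in>{\<gamma>. \<gamma> \<subseteq> {1..K n} \<and> \<gamma> \<noteq> {} \<and> card \<gamma> \<le> rbar n}. ch1 (V n \<gamma>))
          (SUP \<gamma>\<in>{\<gamma>. \<gamma> \<subseteq> {1..K n} \<and> \<gamma> \<noteq> {} \<and> card \<gamma> \<le> rbar n}. ch1 (inv_mat (V n \<gamma>)))
        \<le> B * real (rbar n) powr v"
    and "\<And>n. n \<ge> 1 \<Longrightarrow> AE x in \<nu> n. \<forall>j\<in>{1..K n}. \<bar>x j\<bar> \<le> 1"
    and "convergent (\<lambda>n. \<Sum>j=1..K n. \<bar>\<beta> n j\<bar>)"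
    and "mono_on {1..} K"
    and "\<delta> > 0" and "prec (\<lambda>n. real n powr \<delta>) (\<lambda>n. real (K n))"
    and "\<And>n. n \<ge> 1 \<Longrightarrow> 0 < \<epsilon> n \<and> \<epsilon> n \<le> 1"
    and "prec (\<lambda>n. 1) (\<lambda>n. real n * (\<epsilon> n)\<^sup>2)"
    and "prec (\<lambda>n. real (rbar n) * ln (real (K n))) (\<lambda>n. real n * (\<epsilon> n)\<^sup>2)"
    and "\<And>n. n \<ge> 1 \<Longrightarrow> 1 \<le> r n \<and> r n \<le> rbar n \<and> rbar n < K n"
    and "prec (\<lambda>n. 1) (\<lambda>n. real (r n))"
    and "prec (\<lambda>n. real (r n)) (\<lambda>n. real (K n))"
    and "prec (\<lambda>n. tail_sum (K n) (\<beta> n) (r n)) (\<lambda>n. (\<epsilon> n)\<^sup>2)"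
    and "is_Normal_Linear m \<or> m = Logistic \<or> m = Probit \<Longrightarrow>
      prec (\<lambda>n. real (rbar n)) (\<lambda>n. (real n * (\<epsilon> n)\<^sup>2) powr (1 / v))"
    and "m = Poisson \<or> m = Exponential \<Longrightarrow>
      prec (\<lambda>n. real (rbar n)) (\<lambda>n. (real n * (\<epsilon> n)\<^sup>2) powr (1 / (4 + v)))"
  shows
    "(\<exists>r\<^sub>0>0. (\<lambda>n. measure (data_law m (K n) (\<beta> n) (\<nu> n) n)
        {D \<in> space (data_law m (K n) (\<beta> n) (\<nu> n) n).
          posterior_prob m (K n) (r n) (rbar n) (V n) n D
            {(\<gamma>, b). hellinger m (K n) (\<beta> n) (\<nu> n) \<gamma> b \<le> \<epsilon> n}
          \<ge> 1 - exp (- r\<^sub>0 * real n * (\<epsilon> n)\<^sup>2)}) \<longlonglongrightarrow> 1)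
    \<and> (\<exists>c\<^sub>1>0. \<forall>\<^sub>F n in sequentially. measure (data_law m (K n) (\<beta> n) (\<nu> n) n)
        {D \<in> space (data_law m (K n) (\<beta> n) (\<nu> n) n).
          posterior_prob m (K n) (r n) (rbar n) (V n) n D
            {(\<gamma>, b). hellinger m (K n) (\<beta> n) (\<nu> n) \<gamma> b > \<epsilon> n}
          \<ge> exp (- 0.5 * c\<^sub>1 * real n * (\<epsilon> n)\<^sup>2)}
        \<le> exp (- 0.5 * c\<^sub>1 * real n * (\<epsilon> n)\<^sup>2))
    \<and> (\<exists>c\<^sub>1>0. \<forall>\<^sub>F n in sequentially.
        (\<integral>D. posterior_prob m (K n) (r n) (rbar n) (V n) n D
            {(\<gamma>, b). hellinger m (K n) (\<beta> n) (\<nu> n) \<gamma> b > \<epsilon> n}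
          \<partial>data_law m (K n) (\<beta> n) (\<nu> n) n)
        \<le> exp (- c\<^sub>1 * real n * (\<epsilon> n)\<^sup>2))"
proof -
  note valid = assms(1) and prob\<nu> = assms(2) and sets\<nu> = assms(3) and pd = assms(4) and B0 = assms(5) and v0 = assms(6)
    and eig = assms(7) and x1 = assms(8) and conv = assms(9) and \<delta>0 = assms(11) and Kn = assms(12)
    and \<epsilon>01 = assms(13) and s_inf = assms(14) and rL = assms(15) and sizes = assms(16) and r_inf = assms(17)
    and tail = assms(19) and growth = assms(20,21)
  define s where "s n = real n * (\<epsilon> n)\<^sup>2" for n
  have s0: "0 < s n" if "n \<ge> 1" for n unfolding s_def using \<epsilon>01[OF that] that by simp
  obtain c where c: "1 \<le> c" and chi: "\<And>H h h' d. 0 \<le> H \<Longrightarrow> \<bar>h\<bar> \<le> H \<Longrightarrow> \<bar>h'\<bar> \<le> H \<Longrightarrow> \<bar>h - h'\<bar> \<le> d \<Longrightarrow>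
       c * chi_growth m H * d \<le> 1 \<Longrightarrow> chi_square m h h' \<le> ennreal ((c * chi_growth m H * d)\<^sup>2)"
    using chi_square_bound[OF valid] by blast
  obtain M\<^sub>0 where M\<^sub>0: "\<And>n. norm (\<Sum>j=1..K n. \<bar>\<beta> n j\<bar>) \<le> M\<^sub>0"
    using convergent_imp_Bseq[OF conv] unfolding Bseq_def by blast
  define M where "M = M\<^sub>0 + 1"
  have M: "(\<Sum>j=1..K n. \<bar>\<beta> n j\<bar>) + 1 \<le> M" for n using M\<^sub>0[of n] unfolding M_def by simp
  have "0 \<le> M\<^sub>0" by (rule order.trans[OF norm_ge_zero M\<^sub>0])
  then have M'1: "1 \<le> chi_growth m M" unfolding M_def by (intro chi_growth_ge_1) simp
  define B' where "B' = max B 1"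
  have B': "1 \<le> B'" "B \<le> B'" unfolding B'_def by auto
  define p where "p = 1 / \<delta>"
  have p0: "0 < p" unfolding p_def using \<delta>0 by simp
  define L where "L n = ln (real (K n))" for n
  have r_large: "\<forall>\<^sub>F n in sequentially. X \<le> real (r n)" for X
  proof -
    have "\<forall>\<^sub>F n in sequentially. 1 \<le> (1 / (\<bar>X\<bar> + 1)) * real (r n)"
      using sizes by (intro prec_eventually_le[OF r_inf]) (auto simp: Suc_le_eq)
    then show ?thesis by eventually_elim (rule le_of_one_le_scaled)
  qed
  have L_large: "\<forall>\<^sub>F n in sequentially. X \<le> L n" for X
    using r_large[of "exp X"] eventually_ge_at_top[of 1]
  proof eventually_elim
    case (elim n)
    have "exp X \<le> real (K n)" using elim(1) sizes[OF elim(2)] by linarith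
    moreover have "0 < real (K n)" using sizes[OF elim(2)] by simp
    ultimately have "ln (exp X) \<le> ln (real (K n))" by (subst ln_le_cancel_iff) simp_all
    then show ?case unfolding L_def by simp
  qed
  have s_large: "\<forall>\<^sub>F n in sequentially. X \<le> s n" for X
  proof -
    have "\<forall>\<^sub>F n in sequentially. 1 \<le> (1 / (\<bar>X\<bar> + 1)) * s n"
      unfolding s_def using s0[unfolded s_def] by (intro prec_eventually_le[OF s_inf]) auto
    then show ?thesis by eventually_elim (rule le_of_one_le_scaled)
  qed
  have rL_small: "\<forall>\<^sub>F n in sequentially. real (rbar n) * L n \<le> \<kappa> * s n" if "0 < \<kappa>" for \<kappa>
    using prec_eventually_le[OF rL s0[unfolded s_def] that] unfolding L_def s_def .
  have ln_n: "\<forall>\<^sub>F n in sequentially. ln (real n) \<le> p * L n"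
  proof -
    have "\<forall>\<^sub>F n in sequentially. real n powr \<delta> \<le> 1 * real (K n)"
    proof (rule prec_eventually_le[OF Kn])
      show "0 < real (K n)" if "n \<ge> 1" for n using sizes[OF that] by simp
    qed simp
    then show ?thesis using eventually_ge_at_top[of 1]
    proof eventually_elim
      case (elim n)
      have "ln (real n powr \<delta>) \<le> ln (real (K n))"
        using elim sizes[OF elim(2)] by (subst ln_le_cancel_iff) auto
      then have "\<delta> * ln (real n) \<le> L n" unfolding L_def using elim(2) by (simp add: ln_powr)
      then show ?case unfolding p_def using \<delta>0 by (simp add: field_simps)
    qed
  qed
  have pois: "\<forall>\<^sub>F n in sequentially. real (rbar n) powr (4 + v) \<le> \<kappa> * s n"
    if "m = Poisson \<or> m = Exponential" "0 < \<kappa>" for \<kappa>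
    unfolding s_def
    using s0[unfolded s_def] v0 that by (intro prec_powr_eventually_le[OF growth(2)]) auto
  \<comment> \<open>In Poisson and exponential regression the assumption is on the power \<open>4 + v\<close>, which dominates since
    \<open>rbar \<ge> 1\<close>.\<close>
  have rv: "\<forall>\<^sub>F n in sequentially. real (rbar n) powr v \<le> \<kappa> * s n" if \<kappa>: "0 < \<kappa>" for \<kappa>
  proof (cases "m = Poisson \<or> m = Exponential")
    case True
    from pois[OF this \<kappa>] eventually_ge_at_top[of 1] show ?thesis
    proof eventually_elim
      case (elim n)
      have "real (rbar n) powr v \<le> real (rbar n) powr (4 + v)" using sizes[OF elim(2)] by (intro powr_mono) auto
      with elim(1) show ?case by linarith
    qed
  next
    case False
    then have "is_Normal_Linear m \<or> m = Logistic \<or> m = Probit" by (cases m) auto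
    from growth(1)[OF this] show ?thesis
      unfolding s_def using s0[unfolded s_def] v0 \<kappa> by (intro prec_powr_eventually_le) auto
  qed
  have tail_small: "\<forall>\<^sub>F n in sequentially. tail_sum (K n) (\<beta> n) (r n) \<le> \<kappa> * (\<epsilon> n)\<^sup>2" if "0 < \<kappa>" for \<kappa>
    using \<epsilon>01 that by (intro prec_eventually_le[OF tail]) fastforce+
  obtain R where R: "\<And>n. n \<ge> 1 \<Longrightarrow> rbar n \<ge> R \<Longrightarrow>
      max (SUP \<gamma>\<in>{\<gamma>. \<gamma> \<subseteq> {1..K n} \<and> \<gamma> \<noteq> {} \<and> card \<gamma> \<le> rbar n}. ch1 (V n \<gamma>))
          (SUP \<gamma>\<in>{\<gamma>. \<gamma> \<subseteq> {1..K n} \<and> \<gamma> \<noteq> {} \<and> card \<gamma> \<le> rbar n}. ch1 (inv_mat (V n \<gamma>)))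
        \<le> B * real (rbar n) powr v" using eig by blast
  define t where "t n = B' * real (rbar n) powr v" for n
  \<comment> \<open>The shares of the budgets \<open>s / 16\<close> for the prior mass (A and B) and \<open>s / 4\<close> for the net (C and D).\<close>
  let ?kA = "1 / (32 * (6 + 2 * v + p))" and ?kB = "1 / (32 * (M\<^sup>2 * B' / 2 + 1))" and ?kC = "1 / (8 * (9 + 2 * v + 3 * p))"
    and ?kD = "1 / (64 * B')"
  have k0: "0 < ?kA" "0 < ?kB" "0 < ?kC" "0 < ?kD" "0 < 1 / (128 * c * chi_growth m M)"
    using v0 p0 B' c M'1 by (auto intro!: divide_pos_pos add_nonneg_pos mult_pos_pos)
  have pois': "\<forall>\<^sub>F n in sequentially. m = Poisson \<longrightarrow> real (rbar n) powr (4 + v) \<le> ?kD * s n"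
  proof (cases "m = Poisson")
    case True
    then show ?thesis using pois[of ?kD] k0 by simp
  qed simp
  have cancel: "a * (1 / (k * a) * x) = x / k" if "0 < a" for a k x :: real
    using that by simp
  let ?post = "\<lambda>n D A. posterior_prob m (K n) (r n) (rbar n) (V n) n D A"
  let ?P = "\<lambda>n. data_law m (K n) (\<beta> n) (\<nu> n) n"
  let ?far = "\<lambda>n. {(\<gamma>, b). hellinger m (K n) (\<beta> n) (\<nu> n) \<gamma> b > \<epsilon> n}"
  let ?near = "\<lambda>n. {(\<gamma>, b). hellinger m (K n) (\<beta> n) (\<nu> n) \<gamma> b \<le> \<epsilon> n}"
  have main: "\<forall>\<^sub>F n in sequentially.
      (\<integral>D. ?post n D (?far n) \<partial>?P n) \<le> exp (- (2 * (s n / 64))) \<and>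
      measure (?P n) {D \<in> space (?P n). ?post n D (?far n) \<ge> exp (- (s n / 64))} \<le> exp (- (s n / 64)) \<and>
      1 - exp (- (s n / 64)) \<le> measure (?P n) {D \<in> space (?P n). ?post n D (?near n) \<ge> 1 - exp (- (s n / 64))} \<and>
      measure (?P n) {D \<in> space (?P n). ?post n D (?near n) \<ge> 1 - exp (- (s n / 64))} \<le> 1"
    using eventually_ge_at_top[of 1] s_large[of 64] L_large[of 1] L_large[of "ln (11 * c)"] L_large[of "ln (2 * B')"]
      L_large[of "ln (256 * B' * c * chi_growth m M)"] ln_n rL_small[OF k0(1)] rv[OF k0(2)] rL_small[OF k0(3)]
      pois' tail_small[OF k0(5)] r_large[of "real R"]
  proof eventually_elim
    case (elim n)
    note n1 = elim(1)
    have sz: "1 \<le> r n" "r n \<le> rbar n" "rbar n < K n" using sizes[OF n1] by auto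
    have rb1: "1 \<le> real (rbar n)" using sz by simp
    have rv1: "1 \<le> real (rbar n) powr v" using rb1 v0 by (intro ge_one_powr_ge_zero) auto
    have t1: "1 \<le> t n" unfolding t_def using mult_mono[OF B'(1) rv1] B' by simp
    let ?S = "{\<gamma>. \<gamma> \<subseteq> {1..K n} \<and> \<gamma> \<noteq> {} \<and> card \<gamma> \<le> rbar n}"
    have finS: "finite ?S" by (rule finite_subset[of _ "Pow {1..K n}"]) auto
    have "R \<le> rbar n" using elim(13) sz by linarith
    from R[OF n1 this] have sup: "(SUP \<gamma>\<in>?S. ch1 (V n \<gamma>)) \<le> t n" "(SUP \<gamma>\<in>?S. ch1 (inv_mat (V n \<gamma>))) \<le> t n"
      using mult_right_mono[OF B'(2), of "real (rbar n) powr v"] unfolding t_def by auto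
    have ch: "ch1 (V n \<gamma>) \<le> t n" "ch1 (inv_mat (V n \<gamma>)) \<le> t n"
      if "\<gamma> \<subseteq> {1..K n}" "\<gamma> \<noteq> {}" "card \<gamma> \<le> rbar n" for \<gamma>
    proof -
      have "\<gamma> \<in> ?S" using that by simp
      then show "ch1 (V n \<gamma>) \<le> t n" "ch1 (inv_mat (V n \<gamma>)) \<le> t n"
        using order.trans[OF cSUP_upper sup(1)] order.trans[OF cSUP_upper sup(2)] finS
        by (simp_all add: bdd_above_finite)
    qed
    interpret prob_space "\<nu> n" by (rule prob\<nu>[OF n1])
    interpret S: selection_model "\<nu> n" m "K n" "r n" "rbar n" n "\<beta> n" "V n" "t n"
      using valid sets\<nu>[OF n1] x1[OF n1] pd[OF n1] sz t1 ch by unfold_locales auto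
    have bound: "(\<integral>\<^sup>+D. ennreal (?post n D (S.far (\<epsilon> n))) \<partial>S.data n) \<le> ennreal (4 * exp (- (real n * (\<epsilon> n)\<^sup>2) / 16))"
    proof (rule S.posterior_far_exponential[where B = B' and v = v and p = p and c = c and M = M])
      show "0 < \<epsilon> n" "\<epsilon> n \<le> 1" using \<epsilon>01[OF n1] by auto
      show "1 \<le> real n * (\<epsilon> n)\<^sup>2" using elim(2) unfolding s_def by simp
      show "tail_sum (K n) (\<beta> n) (r n) \<le> (\<epsilon> n)\<^sup>2 / (128 * c * chi_growth m M)" using elim(12) unfolding times_divide_eq_left mult_1_left .
      have "(6 + 2 * v + p) * (real (rbar n) * L n) \<le> (6 + 2 * v + p) * (?kA * s n)"
        by (intro mult_left_mono elim(8)) (use v0 p0 in simp)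
      also have "\<dots> = s n / 32" by (rule cancel) (use v0 p0 in simp)
      finally have b1: "(6 + 2 * v + p) * (real (rbar n) * L n) \<le> s n / 32" .
      let ?a = "M\<^sup>2 * B' / 2"
      have a0: "0 \<le> ?a" using B' by simp
      have "?a * real (rbar n) powr v \<le> (?a + 1) * real (rbar n) powr v"
        by (intro mult_right_mono) simp_all
      also have "\<dots> \<le> (?a + 1) * (?kB * s n)" by (intro mult_left_mono elim(9)) (use a0 in simp)
      also have "\<dots> = s n / 32" by (rule cancel) (use a0 in simp)
      finally have b2: "?a * real (rbar n) powr v \<le> s n / 32" .
      show "(6 + 2 * v + p) * (real (rbar n) * ln (real (K n))) + M\<^sup>2 * B' / 2 * real (rbar n) powr v \<le> real n * (\<epsilon> n)\<^sup>2 / 16"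
        using b1 b2 unfolding L_def s_def by linarith
      have "(9 + 2 * v + 3 * p) * (real (rbar n) * L n) \<le> (9 + 2 * v + 3 * p) * (?kC * s n)"
        by (intro mult_left_mono elim(10)) (use v0 p0 in simp)
      also have "\<dots> = s n / 8" by (rule cancel) (use v0 p0 in simp)
      finally have b3: "(9 + 2 * v + 3 * p) * (real (rbar n) * L n) \<le> s n / 8" .
      have b4: "(if m = Poisson then (real (rbar n))\<^sup>2 * sqrt (t n * s n) else 0) \<le> s n / 8"
      proof (cases "m = Poisson")
        case True
        have sq: "(x\<^sup>2 * sqrt y)\<^sup>2 = x ^ 4 * y" if "0 \<le> y" for x y :: real
        proof -
          have "(x\<^sup>2)\<^sup>2 = x ^ 4" unfolding power_mult[symmetric] by simp
          then show ?thesis unfolding power_mult_distrib using that by simp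
        qed
        have quot: "(1 / (64 * b) * y) * (b * y) = (y / 8)\<^sup>2" if "0 < b" for b y :: real
          using that by (simp add: power2_eq_square)
        have ts: "0 \<le> t n * s n" using s0[OF n1] t1 by simp
        have "((real (rbar n))\<^sup>2 * sqrt (t n * s n))\<^sup>2 = real (rbar n) ^ 4 * (t n * s n)" by (rule sq[OF ts])
        also have "\<dots> = (real (rbar n) ^ 4 * real (rbar n) powr v) * (B' * s n)"
          unfolding t_def by (simp only: mult_ac)
        also have "real (rbar n) ^ 4 * real (rbar n) powr v = real (rbar n) powr (4 + v)"
        proof -
          have "real (rbar n) powr 4 = real (rbar n) ^ 4" using rb1 by (intro powr_numeral) simp
          then show ?thesis unfolding powr_add by (simp only:)
        qed
        also have "\<dots> * (B' * s n) \<le> (?kD * s n) * (B' * s n)"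
          by (intro mult_right_mono elim(11)[rule_format, OF True]) (use s0[OF n1] B' in simp)
        also have "\<dots> = (s n / 8)\<^sup>2" by (rule quot) (use B' in simp)
        finally have "(real (rbar n))\<^sup>2 * sqrt (t n * s n) \<le> s n / 8"
          by (rule power2_le_imp_le) (use s0[OF n1] in simp)
        then show ?thesis unfolding if_P[OF True] .
      qed (use s0[OF n1] in simp)
      show "(9 + 2 * v + 3 * p) * (real (rbar n) * ln (real (K n))) +
          (if m = Poisson then (real (rbar n))\<^sup>2 * sqrt (t n * (real n * (\<epsilon> n)\<^sup>2)) else 0) \<le> real n * (\<epsilon> n)\<^sup>2 / 4"
        using b3 b4 unfolding L_def s_def by linarith
      show "1 \<le> B'" by (rule B'(1))
      show "0 \<le> v" "0 \<le> p" using v0 p0 by simp_all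
      show "t n = B' * real (rbar n) powr v" by (rule t_def)
      show "1 \<le> c" by (rule c)
      show "(\<Sum>j=1..K n. \<bar>\<beta> n j\<bar>) + 1 \<le> M" by (rule M)
      show "1 \<le> ln (real (K n))" "ln (real n) \<le> p * ln (real (K n))" "ln (11 * c) \<le> ln (real (K n))"
        "ln (2 * B') \<le> ln (real (K n))" "ln (256 * B' * c * chi_growth m M) \<le> ln (real (K n))"
        by (rule elim(3)[unfolded L_def] elim(7)[unfolded L_def] elim(4)[unfolded L_def] elim(5)[unfolded L_def]
            elim(6)[unfolded L_def])+
      fix H h h' d :: real
      assume "0 \<le> H" "\<bar>h\<bar> \<le> H" "\<bar>h'\<bar> \<le> H" "\<bar>h - h'\<bar> \<le> d" "c * chi_growth m H * d \<le> 1"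
      then show "chi_square m h h' \<le> ennreal ((c * chi_growth m H * d)\<^sup>2)" by (rule chi)
    qed
    have far_eq: "S.far (\<epsilon> n) = ?far n" unfolding S.far_def ..
    have "4 * exp (- (s n) / 16) \<le> exp (s n / 32) * exp (- (s n) / 16)"
    proof (intro mult_right_mono)
      have "4 \<le> (1 + 1 :: real) ^ 2" by simp
      also have "\<dots> \<le> exp 1 ^ 2" using exp_ge_add_one_self[of 1] by (intro power_mono) auto
      also have "\<dots> = exp 2" by (simp add: exp_of_nat_mult[symmetric])
      also have "\<dots> \<le> exp (s n / 32)" using elim(2) by simp
      finally show "4 \<le> exp (s n / 32)" .
    qed simp
    also have "\<dots> = exp (- (2 * (s n / 64)))" by (simp add: mult_exp_exp)
    finally have small: "4 * exp (- (s n) / 16) \<le> exp (- (2 * (s n / 64)))" .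
    have E: "(\<integral>\<^sup>+D. ennreal (?post n D (?far n)) \<partial>?P n) \<le> ennreal (exp (- (2 * (s n / 64))))"
      unfolding S.data_law_eq far_eq[symmetric]
      by (rule order.trans[OF bound]) (use small in \<open>simp add: s_def ennreal_leI\<close>)
    have pr: "prob_space (?P n)" unfolding S.data_law_eq by (rule S.prob_space_data)
    have mf: "(\<lambda>D. ?post n D (?far n)) \<in> borel_measurable (?P n)"
      unfolding S.data_law_eq far_eq[symmetric]
      by (rule S.posterior_prob_measurable[OF S.measurable_event_far])
    have mn: "(\<lambda>D. ?post n D (?near n)) \<in> borel_measurable (?P n)"
      unfolding S.data_law_eq
      by (rule S.posterior_prob_measurable[OF S.measurable_event_hellinger]) simp
    have compl: "AE D in ?P n. ?post n D (?near n) = 1 - ?post n D (?far n)"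
      unfolding S.data_law_eq far_eq[symmetric] by (rule S.posterior_near_complement)
    have nonneg: "0 \<le> ?post n D (?far n)" for D unfolding posterior_prob_def by simp
    show ?case
      using expectation_to_probability_bounds[OF pr mf mn nonneg E compl] prob_space.prob_le_1[OF pr] by blast
  qed
  have e2: "- 0.5 * (1 / 32) * real n * (\<epsilon> n)\<^sup>2 = - (s n / 64)" for n unfolding s_def by simp
  have e1: "- (1 / 64) * real n * (\<epsilon> n)\<^sup>2 = - (s n / 64)" for n unfolding s_def by simp
  have e3: "- (1 / 32) * real n * (\<epsilon> n)\<^sup>2 = - (2 * (s n / 64))" for n unfolding s_def by simp
  have "filterlim (\<lambda>n. - (s n / 64)) at_bot sequentially"
    unfolding filterlim_at_bot
  proof
    fix Z :: real
    show "\<forall>\<^sub>F n in sequentially. - (s n / 64) \<le> Z" using s_large[of "- 64 * Z"] by eventually_elim simp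
  qed
  from tendsto_diff[OF tendsto_const filterlim_compose[OF exp_at_bot this], of 1]
  have lim: "(\<lambda>n. 1 - exp (- (s n / 64))) \<longlonglongrightarrow> 1" by simp
  show ?thesis
  proof (intro conjI)
    show "\<exists>r\<^sub>0>0. (\<lambda>n. measure (?P n) {D \<in> space (?P n). ?post n D (?near n)
          \<ge> 1 - exp (- r\<^sub>0 * real n * (\<epsilon> n)\<^sup>2)}) \<longlonglongrightarrow> 1"
    proof (rule exI[of _ "1 / 64"], unfold e1, rule conjI)
      show "(\<lambda>n. measure (?P n) {D \<in> space (?P n). ?post n D (?near n) \<ge> 1 - exp (- (s n / 64))}) \<longlonglongrightarrow> 1"
        by (rule tendsto_sandwich[OF _ _ lim tendsto_const]; use main in eventually_elim, blast)
    qed simp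
    show "\<exists>c\<^sub>1>0. \<forall>\<^sub>F n in sequentially. measure (?P n)
        {D \<in> space (?P n). ?post n D (?far n) \<ge> exp (- 0.5 * c\<^sub>1 * real n * (\<epsilon> n)\<^sup>2)}
        \<le> exp (- 0.5 * c\<^sub>1 * real n * (\<epsilon> n)\<^sup>2)"
    proof (rule exI[of _ "1 / 32"], unfold e2, rule conjI)
      show "\<forall>\<^sub>F n in sequentially. measure (?P n) {D \<in> space (?P n). ?post n D (?far n) \<ge> exp (- (s n / 64))}
        \<le> exp (- (s n / 64))" using main by eventually_elim blast
    qed simp
    show "\<exists>c\<^sub>1>0. \<forall>\<^sub>F n in sequentially. (\<integral>D. ?post n D (?far n) \<partial>?P n) \<le> exp (- c\<^sub>1 * real n * (\<epsilon> n)\<^sup>2)"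
    proof (rule exI[of _ "1 / 32"], unfold e3, rule conjI)
      show "\<forall>\<^sub>F n in sequentially. (\<integral>D. ?post n D (?far n) \<partial>?P n) \<le> exp (- (2 * (s n / 64)))"
        using main by eventually_elim blast
    qed simp
  qed
qed

end
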